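(* Let $\sigma^2>0$ and let $\mathbf{\Xi}_N$ be a (normalized) periodically banded GUE matrix of band width $b_N$, where $(b_N)$ is a sequence of nonnegative integers with $b_N\to\infty$; that is, $\mathbf{\Xi}_N(j,k)=\frac{1}{\sqrt{\xi_N}}\mathbf{1}\{|j-k|_N\le b_N\}\mathbf{X}_N(j,k)$ with $\mathbf{X}_N\sim\mathrm{GUE}(N,\sigma^2)$, $|j-k|_N=\min(|j-k|,N-|j-k|)$ and $\xi_N=\min(2b_N+1,N)$. Suppose that $b_N/\sqrt N\to\infty$ or that $\lim_{N\to\infty}\frac{b_N}{\sqrt N}=c\in(0,\infty)$. Then for any fixed $N_0\in\mathbb{N}$, the three families $\{\mathbf{\Xi}_N\}$, $(\mathbf{E}_N^{(j,k)})_{j,k\in[N_0]}$ and $\{\frac1N\mathbf{J}_N\}$ are asymptotically infinitesimally free, where $\mathbf{E}_N^{(j,k)}$ is the $N\times N$ matrix unit with a $1$ in coordinate $(j,k)$ and $\mathbf{J}_N$ is the $N\times N$ all-ones matrix.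
   Context: $[N]=\{1,\dots,N\}$. $\mathrm{GUE}(N,\sigma^2)$ is the law of a self-adjoint $N\times N$ complex Gaussian matrix, with entries on and above the diagonal independent and centered, real diagonal entries of variance $\sigma^2$, and off-diagonal entries with independent real and imaginary parts of variance $\sigma^2/2$ each. An infinitesimal non-commutative (NC) probability space $(\mathcal{A},\varphi,\varphi')$ is a unital complex algebra $\mathcal{A}$ with a unital linear functional $\varphi$ and a linear functional $\varphi'$ with $\varphi'(1)=0$. Unital subalgebras $(\mathcal{A}_i)_{i\in I}$ are infinitesimally free if for all $k\ge2$, all consecutively distinct indices $i(1)\ne i(2)\ne\cdots\ne i(k)$ and all $a_j\in\mathcal{A}_{i(j)}$ with $\varphi(a_j)=0$: (i) $\varphi(a_1\cdots a_k)=0$; (ii) $\varphi'(a_1\cdots a_k)=\sum_{j=1}^k\varphi'(a_j)\,\varphi(a_1\cdots a_{j-1}a_{j+1}\cdots a_k)$. Collections of elements are infinitesimally free if the unital subalgebras they generate are. For a family $\mathcal{A}_N=(\mathbf{A}_N^{(i)})_{i\in I}$ of random $N\times N$ matrices with entries having all moments, and non-commuting indeterminates $\mathbf{x}=(x_i)_{i\in I}$, put $\mu_{\mathcal{A}_N}(P)=\frac1N\mathbb{E}[\mathrm{Tr}(P(\mathcal{A}_N))]$ for $P\in\mathbb{C}\langle\mathbf{x}\rangle$. If $\mu_{\mathbf{x}}(P)=\lim_N\mu_{\mathcal{A}_N}(P)$ and $\nu_{\mathbf{x}}(P)=\lim_N N(\mu_{\mathcal{A}_N}(P)-\mu_{\mathbf{x}}(P))$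 exist (finite) for all $P$, then $\nu_{\mathbf{x}}$ is called the infinitesimal distribution of $\mathcal{A}_N$. Families of random matrices are asymptotically infinitesimally free if their union has such limits $(\mu_{\mathbf{x}},\nu_{\mathbf{x}})$ and the corresponding collections of indeterminates are infinitesimally free in $(\mathbb{C}\langle\mathbf{x}\rangle,\mu_{\mathbf{x}},\nu_{\mathbf{x}})$. *)

theory Defs
  imports
    "HOL-Probability.Probability"
    "HOL-Library.Poly_Mapping"
    "Jordan_Normal_Form.Matrix"
    "Jordan_Normal_Form.Schur_Decomposition"
begin

section \<open>Complex algebras and infinitesimal freeness\<close>

locale complex_algebra = vector_space scale
  for scale :: "complex \<Rightarrow> 'a::ring_1 \<Rightarrow> 'a" +
  assumes scale_mult_left: "scale c x * y = scale c (x * y)"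
    and scale_mult_right: "x * scale c y = scale c (x * y)"
begin

definition unital_subalgebra :: "'a set \<Rightarrow> bool" where
  "unital_subalgebra B \<longleftrightarrow> subspace B \<and> 1 \<in> B \<and> (\<forall>x\<in>B. \<forall>y\<in>B. x * y \<in> B)"

end

text \<open>The algebra is a carrier set \<open>A\<close> (a unital subalgebra of the ambient type), so that
  \<open>\<complex>\<langle>x\<^sub>i : i \<in> I\<rangle>\<close> is available for an arbitrary index \<^emph>\<open>set\<close> \<open>I\<close>. Nothing is required of
  \<open>\<phi>\<close> and \<open>\<phi>'\<close> outside \<open>A\<close>.\<close>

locale inf_nc_prob_space = complex_algebra scale
  for scale :: "complex \<Rightarrow> 'a::ring_1 \<Rightarrow> 'a" +
  fixes A :: "'a set" and \<phi> \<phi>' :: "'a \<Rightarrow> complex"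
  assumes subalgebra: "unital_subalgebra A"
    and add: "\<lbrakk>x \<in> A; y \<in> A\<rbrakk> \<Longrightarrow> \<phi> (x + y) = \<phi> x + \<phi> y"
    and scale: "x \<in> A \<Longrightarrow> \<phi> (scale c x) = c * \<phi> x"
    and one: "\<phi> 1 = 1"
    and add': "\<lbrakk>x \<in> A; y \<in> A\<rbrakk> \<Longrightarrow> \<phi>' (x + y) = \<phi>' x + \<phi>' y"
    and scale': "x \<in> A \<Longrightarrow> \<phi>' (scale c x) = c * \<phi>' x"
    and one': "\<phi>' 1 = 0"
begin

text \<open>In the following definition the factors are numbered \<open>0, \<dots>, k - 1\<close>.\<close>

definition infinitesimally_free :: "'l set \<Rightarrow> ('l \<Rightarrow> 'a set) \<Rightarrow> bool" where
  "infinitesimally_free L B \<longleftrightarrow>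
     (\<forall>l\<in>L. unital_subalgebra (B l) \<and> B l \<subseteq> A) \<and>
     (\<forall>k\<ge>2. \<forall>(i :: nat \<Rightarrow> 'l) (a :: nat \<Rightarrow> 'a).
        (\<forall>j<k. i j \<in> L \<and> a j \<in> B (i j) \<and> \<phi> (a j) = 0) \<and>
        (\<forall>j. Suc j < k \<longrightarrow> i j \<noteq> i (Suc j)) \<longrightarrow>
          \<phi> (prod_list (map a [0..<k])) = 0 \<and>
          \<phi>' (prod_list (map a [0..<k])) =
            (\<Sum>j<k. \<phi>' (a j) * \<phi> (prod_list (map a ([0..<j] @ [Suc j..<k])))))"

definition collections_infinitesimally_free :: "'l set \<Rightarrow> ('l \<Rightarrow> 'a set) \<Rightarrow> bool" where
  "collections_infinitesimally_free L S \<longleftrightarrow>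
     infinitesimally_free L (\<lambda>l. unital_subalgebra hull S l)"

end


section \<open>Polynomials in non-commuting indeterminates\<close>

text \<open>Monomials form the free monoid, written additively because the convolution product on
  \<^typ>\<open>'m \<Rightarrow>\<^sub>0 complex\<close> is set up for additive monoids of exponents.\<close>

datatype 'i nc_monomial = Monomial (letters: "'i list")

instantiation nc_monomial :: (type) monoid_add
begin

definition zero_nc_monomial :: "'a nc_monomial" where
  "0 = Monomial []"

definition plus_nc_monomial :: "'a nc_monomial \<Rightarrow> 'a nc_monomial \<Rightarrow> 'a nc_monomial" where
  "u + w = Monomial (letters u @ letters w)"

instance
  by standard (simp_all add: zero_nc_monomial_def plus_nc_monomial_def)

end

type_synonym 'i nc_poly = "'i nc_monomial \<Rightarrow>\<^sub>0 complex"

definition nc_scale :: "complex \<Rightarrow> 'i nc_poly \<Rightarrow> 'i nc_poly" where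
  "nc_scale c P = Poly_Mapping.single 0 c * P"

definition nc_var :: "'i \<Rightarrow> 'i nc_poly" where
  "nc_var i = Poly_Mapping.single (Monomial [i]) 1"

definition nc_polys :: "'i set \<Rightarrow> 'i nc_poly set" where
  "nc_polys I = {P. \<forall>w\<in>Poly_Mapping.keys P. set (letters w) \<subseteq> I}"

lemma single_zero_mult_commute:
  "Poly_Mapping.single 0 c * (P :: 'i nc_poly) = P * Poly_Mapping.single 0 c"
proof (induction P rule: update_induct)
  case const
  show ?case by simp
next
  case (update f a b)
  then have "Poly_Mapping.update a b f = f + Poly_Mapping.single a b"
    by (intro poly_mapping_eqI)
       (auto simp: lookup_update lookup_add lookup_single in_keys_iff)
  with update show ?case
    by (simp add: distrib_left distrib_right mult_single mult.commute)
qed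

interpretation nc_poly: complex_algebra "nc_scale :: complex \<Rightarrow> 'i nc_poly \<Rightarrow> 'i nc_poly"
proof
  fix c d :: complex and P Q :: "'i nc_poly"
  show "nc_scale c (P + Q) = nc_scale c P + nc_scale c Q"
    by (simp add: nc_scale_def algebra_simps)
  show "nc_scale (c + d) P = nc_scale c P + nc_scale d P"
    by (simp add: nc_scale_def algebra_simps single_add)
  show "nc_scale c (nc_scale d P) = nc_scale (c * d) P"
    by (simp add: nc_scale_def mult_single flip: mult.assoc)
  show "nc_scale 1 P = P"
    by (simp add: nc_scale_def)
  show "nc_scale c P * Q = nc_scale c (P * Q)"
    by (simp add: nc_scale_def mult.assoc)
  show "P * nc_scale c Q = nc_scale c (P * Q)"
    unfolding nc_scale_def by (metis mult.assoc single_zero_mult_commute)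
qed

definition eval_monomial :: "nat \<Rightarrow> ('i \<Rightarrow> complex mat) \<Rightarrow> 'i nc_monomial \<Rightarrow> complex mat" where
  "eval_monomial N A w = foldr (\<lambda>i B. A i * B) (letters w) (1\<^sub>m N)"

definition eval_poly :: "nat \<Rightarrow> ('i \<Rightarrow> complex mat) \<Rightarrow> 'i nc_poly \<Rightarrow> complex mat" where
  "eval_poly N A P = Matrix.mat N N (\<lambda>(r, s).
     \<Sum>w\<in>Poly_Mapping.keys P. Poly_Mapping.lookup P w * eval_monomial N A w $$ (r, s))"


section \<open>Families of random matrices and their limits\<close>

definition mat_trace :: "complex mat \<Rightarrow> complex" where
  "mat_trace A = (\<Sum>r<dim_row A. A $$ (r, r))"

context prob_space
begin

definition random_matrix :: "nat \<Rightarrow> ('a \<Rightarrow> complex mat) \<Rightarrow> bool" where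
  "random_matrix N X \<longleftrightarrow>
     (\<forall>\<omega>\<in>space M. X \<omega> \<in> carrier_mat N N) \<and>
     (\<forall>r<N. \<forall>s<N. random_variable borel (\<lambda>\<omega>. X \<omega> $$ (r, s)))"

definition has_all_moments :: "nat \<Rightarrow> ('a \<Rightarrow> complex mat) \<Rightarrow> bool" where
  "has_all_moments N X \<longleftrightarrow>
     (\<forall>r<N. \<forall>s<N. \<forall>p::nat. integrable M (\<lambda>\<omega>. norm (X \<omega> $$ (r, s)) ^ p))"

definition mean_distr :: "nat \<Rightarrow> ('i \<Rightarrow> 'a \<Rightarrow> complex mat) \<Rightarrow> 'i nc_poly \<Rightarrow> complex" where
  "mean_distr N A P =
     1 / of_nat N * expectation (\<lambda>\<omega>. mat_trace (eval_poly N (\<lambda>i. A i \<omega>) P))"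

end

text \<open>\<open>A N i\<close> is the \<open>i\<close>-th random matrix of size \<open>N\<close>, defined on the probability space \<open>M N\<close>,
  and \<open>F l\<close> is the set of indices of the \<open>l\<close>-th family. Matrices of size \<open>0\<close> are ignored.\<close>

definition asymptotically_infinitesimally_free ::
  "(nat \<Rightarrow> 'w measure) \<Rightarrow> (nat \<Rightarrow> 'i \<Rightarrow> 'w \<Rightarrow> complex mat) \<Rightarrow> 'l set \<Rightarrow> ('l \<Rightarrow> 'i set) \<Rightarrow> bool" where
  "asymptotically_infinitesimally_free M A L F \<longleftrightarrow>
     (let I = (\<Union>l\<in>L. F l) in
       disjoint_family_on F L \<and>
       (\<forall>N>0. \<forall>i\<in>I. prob_space.random_matrix (M N) N (A N i) \<and>
                     prob_space.has_all_moments (M N) N (A N i)) \<and>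
       (\<exists>\<mu> \<nu>.
         (\<forall>P\<in>nc_polys I.
            (\<lambda>N. prob_space.mean_distr (M N) N (A N) P) \<longlonglongrightarrow> \<mu> P \<and>
            (\<lambda>N. of_nat N * (prob_space.mean_distr (M N) N (A N) P - \<mu> P)) \<longlonglongrightarrow> \<nu> P) \<and>
         inf_nc_prob_space nc_scale (nc_polys I) \<mu> \<nu> \<and>
         inf_nc_prob_space.collections_infinitesimally_free
           nc_scale (nc_polys I) \<mu> \<nu> L (\<lambda>l. nc_var ` F l)))"


section \<open>The random matrix models\<close>

text \<open>Rows and columns are numbered from \<open>0\<close>, as usual for \<^typ>\<open>complex mat\<close>. The second argument
  of \<open>gue\<close> is the variance \<open>\<sigma>\<^sup>2\<close>, whereas \<^const>\<open>normal_density\<close> expects standard deviations.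
  The law determines self-adjointness only almost surely; together with it, the real parts
  describe the diagonal entries completely.\<close>

definition (in prob_space) gue :: "nat \<Rightarrow> real \<Rightarrow> ('a \<Rightarrow> complex mat) \<Rightarrow> bool" where
  "gue N v X \<longleftrightarrow>
     random_matrix N X \<and>
     (AE \<omega> in M. mat_adjoint (X \<omega>) = X \<omega>) \<and>
     indep_vars (\<lambda>_. borel) (\<lambda>(r, s) \<omega>. X \<omega> $$ (r, s)) {(r, s). r \<le> s \<and> s < N} \<and>
     (\<forall>r<N. distributed M lborel (\<lambda>\<omega>. Re (X \<omega> $$ (r, r))) (normal_density 0 (sqrt v))) \<and>
     (\<forall>r s. r < s \<and> s < N \<longrightarrow>
        indep_var borel (\<lambda>\<omega>. Re (X \<omega> $$ (r, s))) borel (\<lambda>\<omega>. Im (X \<omega> $$ (r, s))) \<and>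
        distributed M lborel (\<lambda>\<omega>. Re (X \<omega> $$ (r, s))) (normal_density 0 (sqrt (v / 2))) \<and>
        distributed M lborel (\<lambda>\<omega>. Im (X \<omega> $$ (r, s))) (normal_density 0 (sqrt (v / 2))))"

definition periodic_dist :: "nat \<Rightarrow> nat \<Rightarrow> nat \<Rightarrow> int" where
  "periodic_dist N r s = min \<bar>int r - int s\<bar> (int N - \<bar>int r - int s\<bar>)"

definition periodic_band :: "nat \<Rightarrow> nat \<Rightarrow> complex mat \<Rightarrow> complex mat" where
  "periodic_band N b X = Matrix.mat N N (\<lambda>(r, s).
     of_real (1 / sqrt (real (min (2 * b + 1) N))) *
     (if periodic_dist N r s \<le> int b then X $$ (r, s) else 0))"

text \<open>The coordinates \<open>(j, k)\<close> are numbered from \<open>1\<close> here; the result is the zero matrix if they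
  exceed \<open>N\<close>.\<close>

definition matrix_unit :: "nat \<Rightarrow> nat \<Rightarrow> nat \<Rightarrow> complex mat" where
  "matrix_unit N j k = Matrix.mat N N (\<lambda>(r, s). if Suc r = j \<and> Suc s = k then 1 else 0)"

definition normalized_ones :: "nat \<Rightarrow> complex mat" where
  "normalized_ones N = (1 / of_nat N) \<cdot>\<^sub>m Matrix.mat N N (\<lambda>_. 1)"

datatype model_index = Band | MatrixUnit nat nat | Ones

primrec model ::
  "(nat \<Rightarrow> 'w \<Rightarrow> complex mat) \<Rightarrow> (nat \<Rightarrow> nat) \<Rightarrow> nat \<Rightarrow> model_index \<Rightarrow> 'w \<Rightarrow> complex mat" where
  "model X b N Band = (\<lambda>\<omega>. periodic_band N (b N) (X N \<omega>))"
| "model X b N (MatrixUnit j k) = (\<lambda>_. matrix_unit N j k)"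
| "model X b N Ones = (\<lambda>_. normalized_ones N)"

datatype family_label = BandFamily | UnitFamily | OnesFamily

primrec family_indices :: "nat \<Rightarrow> family_label \<Rightarrow> model_index set" where
  "family_indices N0 BandFamily = {Band}"
| "family_indices N0 UnitFamily = {MatrixUnit j k | j k. j \<in> {1..N0} \<and> k \<in> {1..N0}}"
| "family_indices N0 OnesFamily = {Ones}"

end

theory Submission
  imports Defs "HOL-Real_Asymp.Real_Asymp"
begin

text \<open>
  By the Wick formula, \<open>E Tr \<Xi>\<^sup>m / N\<close> is a sum over pairings \<open>\<pi>\<close> of the \<open>m\<close> positions, weighted by the number of
  closed walks \<open>i\<close> in the band with \<open>i t = i (\<pi> t + 1)\<close>. Encoding such a walk by its steps at the first position of
  each pair, the constraints become linear relations, one for each pair, whose coefficients are \<open>\<plusminus>1\<close> at the pairs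
  that cross it. So a noncrossing pairing contributes exactly \<open>v ^ (m div 2)\<close>, whereas two crossing pairs lose
  two degrees of freedom, for a contribution of order \<open>1 / \<xi>\<^sup>2\<close>. Multiplied by \<open>N\<close> it tends to \<open>0\<close> if
  \<open>b / \<surd>N \<longlonglongrightarrow> \<infinity>\<close>, and converges if \<open>b / \<surd>N \<longlonglongrightarrow> c\<close>: then the count is one of integer walks whose steps are bounded
  by \<open>b\<close>, and this is asymptotically homogeneous in \<open>b\<close> by a Fekete argument.

  The matrix units and \<open>J / N\<close> have rank one. So the trace of a word containing such a letter is a product of terms
  \<open>\<langle>x, \<Xi>\<^sup>m y\<rangle>\<close>, where \<open>x\<close> and \<open>y\<close> are unit vectors that are either coordinate vectors or constant. Each term
  converges in all moments to \<open>\<mu>(\<Xi>\<^sup>m)\<close> times the limit of \<open>\<langle>x, y\<rangle>\<close>: the variance is \<open>O(1 / \<xi>)\<close>, as a pairing that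
  connects the two factors of a covariance loses one degree of freedom, and higher moments are bounded by
  \<open>|\<langle>x, B y\<rangle>|\<^sup>2 \<le> \<langle>x, B\<^sup>2 x\<rangle>\<close>. Hence \<open>\<nu>\<close> is tracial, satisfies \<open>\<nu>(\<Xi>\<^sup>m T) = \<mu>(\<Xi>\<^sup>m) \<nu>(T)\<close> if \<open>T\<close> begins and
  ends with letters other than \<open>\<Xi>\<close>, and vanishes on words in which a matrix unit and \<open>J / N\<close> are adjacent. These three
  rules evaluate both sides of the defining identity of infinitesimal freeness; they are nonzero only for products
  of the form \<open>\<Xi>\<close>-part, rank one part, \<open>\<Xi>\<close>-part.
\<close>

section \<open>Pairings of a finite set\<close>

text \<open>Freeness at the scale 1 / N requires expectations up to o(1 / N). For powers of the band
  matrix this works because the noncrossing pairings are counted exactly for every N, so the whole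
  error comes from crossing ones. If b / sqrt N tends to c, the factor N / \<xi>^2 has a positive
  limit, so for these a bound is not enough: the normalized counts must converge. Their limit is
  never computed, because in the freeness identity the value of \<nu> on a band factor is always
  multiplied by 0. Periodicity enters as translation invariance: the number of walks from j that
  respect a pairing does not depend on j. Hence E \<Xi>^m is exactly a multiple of the identity, and
  the mean of <x, \<Xi>^m y> depends on x and y only through their inner product, whether they are
  localized or spread out. A rank one letter keeps the trace of a word bounded, so \<mu> vanishes on
  such a word and \<nu> is the limit of its expected trace. This trace is a product of forms of the
  same random matrix, which are not independent; convergence in all moments is the notion that
  survives multiplication.\<close>

definition pairings :: "'a set \<Rightarrow> ('a \<Rightarrow> 'a) set" where
  "pairings S = {\<pi>. \<pi> permutes S \<and> (\<forall>x\<in>S. \<pi> x \<noteq> x \<and> \<pi> (\<pi> x) = x)}"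

text \<open>The pairings that contribute to the Wick expansion of \<open>\<Prod>t\<in>S. X(p t, q t)\<close>: the covariance of
  \<open>X(p t, q t)\<close> and \<open>X(p u, q u)\<close> vanishes unless \<open>p t = q u\<close> and \<open>p u = q t\<close>.\<close>

definition matchings :: "'a set \<Rightarrow> ('a \<Rightarrow> 'b) \<Rightarrow> ('a \<Rightarrow> 'b) \<Rightarrow> ('a \<Rightarrow> 'a) set" where
  "matchings S p q = {\<pi>\<in>pairings S. \<forall>t\<in>S. p t = q (\<pi> t)}"

lemma finite_pairings: "finite S \<Longrightarrow> finite (pairings S)"
  by (rule finite_subset[OF _ finite_permutations]) (auto simp: pairings_def)

lemma finite_matchings: "finite S \<Longrightarrow> finite (matchings S p q)"
  by (simp add: matchings_def finite_pairings)

lemma pairings_empty: "pairings {} = {id}"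
  by (auto simp: pairings_def)

lemma pairingsD:
  assumes "\<pi> \<in> pairings S"
  shows "x \<in> S \<Longrightarrow> \<pi> x \<in> S" "x \<in> S \<Longrightarrow> \<pi> x \<noteq> x" "\<pi> (\<pi> x) = x" "x \<notin> S \<Longrightarrow> \<pi> x = x"
    "\<pi> permutes S"
proof -
  show p: "\<pi> permutes S" using assms by (simp add: pairings_def)
  show "x \<in> S \<Longrightarrow> \<pi> x \<in> S" "x \<notin> S \<Longrightarrow> \<pi> x = x"
    using p by (auto simp: permutes_in_image permutes_not_in)
  show "x \<in> S \<Longrightarrow> \<pi> x \<noteq> x" using assms by (simp add: pairings_def)
  show "\<pi> (\<pi> x) = x" using assms p by (cases "x \<in> S") (auto simp: pairings_def permutes_not_in)
qed

lemma pairingsI: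
  assumes "\<And>x. x \<in> S \<Longrightarrow> \<pi> x \<in> S" "\<And>x. x \<in> S \<Longrightarrow> \<pi> x \<noteq> x"
    "\<And>x. \<pi> (\<pi> x) = x" "\<And>x. x \<notin> S \<Longrightarrow> \<pi> x = x"
  shows "\<pi> \<in> pairings S"
proof -
  have "bij_betw \<pi> S S"
    by (rule bij_betw_byWitness[where f'=\<pi>]) (use assms in auto)
  then have "\<pi> permutes S"
    using assms by (intro bij_imp_permutes) auto
  then show ?thesis using assms by (auto simp: pairings_def)
qed

text \<open>Induction by turning a pair \<open>x\<close>, \<open>\<pi> x\<close> into two fixed
  points. Evenness makes the halved exponents \<open>card S div 2\<close> add up over disjoint sets,
  and the powers of the square root of the band width integral.\<close>

lemma pairings_even_card:
  assumes "finite S" "\<pi> \<in> pairings S"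
  shows "even (card S)"
  using assms
proof (induction "card S" arbitrary: S \<pi> rule: less_induct)
  case less
  show ?case
  proof (cases "S = {}")
    case False
    then obtain x where x: "x \<in> S" by auto
    note D = pairingsD[OF less.prems(2)]
    have "\<pi>(x := x, \<pi> x := \<pi> x) \<in> pairings (S - {x, \<pi> x})"
    proof (rule pairingsI)
      fix t
      show "t \<in> S - {x, \<pi> x} \<Longrightarrow> (\<pi>(x := x, \<pi> x := \<pi> x)) t \<in> S - {x, \<pi> x}"
        using D by auto (metis D(3))+
      show "t \<in> S - {x, \<pi> x} \<Longrightarrow> (\<pi>(x := x, \<pi> x := \<pi> x)) t \<noteq> t" using D by auto
      show "(\<pi>(x := x, \<pi> x := \<pi> x)) ((\<pi>(x := x, \<pi> x := \<pi> x)) t) = t"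
        using D by auto (metis D(3))+
      show "t \<notin> S - {x, \<pi> x} \<Longrightarrow> (\<pi>(x := x, \<pi> x := \<pi> x)) t = t" using D by auto
    qed
    moreover have c: "card S = card (S - {x, \<pi> x}) + 2"
      using x D(1,2)[OF x] less.prems(1)
      by (metis card_0_eq card_2_iff card_Diff_subset card_mono empty_subsetI finite.emptyI finite.insertI insert_subset le_add_diff_inverse2)
    ultimately have "even (card (S - {x, \<pi> x}))"
      using less.prems(1) by (intro less.hyps) auto
    then show ?thesis using c by simp
  qed simp
qed

text \<open>Classification by the partner \<open>y\<close> of \<open>x\<close>. Gaussian
  expectations satisfy the same recursion (\<open>wick_step\<close>), which is how
  \<open>wick\<close> is proved. There are two equations on \<open>y\<close> because a matching is
  constrained both at \<open>x\<close> and at \<open>y\<close>.\<close>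

lemma matchings_insert:
  fixes p q :: "'a \<Rightarrow> 'b"
  assumes "finite S" "x \<notin> S"
  shows "card (matchings (insert x S) p q) =
    (\<Sum>y\<in>{y\<in>S. p x = q y \<and> p y = q x}. card (matchings (S - {y}) p q))"
proof -
  define Y where "Y = {y\<in>S. p x = q y \<and> p y = q x}"
  define \<Phi> where "\<Phi> = (\<lambda>y (\<pi>::'a\<Rightarrow>'a). \<pi>(x := y, y := x))"
  have eq: "matchings (insert x S) p q = (\<Union>y\<in>Y. \<Phi> y ` matchings (S - {y}) p q)"
  proof (intro equalityI subsetI)
    fix \<pi> assume A: "\<pi> \<in> matchings (insert x S) p q"
    then have P: "\<pi> \<in> pairings (insert x S)" and m: "\<And>t. t \<in> insert x S \<Longrightarrow> p t = q (\<pi> t)"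
      by (auto simp: matchings_def)
    note D = pairingsD[OF P]
    have yS: "\<pi> x \<in> S" using D(1,2)[of x] by auto
    have yY: "\<pi> x \<in> Y" unfolding Y_def using yS m[of x] m[of "\<pi> x"] D(3)[of x] by auto
    let ?\<pi> = "\<pi>(x := x, \<pi> x := \<pi> x)"
    have "?\<pi> \<in> pairings (S - {\<pi> x})"
    proof (rule pairingsI)
      fix t
      show "t \<in> S - {\<pi> x} \<Longrightarrow> ?\<pi> t \<in> S - {\<pi> x}"
        using D assms(2) by auto (metis D(3) assms(2) insert_iff)+
      show "t \<in> S - {\<pi> x} \<Longrightarrow> ?\<pi> t \<noteq> t" using D assms(2) by auto
      show "?\<pi> (?\<pi> t) = t" using D by auto (metis D(3))+
      show "t \<notin> S - {\<pi> x} \<Longrightarrow> ?\<pi> t = t" using D by auto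
    qed
    moreover have "\<forall>t\<in>S - {\<pi> x}. p t = q (?\<pi> t)" using m assms(2) by auto
    ultimately have "?\<pi> \<in> matchings (S - {\<pi> x}) p q" by (auto simp: matchings_def)
    moreover have "\<pi> = \<Phi> (\<pi> x) ?\<pi>" unfolding \<Phi>_def using D(3)[of x] by auto
    ultimately show "\<pi> \<in> (\<Union>y\<in>Y. \<Phi> y ` matchings (S - {y}) p q)" using yY by blast
  next
    fix \<rho> assume "\<rho> \<in> (\<Union>y\<in>Y. \<Phi> y ` matchings (S - {y}) p q)"
    then obtain y \<pi> where y: "y \<in> Y" and P: "\<pi> \<in> matchings (S - {y}) p q" and \<rho>: "\<rho> = \<Phi> y \<pi>" by auto
    have yS: "y \<in> S" "p x = q y" "p y = q x" "y \<noteq> x" using y assms(2) by (auto simp: Y_def)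
    have D: "\<pi> \<in> pairings (S - {y})" using P by (simp add: matchings_def)
    note D = pairingsD[OF D]
    have fx: "\<pi> x = x" "\<pi> y = y" using D(4) assms(2) by auto
    have ne: "\<pi> t \<noteq> x" "\<pi> t \<noteq> y" if "t \<noteq> x" "t \<noteq> y" for t using D(3) fx that by metis+
    have "\<rho> \<in> pairings (insert x S)"
    proof (rule pairingsI)
      fix t
      show "t \<in> insert x S \<Longrightarrow> \<rho> t \<in> insert x S"
        unfolding \<rho> \<Phi>_def using D yS by auto
      show "t \<in> insert x S \<Longrightarrow> \<rho> t \<noteq> t" unfolding \<rho> \<Phi>_def using D yS by auto
      show "\<rho> (\<rho> t) = t" unfolding \<rho> \<Phi>_def using D yS ne by auto
      show "t \<notin> insert x S \<Longrightarrow> \<rho> t = t" unfolding \<rho> \<Phi>_def using D yS by auto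
    qed
    moreover have "\<forall>t\<in>insert x S. p t = q (\<rho> t)"
      using P yS unfolding \<rho> \<Phi>_def matchings_def by auto
    ultimately show "\<rho> \<in> matchings (insert x S) p q" by (simp add: matchings_def)
  qed
  have inj: "inj_on (\<Phi> y) (matchings (S - {y}) p q)" if "y \<in> Y" for y
  proof (rule inj_onI)
    fix \<pi> \<pi>' assume P: "\<pi> \<in> matchings (S - {y}) p q" "\<pi>' \<in> matchings (S - {y}) p q" and e: "\<Phi> y \<pi> = \<Phi> y \<pi>'"
    have fx: "\<pi> x = x" "\<pi> y = y" "\<pi>' x = x" "\<pi>' y = y"
      using P pairingsD(4) assms(2) by (fastforce simp: matchings_def)+
    show "\<pi> = \<pi>'"
    proof
      fix t show "\<pi> t = \<pi>' t" using fun_cong[OF e, of t] fx unfolding \<Phi>_def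
        by (auto split: if_splits)
    qed
  qed
  have "card (matchings (insert x S) p q) = (\<Sum>y\<in>Y. card (\<Phi> y ` matchings (S - {y}) p q))"
    unfolding eq
  proof (rule card_UN_disjoint)
    show "finite Y" unfolding Y_def using assms by auto
    show "\<forall>y\<in>Y. finite (\<Phi> y ` matchings (S - {y}) p q)" using assms by (auto intro!: finite_matchings)
    show "\<forall>y\<in>Y. \<forall>z\<in>Y. y \<noteq> z \<longrightarrow> \<Phi> y ` matchings (S - {y}) p q \<inter> \<Phi> z ` matchings (S - {z}) p q = {}"
    proof (intro ballI impI equals0I)
      fix y z \<rho> assume y: "y \<in> Y" "z \<in> Y" "y \<noteq> z"
        and r: "\<rho> \<in> \<Phi> y ` matchings (S - {y}) p q \<inter> \<Phi> z ` matchings (S - {z}) p q"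
      have "x \<noteq> y" "x \<noteq> z" using y assms(2) by (auto simp: Y_def)
      from r obtain \<pi> \<pi>' where e1: "\<rho> = \<pi>(x := y, y := x)" and e2: "\<rho> = \<pi>'(x := z, z := x)"
        unfolding \<Phi>_def by blast
      have "\<rho> x = y" using \<open>x \<noteq> y\<close> by (simp add: e1)
      moreover have "\<rho> x = z" using \<open>x \<noteq> z\<close> by (simp add: e2)
      ultimately show False using y by simp
    qed
  qed
  also have "\<dots> = (\<Sum>y\<in>Y. card (matchings (S - {y}) p q))"
    using card_image[OF inj] by simp
  finally show ?thesis unfolding Y_def .
qed

text \<open>A pairing is an involution, so once it preserves \<open>S\<close> it preserves
  \<open>T\<close> and consists of two independent matchings. In a covariance these are the terms
  that cancel.\<close>

lemma matchings_Un:
  fixes p q :: "'a \<Rightarrow> 'b"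
  assumes "S \<inter> T = {}"
  shows "card {\<pi>\<in>matchings (S \<union> T) p q. \<pi> ` S \<subseteq> S} = card (matchings S p q) * card (matchings T p q)"
proof -
  define F :: "('a \<Rightarrow> 'a) \<Rightarrow> _" where
    "F = (\<lambda>\<pi>. (\<lambda>t. if t \<in> S then \<pi> t else t, \<lambda>t. if t \<in> T then \<pi> t else t))"
  define G :: "('a \<Rightarrow> 'a) \<times> ('a \<Rightarrow> 'a) \<Rightarrow> _" where
    "G = (\<lambda>(\<pi>1,\<pi>2) t. if t \<in> S then \<pi>1 t else \<pi>2 t)"
  have "bij_betw F {\<pi>\<in>matchings (S \<union> T) p q. \<pi> ` S \<subseteq> S} (matchings S p q \<times> matchings T p q)"
  proof (rule bij_betw_byWitness[where f'=G])
    show "\<forall>\<pi>\<in>{\<pi>\<in>matchings (S \<union> T) p q. \<pi> ` S \<subseteq> S}. G (F \<pi>) = \<pi>"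
      by (auto simp: F_def G_def fun_eq_iff matchings_def dest!: pairingsD(4))
    show "\<forall>\<rho>\<in>matchings S p q \<times> matchings T p q. F (G \<rho>) = \<rho>"
    proof safe
      fix \<pi>1 \<pi>2 assume a: "\<pi>1 \<in> matchings S p q" "\<pi>2 \<in> matchings T p q"
      have "\<And>t. t \<notin> S \<Longrightarrow> \<pi>1 t = t" "\<And>t. t \<notin> T \<Longrightarrow> \<pi>2 t = t"
        using a pairingsD(4) unfolding matchings_def by fast+
      then show "F (G (\<pi>1, \<pi>2)) = (\<pi>1, \<pi>2)"
        using assms by (auto simp: F_def G_def fun_eq_iff)
    qed
    show "F ` {\<pi>\<in>matchings (S \<union> T) p q. \<pi> ` S \<subseteq> S} \<subseteq> matchings S p q \<times> matchings T p q"
    proof safe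
      fix \<pi>1 \<pi>2 \<pi> assume F: "(\<pi>1, \<pi>2) = F \<pi>" and \<pi>: "\<pi> \<in> matchings (S \<union> T) p q" "\<pi> ` S \<subseteq> S"
      have P: "\<pi> \<in> pairings (S \<union> T)" using \<pi> by (simp add: matchings_def)
      note D = pairingsD[OF P]
      have T: "\<pi> t \<in> T" if "t \<in> T" for t
      proof -
        have "\<pi> t \<in> S \<union> T" using D(1) that by auto
        moreover have "\<pi> t \<notin> S" using D(3)[of t] \<pi>(2) that assms by (metis IntI empty_iff image_subset_iff)
        ultimately show ?thesis by auto
      qed
      have S: "\<pi> t \<in> S" if "t \<in> S" for t using that \<pi>(2) by auto
      have "\<pi>1 \<in> pairings S" "\<pi>2 \<in> pairings T"
        using F D S T by (auto simp: F_def intro!: pairingsI)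
      moreover have "\<forall>t\<in>S. p t = q (\<pi>1 t)" "\<forall>t\<in>T. p t = q (\<pi>2 t)"
        using F \<pi>(1) by (auto simp: F_def matchings_def)
      ultimately show "\<pi>1 \<in> matchings S p q" "\<pi>2 \<in> matchings T p q" by (auto simp: matchings_def)
    qed
    show "G ` (matchings S p q \<times> matchings T p q) \<subseteq> {\<pi>\<in>matchings (S \<union> T) p q. \<pi> ` S \<subseteq> S}"
    proof safe
      fix \<pi>1 \<pi>2 assume a: "\<pi>1 \<in> matchings S p q" "\<pi>2 \<in> matchings T p q"
      have P1: "\<pi>1 \<in> pairings S" "\<pi>2 \<in> pairings T" using a by (auto simp: matchings_def)
      note D1 = pairingsD[OF P1(1)] and D2 = pairingsD[OF P1(2)]
      have n: "\<pi>2 t \<notin> S" if "t \<notin> S" for t using D2(1,4) that assms by (cases "t \<in> T") auto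
      have "G (\<pi>1, \<pi>2) \<in> pairings (S \<union> T)"
        using D1 D2 assms n by (intro pairingsI) (auto simp: G_def)
      moreover have "\<forall>t\<in>S \<union> T. p t = q (G (\<pi>1, \<pi>2) t)"
        using a assms by (auto simp: G_def matchings_def)
      ultimately show "G (\<pi>1, \<pi>2) \<in> matchings (S \<union> T) p q" by (simp add: matchings_def)
      show "\<And>x. x \<in> S \<Longrightarrow> G (\<pi>1, \<pi>2) x \<in> S" using D1 by (auto simp: G_def)
    qed
  qed
  then show ?thesis by (simp add: bij_betw_same_card card_cartesian_product)
qed

section \<open>Moments and integration by parts\<close>

context prob_space
begin

text \<open>The intersection of all \<open>L^p\<close> spaces. It is an algebra, so the
  integrability of any polynomial in the matrix entries follows by introduction rules.\<close>

definition all_moments :: "('a \<Rightarrow> complex) \<Rightarrow> bool" where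
  "all_moments Y \<longleftrightarrow> random_variable borel Y \<and> (\<forall>p::nat. integrable M (\<lambda>\<omega>. norm (Y \<omega>) ^ p))"

lemma all_moments_measurable: "all_moments Y \<Longrightarrow> random_variable borel Y"
  and all_moments_power: "all_moments Y \<Longrightarrow> integrable M (\<lambda>\<omega>. norm (Y \<omega>) ^ p)"
  by (auto simp: all_moments_def)

lemma all_moments_integrable: "all_moments Y \<Longrightarrow> integrable M Y"
  using all_moments_power[of Y 1] all_moments_measurable[of Y] by (simp add: integrable_norm_iff)

lemma all_moments_dominated:
  assumes "random_variable borel Y" "\<And>p. integrable M (g p)" "\<And>\<omega> p. norm (Y \<omega>) ^ p \<le> g p \<omega>"
  shows "all_moments Y"
  unfolding all_moments_def
proof (intro conjI allI)
  fix p :: nat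
  show "integrable M (\<lambda>\<omega>. norm (Y \<omega>) ^ p)"
  proof (rule Bochner_Integration.integrable_bound[OF assms(2)[of p]])
    show "(\<lambda>x. cmod (Y x) ^ p) \<in> borel_measurable M" using assms(1) by measurable
    show "AE x in M. norm (cmod (Y x) ^ p) \<le> norm (g p x)"
    proof (rule AE_I2)
      fix x show "norm (cmod (Y x) ^ p) \<le> norm (g p x)"
        using assms(3)[of x p] order_trans[OF zero_le_power[OF norm_ge_zero] assms(3)[of x p]]
        by (simp add: abs_of_nonneg)
    qed
  qed
qed (rule assms(1))

lemma all_moments_const [intro]: "all_moments (\<lambda>_. c)"
  by (simp add: all_moments_def)

lemma all_moments_add [intro]:
  assumes "all_moments Y" "all_moments Z"
  shows "all_moments (\<lambda>\<omega>. Y \<omega> + Z \<omega>)"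
proof (rule all_moments_dominated)
  show "random_variable borel (\<lambda>\<omega>. Y \<omega> + Z \<omega>)"
    using assms by (auto simp: all_moments_def)
  fix p :: nat
  show "integrable M (\<lambda>\<omega>. 2 ^ p * (norm (Y \<omega>) ^ p + norm (Z \<omega>) ^ p))"
    using assms by (auto simp: all_moments_def)
  fix \<omega>
  have "norm (Y \<omega> + Z \<omega>) ^ p \<le> (2 * max (norm (Y \<omega>)) (norm (Z \<omega>))) ^ p"
    using norm_triangle_ineq[of "Y \<omega>" "Z \<omega>"] by (intro power_mono) auto
  also have "\<dots> \<le> 2 ^ p * (norm (Y \<omega>) ^ p + norm (Z \<omega>) ^ p)"
    unfolding power_mult_distrib by (intro mult_left_mono) (auto simp: max_def)
  finally show "norm (Y \<omega> + Z \<omega>) ^ p \<le> 2 ^ p * (norm (Y \<omega>) ^ p + norm (Z \<omega>) ^ p)" .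
qed

lemma all_moments_mult [intro]:
  assumes "all_moments Y" "all_moments Z"
  shows "all_moments (\<lambda>\<omega>. Y \<omega> * Z \<omega>)"
proof (rule all_moments_dominated)
  show "random_variable borel (\<lambda>\<omega>. Y \<omega> * Z \<omega>)"
    using assms by (auto simp: all_moments_def)
  fix p :: nat
  show "integrable M (\<lambda>\<omega>. norm (Y \<omega>) ^ (2 * p) + norm (Z \<omega>) ^ (2 * p))"
    using assms by (auto simp: all_moments_def)
  fix \<omega>
  have "0 \<le> (norm (Y \<omega>) ^ p - norm (Z \<omega>) ^ p)\<^sup>2" by simp
  moreover have "0 \<le> norm (Y \<omega>) ^ p * norm (Z \<omega>) ^ p" by simp
  ultimately have "norm (Y \<omega>) ^ p * norm (Z \<omega>) ^ p \<le> (norm (Y \<omega>) ^ p)\<^sup>2 + (norm (Z \<omega>) ^ p)\<^sup>2"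
    unfolding power2_diff by linarith
  then show "norm (Y \<omega> * Z \<omega>) ^ p \<le> norm (Y \<omega>) ^ (2 * p) + norm (Z \<omega>) ^ (2 * p)"
    by (simp add: norm_mult power_mult_distrib power_mult[symmetric] mult.commute)
qed

lemma all_moments_cnj [intro]: "all_moments Y \<Longrightarrow> all_moments (\<lambda>\<omega>. cnj (Y \<omega>))"
  using measurable_compose[OF _ borel_measurable_continuous_onI[of cnj], of Y M]
  by (auto simp: all_moments_def intro!: continuous_intros)

lemma all_moments_diff [intro]:
  assumes "all_moments Y" "all_moments Z"
  shows "all_moments (\<lambda>\<omega>. Y \<omega> - Z \<omega>)"
  using all_moments_add[OF assms(1) all_moments_mult[OF all_moments_const[of "-1"] assms(2)]] by simp

lemma all_moments_sum [intro]:
  "(\<And>i. i \<in> A \<Longrightarrow> all_moments (Y i)) \<Longrightarrow> all_moments (\<lambda>\<omega>. \<Sum>i\<in>A. Y i \<omega>)"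
  by (induction A rule: infinite_finite_induct) auto

lemma all_moments_prod [intro]:
  "(\<And>i. i \<in> A \<Longrightarrow> all_moments (Y i)) \<Longrightarrow> all_moments (\<lambda>\<omega>. \<Prod>i\<in>A. Y i \<omega>)"
  by (induction A rule: infinite_finite_induct) auto

lemma all_moments_pow [intro]: "all_moments Y \<Longrightarrow> all_moments (\<lambda>\<omega>. Y \<omega> ^ n)"
  by (induction n) auto

lemma all_moments_poly [intro]: "all_moments Y \<Longrightarrow> all_moments (\<lambda>\<omega>. poly p (Y \<omega>))"
  unfolding poly_altdef
  by (intro all_moments_sum all_moments_mult all_moments_const all_moments_pow)

lemma all_moments_normal:
  assumes "distributed M lborel U (normal_density 0 s)" "s > 0"
  shows "all_moments (\<lambda>\<omega>. complex_of_real (U \<omega>))"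
  unfolding all_moments_def
proof (intro conjI allI)
  have m: "random_variable borel U" using distributed_measurable[OF assms(1)] by simp
  then show "random_variable borel (\<lambda>\<omega>. complex_of_real (U \<omega>))" by measurable
  fix p :: nat
  have "integrable lborel (\<lambda>x. normal_density 0 s x * \<bar>x\<bar> ^ p)"
    using integrable_normal_moment_abs[OF assms(2), of 0 p] by simp
  then have "integrable M (\<lambda>\<omega>. \<bar>U \<omega>\<bar> ^ p)"
    using distributed_integrable[OF assms(1), of "\<lambda>x. \<bar>x\<bar> ^ p"] by simp
  then show "integrable M (\<lambda>\<omega>. cmod (complex_of_real (U \<omega>)) ^ p)" by simp
qed

section \<open>Gaussian integration by parts\<close>

lemma normal_moment:
  assumes "distributed M lborel U (normal_density 0 s)" "s > 0"
  shows "expectation (\<lambda>\<omega>. U \<omega> ^ k) = integral\<^sup>L lborel (\<lambda>x. normal_density 0 s x * (x - 0) ^ k)"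
  using distributed_integral[OF assms(1), of "\<lambda>x. x ^ k"] assms(2) by simp

text \<open>Stein's identity E (U p(U)) = s^2 E p'(U) for the monomial of degree \<open>k\<close>,
  read off from the explicit moments. For \<open>k = 0\<close> the truncated \<open>k - 1\<close> is
  harmless, being multiplied by 0.\<close>

lemma normal_moment_rec:
  assumes "distributed M lborel U (normal_density 0 s)" "s > 0"
  shows "expectation (\<lambda>\<omega>. U \<omega> ^ Suc k) = s\<^sup>2 * (real k * expectation (\<lambda>\<omega>. U \<omega> ^ (k - 1)))"
proof -
  note m = normal_moment[OF assms]
  show ?thesis
  proof (cases "even k")
    case True
    then obtain j where j: "k = 2 * j" by auto
    have "expectation (\<lambda>\<omega>. U \<omega> ^ Suc k) = 0"
      unfolding m j using integral_normal_moment_odd[OF assms(2), of 0 j] by simp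
    moreover have "real k * expectation (\<lambda>\<omega>. U \<omega> ^ (k - 1)) = 0"
    proof (cases j)
      case (Suc i)
      then show ?thesis
        unfolding m j using integral_normal_moment_odd[OF assms(2), of 0 i] by simp
    qed (use j in simp)
    ultimately show ?thesis by (metis mult_zero_right)
  next
    case False
    then obtain j where j: "k = 2 * j + 1" by (auto elim: oddE)
    have e: "Suc k = 2 * Suc j" "k - 1 = 2 * j" using j by auto
    \<comment> \<open>\<open>F / D\<close> is the closed form of the moment of order
      \<open>2 * j\<close>, up to the factor \<open>w\<close>-powers in \<open>D\<close>; the claim
      becomes a relation between two consecutive quotients.\<close>
    define w F D where "w = 2 / s\<^sup>2" and "F = (fact (2 * j) :: real)" and "D = w ^ j * (fact j :: real)"
    have nz: "w \<noteq> 0" "s\<^sup>2 = 2 / w" using assms(2) by (simp_all add: w_def)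
    have D: "D \<noteq> 0" using nz by (simp add: D_def)
    have f1: "fact (2 * Suc j) = (2 * (1 + real j)) * (2 * real j + 1) * F"
      by (simp add: algebra_simps F_def)
    have f2: "w ^ Suc j * fact (Suc j) = w * (1 + real j) * D" by (simp add: D_def)
    have f3: "2 * (1 + real j) * (2 * real j + 1) * F / (w * (1 + real j) * D) =
        2 / w * ((2 * real j + 1) * (F / D))"
      using nz D by (simp add: divide_simps)
    have f4: "real k = 2 * real j + 1" by (simp add: j)
    have "fact (2 * Suc j) / (w ^ Suc j * fact (Suc j)) = s\<^sup>2 * (real k * (F / D))"
      unfolding nz(2) f1 f2 f3 f4 ..
    then show ?thesis
      unfolding m e integral_normal_moment_even[OF assms(2)] w_def D_def F_def .
  qed
qed

lemma normal_stein:
  assumes "distributed M lborel U (normal_density 0 s)" "s > 0"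
  shows "expectation (\<lambda>\<omega>. complex_of_real (U \<omega>) * poly p (of_real (U \<omega>))) =
    of_real (s\<^sup>2) * expectation (\<lambda>\<omega>. poly (pderiv p) (of_real (U \<omega>)))"
proof -
  note U = all_moments_normal[OF assms]
  have monom: "expectation (\<lambda>\<omega>. complex_of_real (U \<omega>) * poly (monom c k) (of_real (U \<omega>))) =
    of_real (s\<^sup>2) * expectation (\<lambda>\<omega>. poly (pderiv (monom c k)) (of_real (U \<omega>)))" for c k
  proof -
    have "expectation (\<lambda>\<omega>. complex_of_real (U \<omega>) * poly (monom c k) (of_real (U \<omega>))) =
      expectation (\<lambda>\<omega>. c * complex_of_real (U \<omega> ^ Suc k))"
      by (simp add: poly_monom mult_ac)
    also have "\<dots> = c * of_real (expectation (\<lambda>\<omega>. U \<omega> ^ Suc k))"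
      unfolding integral_mult_right_zero integral_complex_of_real ..
    also have "\<dots> = of_real (s\<^sup>2) * ((of_nat k * c) * of_real (expectation (\<lambda>\<omega>. U \<omega> ^ (k - 1))))"
      unfolding normal_moment_rec[OF assms] by simp
    also have "\<dots> = of_real (s\<^sup>2) * expectation (\<lambda>\<omega>. (of_nat k * c) * complex_of_real (U \<omega> ^ (k - 1)))"
      unfolding integral_mult_right_zero integral_complex_of_real ..
    finally show ?thesis by (simp add: pderiv_monom poly_monom)
  qed
  have sums: "expectation (\<lambda>\<omega>. complex_of_real (U \<omega>) * poly (\<Sum>i\<in>A. monom (c i) i) (of_real (U \<omega>))) =
    of_real (s\<^sup>2) * expectation (\<lambda>\<omega>. poly (pderiv (\<Sum>i\<in>A. monom (c i) i)) (of_real (U \<omega>)))" if "finite A" for A c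
    using that
  proof (induction A)
    case (insert i A)
    have "integrable M (\<lambda>\<omega>. complex_of_real (U \<omega>) * poly q (of_real (U \<omega>)))" for q
      by (intro all_moments_integrable all_moments_mult U all_moments_poly)
    moreover have "integrable M (\<lambda>\<omega>. poly q (complex_of_real (U \<omega>)))" for q
      by (intro all_moments_integrable U all_moments_poly)
    ultimately show ?case using insert monom[of "c i" i]
      by (simp add: pderiv_add distrib_left)
  qed simp
  show ?thesis
    using sums[of "{..degree p}" "coeff p"] by (simp add: poly_as_sum_of_monoms)
qed

text \<open>The derivative of a product of affine functions is a sum over the deleted factor. The
  constants \<open>\<beta>\<close> leave room for a second variable frozen at a value.\<close>

lemma normal_stein_prod:
  assumes "distributed M lborel U (normal_density 0 s)" "s > 0" "finite T"
  shows "expectation (\<lambda>\<omega>. complex_of_real (U \<omega>) * (\<Prod>t\<in>T. \<alpha> t * of_real (U \<omega>) + \<beta> t)) =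
    of_real (s\<^sup>2) * (\<Sum>y\<in>T. \<alpha> y * expectation (\<lambda>\<omega>. \<Prod>t\<in>T - {y}. \<alpha> t * of_real (U \<omega>) + \<beta> t))"
proof -
  note U = all_moments_normal[OF assms(1,2)]
  have P: "poly (\<Prod>t\<in>B. [:\<beta> t, \<alpha> t:]) z = (\<Prod>t\<in>B. \<alpha> t * z + \<beta> t)" for B z
    by (simp add: poly_prod add.commute mult.commute)
  have "expectation (\<lambda>\<omega>. complex_of_real (U \<omega>) * (\<Prod>t\<in>T. \<alpha> t * of_real (U \<omega>) + \<beta> t)) =
    of_real (s\<^sup>2) * expectation (\<lambda>\<omega>. poly (pderiv (\<Prod>t\<in>T. [:\<beta> t, \<alpha> t:])) (of_real (U \<omega>)))"
    using normal_stein[OF assms(1,2), of "\<Prod>t\<in>T. [:\<beta> t, \<alpha> t:]"] by (simp only: P)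
  also have "expectation (\<lambda>\<omega>. poly (pderiv (\<Prod>t\<in>T. [:\<beta> t, \<alpha> t:])) (of_real (U \<omega>))) =
    expectation (\<lambda>\<omega>. \<Sum>y\<in>T. \<alpha> y * (\<Prod>t\<in>T - {y}. \<alpha> t * of_real (U \<omega>) + \<beta> t))"
    by (simp add: pderiv_prod poly_sum P mult.commute pderiv_pCons)
  also have "\<dots> = (\<Sum>y\<in>T. \<alpha> y * expectation (\<lambda>\<omega>. \<Prod>t\<in>T - {y}. \<alpha> t * of_real (U \<omega>) + \<beta> t))"
  proof (subst Bochner_Integration.integral_sum)
    fix y
    show "integrable M (\<lambda>\<omega>. \<alpha> y * (\<Prod>t\<in>T - {y}. \<alpha> t * of_real (U \<omega>) + \<beta> t))"
      by (intro all_moments_integrable all_moments_mult all_moments_const all_moments_prod all_moments_add U)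
  qed simp
  finally show ?thesis .
qed

text \<open>Stein's identity in \<open>U\<close> for each frozen value of \<open>V\<close>, then
  integrated over the law of \<open>V\<close>: independence makes the joint law a product
  measure.\<close>

lemma normal_stein_pair:
  assumes indep: "indep_var borel U borel V"
    and U: "distributed M lborel U (normal_density 0 s)" "s > 0"
    and V: "distributed M lborel V (normal_density 0 s')" "s' > 0" and "finite T"
  shows "expectation (\<lambda>\<omega>. complex_of_real (U \<omega>) * (\<Prod>t\<in>T. \<alpha> t * of_real (U \<omega>) + \<beta> t * of_real (V \<omega>))) =
    of_real (s\<^sup>2) * (\<Sum>y\<in>T. \<alpha> y * expectation (\<lambda>\<omega>. \<Prod>t\<in>T - {y}. \<alpha> t * of_real (U \<omega>) + \<beta> t * of_real (V \<omega>)))"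
proof -
  note mU = all_moments_normal[OF U] and mV = all_moments_normal[OF V]
  have rv [measurable]: "random_variable borel U" "random_variable borel V"
    using distributed_measurable[OF U(1)] distributed_measurable[OF V(1)] by simp_all
  define F where "F = (\<lambda>B x y. \<Prod>t\<in>B. \<alpha> t * complex_of_real x + \<beta> t * complex_of_real y)"
  \<comment> \<open>\<open>G\<close> is the difference of the integrands of the two sides; already
    its integral over the first variable vanishes.\<close>
  define G where "G = (\<lambda>(x, y). complex_of_real x * F T x y - of_real (s\<^sup>2) * (\<Sum>z\<in>T. \<alpha> z * F (T - {z}) x y))"
  have F_am: "all_moments (\<lambda>\<omega>. F B (U \<omega>) (V \<omega>))" for B
    unfolding F_def by (intro all_moments_prod all_moments_add all_moments_mult all_moments_const mU mV)
  have F_am': "all_moments (\<lambda>\<omega>. F B (U \<omega>) y)" for B y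
    unfolding F_def by (intro all_moments_prod all_moments_add all_moments_mult all_moments_const mU)
  have G_am: "all_moments (\<lambda>\<omega>. G (U \<omega>, V \<omega>))"
    unfolding G_def split by (intro all_moments_diff all_moments_sum all_moments_mult all_moments_const mU F_am)
  have G_meas [measurable]: "G \<in> borel_measurable (borel \<Otimes>\<^sub>M borel)"
    unfolding G_def F_def by measurable
  interpret P: prob_space "distr M borel U" by (rule prob_space_distr) simp
  interpret Q: prob_space "distr M borel V" by (rule prob_space_distr) simp
  interpret PQ: pair_prob_space "distr M borel U" "distr M borel V" ..
  have joint: "distr M borel U \<Otimes>\<^sub>M distr M borel V = distr M (borel \<Otimes>\<^sub>M borel) (\<lambda>x. (U x, V x))"
    using indep unfolding indep_var_distribution_eq by simp
  have inner: "(\<integral>x. G (x, y) \<partial>distr M borel U) = 0" for y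
  proof -
    have "(\<integral>x. G (x, y) \<partial>distr M borel U) = expectation (\<lambda>\<omega>. G (U \<omega>, y))"
      by (rule integral_distr) measurable
    also have "\<dots> = expectation (\<lambda>\<omega>. complex_of_real (U \<omega>) * F T (U \<omega>) y)
        - of_real (s\<^sup>2) * (\<Sum>z\<in>T. \<alpha> z * expectation (\<lambda>\<omega>. F (T - {z}) (U \<omega>) y))"
      unfolding G_def split
      by (subst Bochner_Integration.integral_diff, force intro!: all_moments_integrable mU F_am',
          force intro!: all_moments_integrable mU F_am', subst integral_mult_right_zero,
          subst Bochner_Integration.integral_sum, force intro!: all_moments_integrable mU F_am', simp)
    also have "\<dots> = 0"
      unfolding F_def using normal_stein_prod[OF U \<open>finite T\<close>, of \<alpha> "\<lambda>t. \<beta> t * of_real y"] by simp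
    finally show ?thesis .
  qed
  have "expectation (\<lambda>\<omega>. G (U \<omega>, V \<omega>)) = integral\<^sup>L (distr M (borel \<Otimes>\<^sub>M borel) (\<lambda>x. (U x, V x))) G"
    by (subst integral_distr) auto
  also have "\<dots> = (\<integral>y. (\<integral>x. G (x, y) \<partial>distr M borel U) \<partial>distr M borel V)"
  proof -
    have "integrable (distr M borel U \<Otimes>\<^sub>M distr M borel V) (\<lambda>(x, y). G (x, y))"
      unfolding joint split_beta using all_moments_integrable[OF G_am]
      by (subst integrable_distr_eq) auto
    from PQ.integral_snd[OF this] show ?thesis unfolding joint by simp
  qed
  also have "\<dots> = 0" by (simp add: inner)
  finally have "expectation (\<lambda>\<omega>. G (U \<omega>, V \<omega>)) = 0" .
  also have "expectation (\<lambda>\<omega>. G (U \<omega>, V \<omega>)) = expectation (\<lambda>\<omega>. complex_of_real (U \<omega>) * F T (U \<omega>) (V \<omega>))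
        - of_real (s\<^sup>2) * (\<Sum>z\<in>T. \<alpha> z * expectation (\<lambda>\<omega>. F (T - {z}) (U \<omega>) (V \<omega>)))"
      unfolding G_def split
      by (subst Bochner_Integration.integral_diff, force intro!: all_moments_integrable mU F_am,
          force intro!: all_moments_integrable mU F_am, subst integral_mult_right_zero,
          subst Bochner_Integration.integral_sum, force intro!: all_moments_integrable mU F_am, simp)
  finally show ?thesis unfolding F_def by simp
qed

end

section \<open>The Wick formula for the GUE\<close>

lemma (in prob_space) indep_set_commute:
  assumes "indep_set A B" shows "indep_set B A"
  unfolding indep_sets2_eq
proof (intro conjI ballI)
  show "B \<subseteq> events" "A \<subseteq> events" using assms unfolding indep_sets2_eq by auto
  fix b a assume "b \<in> B" "a \<in> A"
  then have "prob (a \<inter> b) = prob a * prob b" using assms unfolding indep_sets2_eq by blast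
  then show "prob (b \<inter> a) = prob b * prob a" by (simp add: Int_commute mult.commute)
qed

text \<open>The flags \<open>e\<close> tell \<open>Z\<close> from its conjugate. The real part
  contributes \<open>v / 2\<close> and the imaginary part
  \<open>v / 2 * \<beta> x * \<beta> y\<close>. They add up to \<open>v\<close> if exactly one of
  the two factors is conjugated and cancel otherwise: E |Z|^2 = v and E Z^2 = 0.\<close>

lemma (in prob_space) complex_gaussian_ibp:
  fixes Z :: "'a \<Rightarrow> complex" and e :: "'t \<Rightarrow> bool" and H :: "'t \<Rightarrow> complex \<Rightarrow> complex"
  assumes indep: "indep_var borel (\<lambda>\<omega>. Re (Z \<omega>)) borel (\<lambda>\<omega>. Im (Z \<omega>))"
    and U: "distributed M lborel (\<lambda>\<omega>. Re (Z \<omega>)) (normal_density 0 (sqrt (v / 2)))"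
    and V: "distributed M lborel (\<lambda>\<omega>. Im (Z \<omega>)) (normal_density 0 (sqrt (v / 2)))"
    and v: "v > 0" and T: "finite T" "x \<notin> T"
  defines "H \<equiv> \<lambda>t z. if e t then z else cnj z"
  shows "expectation (\<lambda>\<omega>. \<Prod>t\<in>insert x T. H t (Z \<omega>)) =
    (\<Sum>y\<in>{y\<in>T. e y \<noteq> e x}. v * expectation (\<lambda>\<omega>. \<Prod>t\<in>T - {y}. H t (Z \<omega>)))"
proof -
  define s where "s = sqrt (v / 2)"
  have s: "s > 0" "complex_of_real (s\<^sup>2) = v / 2" using v by (simp_all add: s_def)
  note U = U[folded s_def] and V = V[folded s_def]
  define \<beta> where "\<beta> = (\<lambda>t. if e t then \<i> else - \<i>)"
  define P where "P = (\<lambda>B \<omega>. \<Prod>t\<in>B. 1 * complex_of_real (Re (Z \<omega>)) + \<beta> t * of_real (Im (Z \<omega>)))"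
  have H: "H t (Z \<omega>) = 1 * complex_of_real (Re (Z \<omega>)) + \<beta> t * of_real (Im (Z \<omega>))" for t \<omega>
    by (simp add: H_def \<beta>_def complex_eq_iff)
  note mU = all_moments_normal[OF U s(1)] and mV = all_moments_normal[OF V s(1)]
  have mP: "all_moments (P B)" for B
    unfolding P_def by (intro all_moments_prod all_moments_add all_moments_mult all_moments_const mU mV)
  have indep': "indep_var borel (\<lambda>\<omega>. Im (Z \<omega>)) borel (\<lambda>\<omega>. Re (Z \<omega>))"
    using indep unfolding indep_var_eq 
    by (elim conjE, intro conjI) (assumption | erule indep_set_commute)+
  have 1: "expectation (\<lambda>\<omega>. complex_of_real (Re (Z \<omega>)) * P T \<omega>) = v / 2 * (\<Sum>y\<in>T. expectation (P (T - {y})))"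
    using normal_stein_pair[OF indep U s(1) V s(1) T(1), of "\<lambda>_. 1" \<beta>] unfolding s(2) P_def by simp
  have 2: "expectation (\<lambda>\<omega>. complex_of_real (Im (Z \<omega>)) * P T \<omega>) = v / 2 * (\<Sum>y\<in>T. \<beta> y * expectation (P (T - {y})))"
    using normal_stein_pair[OF indep' V s(1) U s(1) T(1), of \<beta> "\<lambda>_. 1"] unfolding s(2) P_def by (simp add: add.commute)
  have "expectation (\<lambda>\<omega>. \<Prod>t\<in>insert x T. H t (Z \<omega>)) =
      expectation (\<lambda>\<omega>. complex_of_real (Re (Z \<omega>)) * P T \<omega> + \<beta> x * (complex_of_real (Im (Z \<omega>)) * P T \<omega>))"
    using T unfolding H P_def by (simp add: algebra_simps)
  also have "\<dots> = v / 2 * (\<Sum>y\<in>T. expectation (P (T - {y}))) + \<beta> x * (v / 2 * (\<Sum>y\<in>T. \<beta> y * expectation (P (T - {y}))))"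
    unfolding 1[symmetric] 2[symmetric]
    by (subst Bochner_Integration.integral_add)
       (auto intro!: all_moments_integrable all_moments_mult all_moments_const mU mV mP)
  also have "\<dots> = (\<Sum>y\<in>T. (v / 2 * (1 + \<beta> x * \<beta> y)) * expectation (P (T - {y})))"
    by (simp add: sum_distrib_left algebra_simps sum.distrib)
  also have "\<dots> = (\<Sum>y\<in>T. if e y \<noteq> e x then v * expectation (P (T - {y})) else 0)"
    by (intro sum.cong) (auto simp: \<beta>_def)
  also have "\<dots> = (\<Sum>y\<in>{y\<in>T. e y \<noteq> e x}. v * expectation (P (T - {y})))"
    using T by (simp add: sum.inter_filter)
  finally show ?thesis unfolding P_def H .
qed

lemma (in prob_space) real_gaussian_ibp:
  assumes U: "distributed M lborel U (normal_density 0 (sqrt v))"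
    and v: "v > 0" and T: "finite T" "x \<notin> T"
  shows "expectation (\<lambda>\<omega>. \<Prod>t\<in>insert x T. complex_of_real (U \<omega>)) =
    (\<Sum>y\<in>T. v * expectation (\<lambda>\<omega>. \<Prod>t\<in>T - {y}. complex_of_real (U \<omega>)))"
proof -
  have "sqrt v > 0" using v by simp
  from normal_stein_prod[OF U this T(1), of "\<lambda>_. 1" "\<lambda>_. 0"] T v
  show ?thesis by (simp add: sum_distrib_left)
qed

locale gue_space = prob_space M for M :: "'w measure" +
  fixes N :: nat and v :: real and X :: "'w \<Rightarrow> complex mat"
  assumes v_pos: "v > 0" and gue: "gue N v X"
begin

lemma gueD:
  "random_matrix N X" "AE \<omega> in M. mat_adjoint (X \<omega>) = X \<omega>"
  "indep_vars (\<lambda>_. borel) (\<lambda>(r, s) \<omega>. X \<omega> $$ (r, s)) {(r, s). r \<le> s \<and> s < N}"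
  "r < N \<Longrightarrow> distributed M lborel (\<lambda>\<omega>. Re (X \<omega> $$ (r, r))) (normal_density 0 (sqrt v))"
  "r < s \<Longrightarrow> s < N \<Longrightarrow> indep_var borel (\<lambda>\<omega>. Re (X \<omega> $$ (r, s))) borel (\<lambda>\<omega>. Im (X \<omega> $$ (r, s)))"
  "r < s \<Longrightarrow> s < N \<Longrightarrow> distributed M lborel (\<lambda>\<omega>. Re (X \<omega> $$ (r, s))) (normal_density 0 (sqrt (v / 2)))"
  "r < s \<Longrightarrow> s < N \<Longrightarrow> distributed M lborel (\<lambda>\<omega>. Im (X \<omega> $$ (r, s))) (normal_density 0 (sqrt (v / 2)))"
  using gue by (auto simp: gue_def)

lemma X_carrier: "\<omega> \<in> space M \<Longrightarrow> X \<omega> \<in> carrier_mat N N"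
  and X_measurable: "r < N \<Longrightarrow> s < N \<Longrightarrow> random_variable borel (\<lambda>\<omega>. X \<omega> $$ (r, s))"
  using gueD(1) by (auto simp: random_matrix_def)

lemma X_hermitian: "AE \<omega> in M. \<forall>r<N. \<forall>s<N. X \<omega> $$ (s, r) = cnj (X \<omega> $$ (r, s))"
  using gueD(2) AE_space
proof eventually_elim
  case (elim \<omega>)
  then have c: "X \<omega> \<in> carrier_mat N N" by (intro X_carrier)
  show ?case
  proof (intro allI impI)
    fix r s assume "r < N" "s < N"
    then have "mat_adjoint (X \<omega>) $$ (s, r) = conjugate (X \<omega> $$ (r, s))"
      using c by (simp add: mat_adjoint_def mat_of_rows_def)
    then show "X \<omega> $$ (s, r) = cnj (X \<omega> $$ (r, s))" using elim by simp
  qed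
qed

text \<open>The law is given directly only above the diagonal. Below it, and for the imaginary parts
  on it, self-adjointness decides, which holds only almost surely.\<close>

lemma X_all_moments:
  assumes "r < N" "s < N"
  shows "all_moments (\<lambda>\<omega>. X \<omega> $$ (r, s))"
proof -
  have off: "all_moments (\<lambda>\<omega>. X \<omega> $$ (r, s))" if "r < s" "s < N" for r s
  proof -
    have "all_moments (\<lambda>\<omega>. complex_of_real (Re (X \<omega> $$ (r, s))) + \<i> * complex_of_real (Im (X \<omega> $$ (r, s))))"
      using v_pos
      by (intro all_moments_add all_moments_mult all_moments_const
          all_moments_normal[OF gueD(6)[OF that]] all_moments_normal[OF gueD(7)[OF that]]) auto
    then show ?thesis by (simp add: complex_eq[symmetric])
  qed
  have AE_eq: "all_moments Y" if "all_moments Z" "AE \<omega> in M. Y \<omega> = Z \<omega>" "random_variable borel Y" for Y Z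
  proof -
    have "integrable M (\<lambda>\<omega>. norm (Y \<omega>) ^ p)" for p
    proof (rule iffD2[OF integrable_cong_AE all_moments_power[OF that(1), of p]])
      show "AE \<omega> in M. norm (Y \<omega>) ^ p = norm (Z \<omega>) ^ p" using that(2) by auto
    qed (use that all_moments_measurable[OF that(1)] in measurable)
    then show ?thesis using that(3) by (simp add: all_moments_def)
  qed
  consider "r < s" | "s < r" | "r = s" by linarith
  then show ?thesis
  proof cases
    case 2
    show ?thesis
      by (rule AE_eq[OF all_moments_cnj[OF off[OF 2 assms(1)]]])
         (use X_hermitian assms X_measurable in auto)
  next
    case 3
    have "all_moments (\<lambda>\<omega>. complex_of_real (Re (X \<omega> $$ (r, r))))"
      using all_moments_normal[OF gueD(4)[OF assms(1)]] v_pos by simp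
    moreover have "AE \<omega> in M. X \<omega> $$ (r, r) = complex_of_real (Re (X \<omega> $$ (r, r)))"
      using X_hermitian
    proof eventually_elim
      case (elim \<omega>)
      then have "X \<omega> $$ (r, r) = cnj (X \<omega> $$ (r, r))" using assms by blast
      then show ?case by (metis Reals_cnj_iff of_real_Re)
    qed
    ultimately have "all_moments (\<lambda>\<omega>. X \<omega> $$ (r, r))"
      by (rule AE_eq) (rule X_measurable[OF assms(1) assms(1)])
    then show ?thesis using 3 by simp
  qed (use off assms in auto)
qed

text \<open>All factors stem from a single position on or above the diagonal. Off the diagonal the
  condition on partners says that exactly one of the two is conjugated; on the diagonal it always
  holds, and the entry is almost surely real.\<close>

lemma half_entry_ibp:
  fixes p q :: "'t \<Rightarrow> nat" and H :: "'t \<Rightarrow> complex \<Rightarrow> complex"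
  defines "H \<equiv> \<lambda>t z. if p t \<le> q t then z else cnj z"
  assumes "finite T" "x \<notin> T" "r \<le> s" "s < N"
    and k: "\<And>t. t \<in> insert x T \<Longrightarrow> (min (p t) (q t), max (p t) (q t)) = (r, s)"
  shows "expectation (\<lambda>\<omega>. \<Prod>t\<in>insert x T. H t (X \<omega> $$ (r, s))) =
    (\<Sum>y\<in>{y\<in>T. p x = q y \<and> p y = q x}. v * expectation (\<lambda>\<omega>. \<Prod>t\<in>T - {y}. H t (X \<omega> $$ (r, s))))"
proof (cases "r = s")
  case False
  then have rs: "r < s" using assms by simp
  have "(p x = q y \<and> p y = q x) = ((p y \<le> q y) \<noteq> (p x \<le> q x))" if "y \<in> T" for y
    using k[of x] k[of y] rs that by (auto simp: min_def max_def split: if_splits)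
  then have "{y\<in>T. p x = q y \<and> p y = q x} = {y\<in>T. (p y \<le> q y) \<noteq> (p x \<le> q x)}" by auto
  then show ?thesis
    using complex_gaussian_ibp[OF gueD(5-7)[OF rs assms(5)] v_pos assms(2,3), of "\<lambda>t. p t \<le> q t"]
    unfolding H_def by simp
next
  case True
  have pq: "p t = r \<and> q t = r" if "t \<in> insert x T" for t
    using k[OF that] True by (auto simp: min_def max_def split: if_splits)
  have AE: "expectation (\<lambda>\<omega>. \<Prod>t\<in>B. H t (X \<omega> $$ (r, s))) = expectation (\<lambda>\<omega>. \<Prod>t\<in>B. complex_of_real (Re (X \<omega> $$ (r, r))))"
    if "B \<subseteq> insert x T" for B
  proof (rule integral_cong_AE)
    have [measurable]: "random_variable borel (\<lambda>\<omega>. X \<omega> $$ (r, r))" using X_measurable assms True by auto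
    have "(\<lambda>\<omega>. \<Prod>t\<in>B. H t (X \<omega> $$ (r, s))) = (\<lambda>\<omega>. \<Prod>t\<in>B. X \<omega> $$ (r, r))"
      using pq that True unfolding H_def by (intro ext prod.cong) auto
    then show "(\<lambda>\<omega>. \<Prod>t\<in>B. H t (X \<omega> $$ (r, s))) \<in> borel_measurable M" by simp
    show "(\<lambda>\<omega>. \<Prod>t\<in>B. complex_of_real (Re (X \<omega> $$ (r, r)))) \<in> borel_measurable M" by measurable
    show "AE \<omega> in M. (\<Prod>t\<in>B. H t (X \<omega> $$ (r, s))) = (\<Prod>t\<in>B. complex_of_real (Re (X \<omega> $$ (r, r))))"
      using X_hermitian
    proof eventually_elim
      case (elim \<omega>)
      then have "X \<omega> $$ (r, r) = cnj (X \<omega> $$ (r, r))" using assms True by blast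
      then have "X \<omega> $$ (r, r) = of_real (Re (X \<omega> $$ (r, r)))" by (metis Reals_cnj_iff of_real_Re)
      then show ?case using pq that True unfolding H_def by (intro prod.cong) auto
    qed
  qed
  have "{y\<in>T. p x = q y \<and> p y = q x} = T" using pq by auto
  moreover have "expectation (\<lambda>\<omega>. \<Prod>t\<in>T - {y}. H t (X \<omega> $$ (r, s))) =
      expectation (\<lambda>\<omega>. \<Prod>t\<in>T - {y}. complex_of_real (Re (X \<omega> $$ (r, r))))" for y
    by (rule AE) auto
  ultimately show ?thesis
    using real_gaussian_ibp[OF gueD(4) v_pos assms(2,3), of r] AE[of "insert x T"] assms True
    by simp
qed

text \<open>Only the entries on and above the diagonal are independent. Conjugation moves each
  factor there, and the factors are grouped by their unordered pair of indices.\<close>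

lemma expectation_prod_factor:
  fixes p q :: "'t \<Rightarrow> nat" and H :: "'t \<Rightarrow> complex \<Rightarrow> complex"
  defines "H \<equiv> \<lambda>t z. if p t \<le> q t then z else cnj z"
    and "\<kappa> \<equiv> \<lambda>t. (min (p t) (q t), max (p t) (q t))"
  assumes "finite S" "\<And>t. t \<in> S \<Longrightarrow> p t < N \<and> q t < N"
  shows "expectation (\<lambda>\<omega>. \<Prod>t\<in>S. X \<omega> $$ (p t, q t)) =
    (\<Prod>k\<in>{(r, s). r \<le> s \<and> s < N}. expectation (\<lambda>\<omega>. \<Prod>t\<in>{t\<in>S. \<kappa> t = k}. H t (X \<omega> $$ k)))"
proof -
  define K where "K = {(r, s). r \<le> s \<and> s < N}"
  have K: "finite K" by (rule finite_subset[of _ "{..<N} \<times> {..<N}"]) (auto simp: K_def)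
  have "\<kappa> ` S \<subseteq> K" using assms(4) by (auto simp: \<kappa>_def K_def)
  have Hm: "H t \<in> borel_measurable borel" for t
    unfolding H_def by (cases "p t \<le> q t") (auto intro!: borel_measurable_continuous_onI continuous_intros)
  have Km: "all_moments (\<lambda>\<omega>. X \<omega> $$ k)" if "k \<in> K" for k
    using that X_all_moments by (auto simp: K_def)
  have Ham: "all_moments (\<lambda>\<omega>. H t (X \<omega> $$ k))" if "k \<in> K" for t k
    unfolding H_def using Km[OF that] by (cases "p t \<le> q t") auto
  have "expectation (\<lambda>\<omega>. \<Prod>t\<in>S. X \<omega> $$ (p t, q t)) = expectation (\<lambda>\<omega>. \<Prod>k\<in>K. \<Prod>t\<in>{t\<in>S. \<kappa> t = k}. H t (X \<omega> $$ k))"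
  proof (rule integral_cong_AE)
    show "(\<lambda>\<omega>. \<Prod>t\<in>S. X \<omega> $$ (p t, q t)) \<in> borel_measurable M"
      using X_measurable assms(4) by (intro borel_measurable_prod) auto
    show "(\<lambda>\<omega>. \<Prod>k\<in>K. \<Prod>t\<in>{t\<in>S. \<kappa> t = k}. H t (X \<omega> $$ k)) \<in> borel_measurable M"
      by (intro borel_measurable_prod all_moments_measurable Ham)
    show "AE \<omega> in M. (\<Prod>t\<in>S. X \<omega> $$ (p t, q t)) = (\<Prod>k\<in>K. \<Prod>t\<in>{t\<in>S. \<kappa> t = k}. H t (X \<omega> $$ k))"
      using X_hermitian
    proof eventually_elim
      case (elim \<omega>)
      have "(\<Prod>k\<in>K. \<Prod>t\<in>{t\<in>S. \<kappa> t = k}. H t (X \<omega> $$ k)) = (\<Prod>k\<in>K. \<Prod>t\<in>{t\<in>S. \<kappa> t = k}. X \<omega> $$ (p t, q t))"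
      proof (intro prod.cong refl)
        fix k t assume "k \<in> K" "t \<in> {t\<in>S. \<kappa> t = k}"
        then have "k = \<kappa> t" "p t < N" "q t < N" using assms(4) by auto
        then have e: "X \<omega> $$ (p t, q t) = cnj (X \<omega> $$ (q t, p t))" "k = \<kappa> t" using elim by blast+
        show "H t (X \<omega> $$ k) = X \<omega> $$ (p t, q t)"
        proof (cases "p t \<le> q t")
          case True
          then show ?thesis unfolding H_def \<kappa>_def e(2) by (simp add: min_def max_def)
        next
          case False
          then show ?thesis unfolding H_def \<kappa>_def e(2) e(1) by (simp add: min_def max_def)
        qed
      qed
      then show ?case using prod.group[OF assms(3) K \<open>\<kappa> ` S \<subseteq> K\<close>, of "\<lambda>t. X \<omega> $$ (p t, q t)"] by simp
    qed
  qed
  also have "\<dots> = (\<Prod>k\<in>K. expectation (\<lambda>\<omega>. \<Prod>t\<in>{t\<in>S. \<kappa> t = k}. H t (X \<omega> $$ k)))"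
  proof (rule indep_vars_lebesgue_integral[OF K])
    have "indep_vars (\<lambda>_. borel) (\<lambda>k \<omega>. (\<lambda>z. \<Prod>t\<in>{t\<in>S. \<kappa> t = k}. H t z) ((\<lambda>(r, s) \<omega>. X \<omega> $$ (r, s)) k \<omega>)) K"
      using gueD(3) unfolding K_def[symmetric]
      by (rule indep_vars_compose2) (intro borel_measurable_prod Hm)
    then show "indep_vars (\<lambda>_. borel) (\<lambda>k \<omega>. \<Prod>t\<in>{t\<in>S. \<kappa> t = k}. H t (X \<omega> $$ k)) K"
      by (simp add: case_prod_beta)
    show "\<And>k. k \<in> K \<Longrightarrow> integrable M (\<lambda>\<omega>. \<Prod>t\<in>{t\<in>S. \<kappa> t = k}. H t (X \<omega> $$ k))"
      by (intro all_moments_integrable all_moments_prod Ham)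
  qed
  finally show ?thesis unfolding K_def .
qed

text \<open>Integration by parts in the one block that contains \<open>x\<close>. Every admissible
  partner lies in this block, and independence carries the other blocks along unchanged.\<close>

lemma wick_step:
  fixes p q :: "'t \<Rightarrow> nat"
  assumes "finite S" "x \<notin> S" "\<And>t. t \<in> insert x S \<Longrightarrow> p t < N \<and> q t < N"
  shows "expectation (\<lambda>\<omega>. \<Prod>t\<in>insert x S. X \<omega> $$ (p t, q t)) =
    (\<Sum>y\<in>{y\<in>S. p x = q y \<and> p y = q x}. v * expectation (\<lambda>\<omega>. \<Prod>t\<in>S - {y}. X \<omega> $$ (p t, q t)))"
proof -
  define H :: "'t \<Rightarrow> complex \<Rightarrow> complex" where "H = (\<lambda>t z. if p t \<le> q t then z else cnj z)"
  define \<kappa> where "\<kappa> = (\<lambda>t. (min (p t) (q t), max (p t) (q t)))"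
  define K where "K = {(r, s). r \<le> s \<and> s < N}"
  have K: "finite K" by (rule finite_subset[of _ "{..<N} \<times> {..<N}"]) (auto simp: K_def)
  define m where "m = (\<lambda>k B. expectation (\<lambda>\<omega>. \<Prod>t\<in>B. H t (X \<omega> $$ k)))"
  have factor: "expectation (\<lambda>\<omega>. \<Prod>t\<in>B. X \<omega> $$ (p t, q t)) = (\<Prod>k\<in>K. m k {t\<in>B. \<kappa> t = k})"
    if "finite B" "\<And>t. t \<in> B \<Longrightarrow> p t < N \<and> q t < N" for B
    unfolding m_def H_def \<kappa>_def K_def by (rule expectation_prod_factor[OF that])
  obtain r s where rs: "\<kappa> x = (r, s)" "r \<le> s" "s < N"
    using assms(3)[of x] by (auto simp: \<kappa>_def)
  define e where "e = (r, s)"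
  have eK: "e \<in> K" using rs by (simp add: e_def K_def)
  define Y where "Y = {y\<in>S. p x = q y \<and> p y = q x}"
  have Ye: "\<kappa> y = e" if "y \<in> Y" for y using that rs by (auto simp: Y_def \<kappa>_def e_def min_def max_def split: if_splits)
  have "expectation (\<lambda>\<omega>. \<Prod>t\<in>insert x S. X \<omega> $$ (p t, q t)) = (\<Prod>k\<in>K. m k {t\<in>insert x S. \<kappa> t = k})"
    by (rule factor) (use assms in auto)
  also have "\<dots> = m e (insert x {t\<in>S. \<kappa> t = e}) * (\<Prod>k\<in>K - {e}. m k {t\<in>S. \<kappa> t = k})"
    unfolding prod.remove[OF K eK]
  proof (rule arg_cong2[of _ _ _ _ "(*)"])
    show "m e {t\<in>insert x S. \<kappa> t = e} = m e (insert x {t\<in>S. \<kappa> t = e})"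
      by (rule arg_cong[of _ _ "m e"]) (use rs in \<open>auto simp: e_def\<close>)
    show "(\<Prod>k\<in>K - {e}. m k {t \<in> insert x S. \<kappa> t = k}) = (\<Prod>k\<in>K - {e}. m k {t \<in> S. \<kappa> t = k})"
    proof (rule prod.cong[OF refl])
      fix k assume "k \<in> K - {e}"
      then have "{t \<in> insert x S. \<kappa> t = k} = {t \<in> S. \<kappa> t = k}" using rs by (auto simp: e_def)
      then show "m k {t \<in> insert x S. \<kappa> t = k} = m k {t \<in> S. \<kappa> t = k}" by simp
    qed
  qed
  also have "m e (insert x {t\<in>S. \<kappa> t = e}) = (\<Sum>y\<in>{y\<in>{t\<in>S. \<kappa> t = e}. p x = q y \<and> p y = q x}. v * m e ({t\<in>S. \<kappa> t = e} - {y}))"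
    unfolding m_def e_def H_def
    by (rule half_entry_ibp) (use assms rs in \<open>auto simp: \<kappa>_def\<close>)
  also have "{y\<in>{t\<in>S. \<kappa> t = e}. p x = q y \<and> p y = q x} = Y" using Ye by (auto simp: Y_def)
  also have "(\<Sum>y\<in>Y. v * m e ({t\<in>S. \<kappa> t = e} - {y})) * (\<Prod>k\<in>K - {e}. m k {t\<in>S. \<kappa> t = k}) =
      (\<Sum>y\<in>Y. v * (m e ({t\<in>S. \<kappa> t = e} - {y}) * (\<Prod>k\<in>K - {e}. m k {t\<in>S. \<kappa> t = k})))"
    by (simp add: sum_distrib_right mult.assoc)
  also have "\<dots> = (\<Sum>y\<in>Y. v * expectation (\<lambda>\<omega>. \<Prod>t\<in>S - {y}. X \<omega> $$ (p t, q t)))"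
  proof (intro sum.cong refl arg_cong2[of _ _ _ _ "(*)"])
    fix y assume y: "y \<in> Y"
    have "expectation (\<lambda>\<omega>. \<Prod>t\<in>S - {y}. X \<omega> $$ (p t, q t)) = (\<Prod>k\<in>K. m k {t\<in>S - {y}. \<kappa> t = k})"
      by (rule factor) (use assms in auto)
    also have "\<dots> = m e {t\<in>S - {y}. \<kappa> t = e} * (\<Prod>k\<in>K - {e}. m k {t\<in>S - {y}. \<kappa> t = k})"
      by (rule prod.remove[OF K eK])
    also have "{t\<in>S - {y}. \<kappa> t = e} = {t\<in>S. \<kappa> t = e} - {y}" by auto
    also have "(\<Prod>k\<in>K - {e}. m k {t\<in>S - {y}. \<kappa> t = k}) = (\<Prod>k\<in>K - {e}. m k {t\<in>S. \<kappa> t = k})"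
    proof (rule prod.cong[OF refl])
      fix k assume "k \<in> K - {e}"
      then have "{t \<in> S - {y}. \<kappa> t = k} = {t \<in> S. \<kappa> t = k}" using Ye[OF y] by auto
      then show "m k {t \<in> S - {y}. \<kappa> t = k} = m k {t \<in> S. \<kappa> t = k}" by simp
    qed
    finally show "m e ({t\<in>S. \<kappa> t = e} - {y}) * (\<Prod>k\<in>K - {e}. m k {t\<in>S. \<kappa> t = k}) =
      expectation (\<lambda>\<omega>. \<Prod>t\<in>S - {y}. X \<omega> $$ (p t, q t))" by simp
  qed
  finally show ?thesis unfolding Y_def .
qed

lemma wick:
  fixes p q :: "'t \<Rightarrow> nat"
  assumes "finite S" "\<And>t. t \<in> S \<Longrightarrow> p t < N \<and> q t < N"
  shows "expectation (\<lambda>\<omega>. \<Prod>t\<in>S. X \<omega> $$ (p t, q t)) =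
    of_real (v ^ (card S div 2)) * of_nat (card (matchings S p q))"
  using assms
proof (induction "card S" arbitrary: S rule: less_induct)
  case less
  show ?case
  proof (cases "S = {}")
    case True
    then show ?thesis by (simp add: matchings_def pairings_empty prob_space)
  next
    case False
    then obtain x T where T: "S = insert x T" "x \<notin> T" "finite T"
      using less.prems(1) by (metis finite_insert mk_disjoint_insert ex_in_conv)
    have "expectation (\<lambda>\<omega>. \<Prod>t\<in>S. X \<omega> $$ (p t, q t)) =
      (\<Sum>y\<in>{y\<in>T. p x = q y \<and> p y = q x}. v * expectation (\<lambda>\<omega>. \<Prod>t\<in>T - {y}. X \<omega> $$ (p t, q t)))"
      unfolding T(1) by (rule wick_step) (use T less.prems in auto)
    also have "\<dots> = (\<Sum>y\<in>{y\<in>T. p x = q y \<and> p y = q x}. of_real (v ^ (card S div 2)) * of_nat (card (matchings (T - {y}) p q)))"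
    proof (rule sum.cong[OF refl])
      fix y assume y: "y \<in> {y\<in>T. p x = q y \<and> p y = q x}"
      then have c: "card S = card (T - {y}) + 2"
        using T by (metis (no_types, lifting) Suc_diff_1 add_2_eq_Suc' card_Diff_singleton card_gt_0_iff card_insert_disjoint empty_iff mem_Collect_eq)
      have "expectation (\<lambda>\<omega>. \<Prod>t\<in>T - {y}. X \<omega> $$ (p t, q t)) =
        of_real (v ^ (card (T - {y}) div 2)) * of_nat (card (matchings (T - {y}) p q))"
        using T c less.prems by (intro less.hyps) auto
      then show "v * expectation (\<lambda>\<omega>. \<Prod>t\<in>T - {y}. X \<omega> $$ (p t, q t)) =
        of_real (v ^ (card S div 2)) * of_nat (card (matchings (T - {y}) p q))"
        unfolding c by simp
    qed
    also have "\<dots> = of_real (v ^ (card S div 2)) * of_nat (card (matchings S p q))"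
      unfolding T(1) matchings_insert[OF T(3,2)] by (simp add: sum_distrib_left)
    finally show ?thesis .
  qed
qed

end

section \<open>Walks in the band that respect a pairing\<close>

definition band :: "nat \<Rightarrow> nat \<Rightarrow> nat \<Rightarrow> nat \<Rightarrow> bool" where
  "band N b r s \<longleftrightarrow> periodic_dist N r s \<le> int b"

definition band_width :: "nat \<Rightarrow> nat \<Rightarrow> nat" where
  "band_width N b = min (2 * b + 1) N"

text \<open>Integer representatives of the differences modulo \<open>N\<close> that the band allows. In the first case the set
  is symmetric about \<open>0\<close>; in the second the band imposes no constraint.\<close>

definition steps :: "nat \<Rightarrow> nat \<Rightarrow> int set" where
  "steps N b = (if 2 * b + 1 \<le> N then {- int b..int b} else {0..<int N})"

lemma finite_steps [simp]: "finite (steps N b)"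
  by (simp add: steps_def)

lemma card_steps: "card (steps N b) = band_width N b"
  by (auto simp: steps_def band_width_def)

lemma band_width_pos: "N > 0 \<Longrightarrow> band_width N b > 0"
  by (simp add: band_width_def)

text \<open>Two representatives differ by less than \<open>N\<close>. This turns a congruence
  between admissible steps into an equality wherever a step is to be determined by the
  others.\<close>

lemma steps_inj:
  assumes "d \<in> steps N b" "d' \<in> steps N b" "int N dvd d - d'"
  shows "d = d'"
proof -
  have "\<bar>d - d'\<bar> < int N"
    using assms(1,2) by (auto simp: steps_def split: if_splits)
  then show ?thesis using assms(3) dvd_imp_le_int[of "d - d'" "int N"] by fastforce
qed

lemma band_commute: "band N b r s \<longleftrightarrow> band N b s r"
  by (simp add: band_def periodic_dist_def abs_minus_commute)

text \<open>\<open>s - r\<close> lies strictly between \<open>- N\<close> and \<open>N\<close>, so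
  adding one of \<open>- N\<close>, \<open>0\<close>, \<open>N\<close> reaches the representative.
  If \<open>2 * b + 1 > N\<close>, all pairs are in the band and the residue modulo \<open>N\<close>
  serves.\<close>

lemma band_iff_step:
  assumes "r < N" "s < N"
  shows "band N b r s \<longleftrightarrow> (\<exists>d\<in>steps N b. int N dvd int s - int r - d)"
proof (cases "2 * b + 1 \<le> N")
  case False
  have "band N b r s" using False assms by (auto simp: band_def periodic_dist_def)
  moreover have "(int s - int r) mod int N \<in> steps N b" using False assms by (simp add: steps_def)
  moreover have "int N dvd int s - int r - (int s - int r) mod int N" by (simp add: dvd_minus_mod)
  ultimately show ?thesis by blast
next
  case True
  define k where "k = int s - int r"
  have k: "\<bar>k\<bar> < int N" using assms by (auto simp: k_def)
  have pd: "band N b r s \<longleftrightarrow> \<bar>k\<bar> \<le> int b \<or> int N - \<bar>k\<bar> \<le> int b"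
    by (auto simp: band_def periodic_dist_def k_def)
  have S: "steps N b = {- int b..int b}" using True by (simp add: steps_def)
  show ?thesis
  proof
    assume "band N b r s"
    then consider "\<bar>k\<bar> \<le> int b" | "int N - \<bar>k\<bar> \<le> int b" "k \<ge> 0" | "int N - \<bar>k\<bar> \<le> int b" "k < 0"
      using pd by linarith
    then show "\<exists>d\<in>steps N b. int N dvd int s - int r - d"
    proof cases
      case 1
      then show ?thesis unfolding S k_def by (intro bexI[of _ k]) (auto simp: k_def)
    next
      case 2
      then show ?thesis using k unfolding S by (intro bexI[of _ "k - int N"]) (auto simp: k_def)
    next
      case 3
      then show ?thesis using k unfolding S by (intro bexI[of _ "k + int N"]) (auto simp: k_def)
    qed
  next
    assume "\<exists>d\<in>steps N b. int N dvd int s - int r - d"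
    then obtain d where d': "d \<in> steps N b" "int N dvd k - d" unfolding k_def by blast
    then obtain m where m: "k - d = int N * m" by (elim dvdE)
    have d: "\<bar>d\<bar> \<le> int b" using d' unfolding S by auto
    \<comment> \<open>\<open>k\<close> and \<open>d\<close> are both smaller than \<open>N\<close>
      in absolute value, so only a direct step or a single wrap around the cycle is
      possible.\<close>
    have "\<bar>int N * m\<bar> < int N * 2" using d k True m by linarith
    then have "int N * \<bar>m\<bar> < int N * 2" by (simp add: abs_mult)
    then have "\<bar>m\<bar> < 2" using assms(1) by (simp add: mult_less_cancel_left)
    then have "m = 0 \<or> m = 1 \<or> m = -1" by linarith
    then show "band N b r s" unfolding pd using m d k by auto
  qed
qed

text \<open>A pairing splits the positions into openers and closers. A walk that respects the pairing is determined by
  its starting point and its steps at the openers, because a closer reverts the step of its partner.\<close>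

definition openers :: "nat \<Rightarrow> (nat \<Rightarrow> nat) \<Rightarrow> nat set" where
  "openers n \<pi> = {t. t < n \<and> t < \<pi> t}"

definition signed_step :: "(nat \<Rightarrow> nat) \<Rightarrow> (nat \<Rightarrow> int) \<Rightarrow> nat \<Rightarrow> int" where
  "signed_step \<pi> f t = (if t < \<pi> t then f t else - f (\<pi> t))"

definition position :: "(nat \<Rightarrow> nat) \<Rightarrow> (nat \<Rightarrow> int) \<Rightarrow> nat \<Rightarrow> int" where
  "position \<pi> f t = (\<Sum>r<t. signed_step \<pi> f r)"

text \<open>The last condition is that of \<open>matchings\<close> for the factors
  \<open>X (i t, i (t + 1))\<close>. A return to \<open>j\<close> is not demanded; it follows
  (\<open>walk_closed\<close>).\<close>

definition walks :: "nat \<Rightarrow> nat \<Rightarrow> nat \<Rightarrow> (nat \<Rightarrow> nat) \<Rightarrow> nat \<Rightarrow> (nat \<Rightarrow> nat) set" where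
  "walks N b n \<pi> j = {i \<in> {..n} \<rightarrow>\<^sub>E {..<N}. i 0 = j \<and> (\<forall>t<n. band N b (i t) (i (Suc t))) \<and>
     (\<forall>t<n. i t = i (Suc (\<pi> t)))}"

text \<open>The starting point has dropped out, as only differences of displacements enter.
  Displacements are integers subject to congruences, not residues, so that wrapping around can later
  be excluded by size.\<close>

definition step_solutions :: "nat \<Rightarrow> nat \<Rightarrow> nat \<Rightarrow> (nat \<Rightarrow> nat) \<Rightarrow> (nat \<Rightarrow> int) set" where
  "step_solutions N b n \<pi> = {f \<in> openers n \<pi> \<rightarrow>\<^sub>E steps N b.
     \<forall>t<n. int N dvd position \<pi> f (Suc (\<pi> t)) - position \<pi> f t}"

definition crossing :: "nat \<Rightarrow> (nat \<Rightarrow> nat) \<Rightarrow> bool" where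
  "crossing n \<pi> \<longleftrightarrow> (\<exists>t q. t < q \<and> q < \<pi> t \<and> \<pi> t < \<pi> q \<and> \<pi> q < n)"

lemma finite_openers [simp]: "finite (openers n \<pi>)"
  by (simp add: openers_def)

lemma position_Suc: "position \<pi> f (Suc t) = position \<pi> f t + signed_step \<pi> f t"
  by (simp add: position_def)

lemma position_0 [simp]: "position \<pi> f 0 = 0"
  by (simp add: position_def)

lemma position_diff: "u \<le> t \<Longrightarrow> position \<pi> f t - position \<pi> f u = (\<Sum>r\<in>{u..<t}. signed_step \<pi> f r)"
  unfolding position_def
  by (metis add_diff_cancel_left' atLeast0LessThan le0 sum.atLeastLessThan_concat)

lemma signed_step_diff: "signed_step \<pi> (\<lambda>t. f t - g t) t = signed_step \<pi> f t - signed_step \<pi> g t"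
  by (simp add: signed_step_def)

lemma position_minus: "position \<pi> (\<lambda>t. f t - g t) t = position \<pi> f t - position \<pi> g t"
  by (simp add: position_def signed_step_diff sum_subtractf)

section \<open>Counting the solutions of the step relations\<close>

locale walk_pairing =
  fixes n :: nat and \<pi> :: "nat \<Rightarrow> nat"
  assumes pairing: "\<pi> \<in> pairings {..<n}"
begin

lemma pi: "t < n \<Longrightarrow> \<pi> t < n" "t < n \<Longrightarrow> \<pi> t \<noteq> t" "\<pi> (\<pi> t) = t"
  using pairingsD[OF pairing] by auto

lemma opener_or_image: "t < n \<Longrightarrow> t \<in> openers n \<pi> \<or> \<pi> t \<in> openers n \<pi>"
  using pi[of t] by (auto simp: openers_def)

lemma card_openers: "card (openers n \<pi>) = n div 2"
proof -
  have "{..<n} = openers n \<pi> \<union> \<pi> ` openers n \<pi>"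
  proof (intro equalityI subsetI)
    fix t assume "t \<in> {..<n}"
    then show "t \<in> openers n \<pi> \<union> \<pi> ` openers n \<pi>"
      using opener_or_image[of t] pi(3)[of t] by (metis UnI1 UnI2 imageI lessThan_iff)
  qed (auto simp: openers_def pi)
  moreover have "openers n \<pi> \<inter> \<pi> ` openers n \<pi> = {}" by (auto simp: openers_def pi)
  moreover have "inj_on \<pi> (openers n \<pi>)" by (metis inj_onI pi(3))
  ultimately have "n = card (openers n \<pi>) + card (openers n \<pi>)"
    by (metis card_Un_disjoint card_image card_lessThan finite_imageI finite_openers)
  then show ?thesis by linarith
qed

lemma signed_step_pi: "t < n \<Longrightarrow> signed_step \<pi> f (\<pi> t) = - signed_step \<pi> f t"
  using pi[of t] by (auto simp: signed_step_def)

lemma sum_signed_step_invariant: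
  assumes "A \<subseteq> {..<n}" "\<pi> ` A \<subseteq> A"
  shows "(\<Sum>r\<in>A. signed_step \<pi> f r) = 0"
proof -
  have "bij_betw \<pi> A A" by (rule bij_betw_byWitness[where f'=\<pi>]) (use assms pi in auto)
  then have "(\<Sum>r\<in>A. signed_step \<pi> f r) = (\<Sum>r\<in>A. signed_step \<pi> f (\<pi> r))"
    by (rule sum.reindex_bij_betw[symmetric])
  also have "\<dots> = - (\<Sum>r\<in>A. signed_step \<pi> f r)"
    unfolding sum_negf[symmetric] by (intro sum.cong) (use assms signed_step_pi in auto)
  finally show ?thesis by simp
qed

lemma noncrossing_invariant:
  assumes "\<not> crossing n \<pi>" "t < \<pi> t" "t < n"
  shows "\<pi> ` {Suc t..<\<pi> t} \<subseteq> {Suc t..<\<pi> t}"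
proof safe
  fix r assume "r \<in> {Suc t..<\<pi> t}"
  then have r: "t < r" "r < \<pi> t" by auto
  have n: "r < n" using r pi(1)[OF assms(3)] by simp
  have "\<pi> r \<noteq> t" "\<pi> r \<noteq> \<pi> t" using r pi(3) by (metis less_irrefl)+
  moreover have "\<not> \<pi> r < t"
  proof
    assume "\<pi> r < t"
    then have "crossing n \<pi>" unfolding crossing_def
      using r pi(3)[of r] pi(1)[OF assms(3)] by (intro exI[of _ "\<pi> r"] exI[of _ t]) auto
    then show False using assms by simp
  qed
  moreover have "\<not> \<pi> t < \<pi> r"
  proof
    assume "\<pi> t < \<pi> r"
    then have "crossing n \<pi>" unfolding crossing_def
      using r pi(1)[OF n] by (intro exI[of _ t] exI[of _ r]) auto
    then show False using assms by simp
  qed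
  ultimately show "\<pi> r \<in> {Suc t..<\<pi> t}" by auto
qed

text \<open>Without crossings, every pair with one end between \<open>t\<close> and its partner has
  the other end there too. So the steps in between cancel, and the relation holds over the integers
  without constraining any opener.\<close>

lemma noncrossing_position:
  assumes "\<not> crossing n \<pi>" "t < n"
  shows "position \<pi> f (Suc (\<pi> t)) = position \<pi> f t"
proof -
  have I: "(\<Sum>r\<in>{Suc u..<\<pi> u}. signed_step \<pi> f r) = 0" if "u < \<pi> u" "u < n" for u
    using noncrossing_invariant[OF assms(1) that] pi(1)[OF that(2)]
    by (intro sum_signed_step_invariant) auto
  have P: "position \<pi> f (\<pi> u) = position \<pi> f (Suc u)" if "u < \<pi> u" "u < n" for u
    using I[OF that] position_diff[of "Suc u" "\<pi> u" \<pi> f] that by simp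
  consider "t < \<pi> t" | "\<pi> t < t" using pi(2)[OF assms(2)] by linarith
  then show ?thesis
  proof cases
    case 1
    then show ?thesis using P[OF 1 assms(2)] signed_step_pi[OF assms(2), of f] by (simp add: position_Suc)
  next
    case 2
    then show ?thesis using P[of "\<pi> t"] pi[of t] assms(2) by simp
  qed
qed

lemma card_solutions_noncrossing:
  assumes "\<not> crossing n \<pi>"
  shows "card (step_solutions N b n \<pi>) = band_width N b ^ (n div 2)"
proof -
  have "step_solutions N b n \<pi> = openers n \<pi> \<rightarrow>\<^sub>E steps N b"
    using noncrossing_position[OF assms] by (auto simp: step_solutions_def)
  then show ?thesis by (simp add: card_PiE card_steps card_openers)
qed

lemma finite_step_solutions: "finite (step_solutions N b n \<pi>)"
  by (rule finite_subset[of _ "openers n \<pi> \<rightarrow>\<^sub>E steps N b"]) (auto simp: step_solutions_def intro!: finite_PiE)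

text \<open>The mechanism by which degrees of freedom are lost: restriction to the openers outside
  \<open>Q\<close> is injective on \<open>A\<close>. It suffices to compare two elements that agree
  off \<open>Q\<close>, which suits linear relations.\<close>

lemma card_le_determined:
  assumes A: "A \<subseteq> openers n \<pi> \<rightarrow>\<^sub>E steps N b" and Q: "Q \<subseteq> openers n \<pi>"
    and det: "\<And>f g q. f \<in> A \<Longrightarrow> g \<in> A \<Longrightarrow> (\<And>r. r \<notin> Q \<Longrightarrow> f r = g r) \<Longrightarrow> q \<in> Q \<Longrightarrow> f q = g q"
  shows "card A \<le> band_width N b ^ (n div 2 - card Q)"
proof -
  have "card A \<le> card ((openers n \<pi> - Q) \<rightarrow>\<^sub>E steps N b)"
  proof (rule card_inj_on_le)
    show "inj_on (\<lambda>f. restrict f (openers n \<pi> - Q)) A"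
    proof (rule inj_onI)
      fix f g assume fg: "f \<in> A" "g \<in> A" and e: "restrict f (openers n \<pi> - Q) = restrict g (openers n \<pi> - Q)"
      have off: "f r = g r" if "r \<notin> Q" for r
      proof (cases "r \<in> openers n \<pi>")
        case True
        then show ?thesis using fun_cong[OF e, of r] that by simp
      next
        case False
        then show ?thesis using fg A by (metis PiE_arb subsetD)
      qed
      show "f = g" using det[OF fg off] off by blast
    qed
    show "(\<lambda>f. restrict f (openers n \<pi> - Q)) ` A \<subseteq> (openers n \<pi> - Q) \<rightarrow>\<^sub>E steps N b"
      using A by fastforce
  qed (simp add: finite_PiE)
  also have "\<dots> = band_width N b ^ (n div 2 - card Q)"
    using Q finite_subset[OF Q] by (simp add: card_PiE card_steps card_Diff_subset card_openers)
  finally show ?thesis .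
qed

text \<open>This is the relation at the closer \<open>\<pi> t\<close>. The step at \<open>t\<close>
  itself has dropped out, and a pair with both ends in the interval cancels, so only the pairs
  crossing that of \<open>t\<close> remain.\<close>

lemma solution_dvd:
  assumes "f \<in> step_solutions N b n \<pi>" "t < n" "t < \<pi> t"
  shows "int N dvd (\<Sum>r\<in>{Suc t..<\<pi> t}. signed_step \<pi> f r)"
proof -
  have "int N dvd position \<pi> f (Suc (\<pi> (\<pi> t))) - position \<pi> f (\<pi> t)"
    using assms pi(1)[of t] by (auto simp: step_solutions_def)
  then have "int N dvd position \<pi> f (\<pi> t) - position \<pi> f (Suc t)"
    unfolding pi(3) by (subst dvd_diff_commute)
  then show ?thesis using position_diff[of "Suc t" "\<pi> t" \<pi> f] assms by simp
qed

text \<open>\<open>h (min r (\<pi> r))\<close> is the step at \<open>r\<close> up to sign. It is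
  applied to the difference \<open>h\<close> of two solutions that agree off very few
  openers.\<close>

lemma sum_signed_step_supported:
  assumes "A \<subseteq> {..<n}" "r0 \<in> A" "\<And>r. r \<in> A \<Longrightarrow> r \<noteq> r0 \<Longrightarrow> h (min r (\<pi> r)) = 0"
  shows "(\<Sum>r\<in>A. signed_step \<pi> h r) = signed_step \<pi> h r0"
proof -
  have "finite A" using assms(1) finite_subset by blast
  then have "(\<Sum>r\<in>A. signed_step \<pi> h r) = signed_step \<pi> h r0 + (\<Sum>r\<in>A - {r0}. signed_step \<pi> h r)"
    by (rule sum.remove) (rule assms)
  also have "(\<Sum>r\<in>A - {r0}. signed_step \<pi> h r) = 0"
  proof (intro sum.neutral ballI)
    fix r assume "r \<in> A - {r0}"
    then have "h (min r (\<pi> r)) = 0" using assms(3) by auto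
    then show "signed_step \<pi> h r = 0" by (cases "r < \<pi> r") (auto simp: signed_step_def min_def split: if_splits)
  qed
  finally show ?thesis by simp
qed

text \<open>If \<open>t\<close> and \<open>q\<close> cross, the closing relation of \<open>t\<close> determines the step at \<open>q\<close> and does not involve the step
  at \<open>t\<close>, and vice versa.\<close>

lemma card_solutions_crossing:
  assumes "crossing n \<pi>"
  shows "card (step_solutions N b n \<pi>) \<le> band_width N b ^ (n div 2 - 2)" "n div 2 \<ge> 2"
proof -
  obtain t q where tq: "t < q" "q < \<pi> t" "\<pi> t < \<pi> q" "\<pi> q < n"
    using assms by (auto simp: crossing_def)
  have Q: "{t, q} \<subseteq> openers n \<pi>" using tq by (auto simp: openers_def)
  have c2: "card {t, q} = 2" using tq by simp
  show "n div 2 \<ge> 2" using card_mono[OF finite_openers Q] c2 card_openers by simp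
  have "card (step_solutions N b n \<pi>) \<le> band_width N b ^ (n div 2 - card {t, q})"
  proof (rule card_le_determined[OF _ Q])
    show "step_solutions N b n \<pi> \<subseteq> openers n \<pi> \<rightarrow>\<^sub>E steps N b" by (auto simp: step_solutions_def)
    fix f g r0 assume fg: "f \<in> step_solutions N b n \<pi>" "g \<in> step_solutions N b n \<pi>"
      and off: "\<And>r. r \<notin> {t, q} \<Longrightarrow> f r = g r" and r0: "r0 \<in> {t, q}"
    \<comment> \<open>By linearity the difference of two solutions satisfies the relations again,
      and it is supported on \<open>t\<close> and \<open>q\<close>.\<close>
    define h where "h = (\<lambda>t. f t - g t)"
    have h0: "h r = 0" if "r \<noteq> t" "r \<noteq> q" for r using off that by (simp add: h_def)
    have dv: "int N dvd (\<Sum>r\<in>{Suc u..<\<pi> u}. signed_step \<pi> h r)" if "u < n" "u < \<pi> u" for u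
      unfolding h_def signed_step_diff sum_subtractf
      by (rule dvd_diff[OF solution_dvd[OF fg(1) that] solution_dvd[OF fg(2) that]])
    have ne: "r \<noteq> u \<Longrightarrow> \<pi> r \<noteq> \<pi> u" for r u by (metis pi(3))
    have "(\<Sum>r\<in>{Suc t..<\<pi> t}. signed_step \<pi> h r) = signed_step \<pi> h q"
    proof (rule sum_signed_step_supported)
      fix r assume r: "r \<in> {Suc t..<\<pi> t}" "r \<noteq> q"
      then have "r \<noteq> \<pi> t" "r \<noteq> \<pi> q" "r \<noteq> t" using tq by auto
      then show "h (min r (\<pi> r)) = 0" using r pi(3) by (intro h0) (auto simp: min_def)
    qed (use tq in auto)
    then have "int N dvd h q" using dv[of t] tq by (simp add: signed_step_def)
    moreover have "(\<Sum>r\<in>{Suc q..<\<pi> q}. signed_step \<pi> h r) = signed_step \<pi> h (\<pi> t)"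
    proof (rule sum_signed_step_supported)
      fix r assume r: "r \<in> {Suc q..<\<pi> q}" "r \<noteq> \<pi> t"
      then have "r \<noteq> \<pi> q" "r \<noteq> t" "r \<noteq> q" using tq by auto
      then show "h (min r (\<pi> r)) = 0" using r pi(3) by (intro h0) (auto simp: min_def)
    qed (use tq in auto)
    then have "int N dvd h t" using dv[of q] tq pi(3)[of t] by (simp add: signed_step_def)
    moreover have "f r0 \<in> steps N b" "g r0 \<in> steps N b"
      using fg Q r0 by (auto simp: step_solutions_def)
    ultimately show "f r0 = g r0" using r0 steps_inj by (auto simp: h_def)
  qed
  then show "card (step_solutions N b n \<pi>) \<le> band_width N b ^ (n div 2 - 2)" unfolding c2 .
qed

lemma card_solutions_le: "card (step_solutions N b n \<pi>) \<le> band_width N b ^ (n div 2)"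
  using card_le_determined[of "step_solutions N b n \<pi>" N b "{}"] by (auto simp: step_solutions_def)

text \<open>Fixing the walk at time \<open>m\<close> determines the step at \<open>q\<close>, which has not been reverted by then.\<close>

lemma card_solutions_connecting:
  assumes "q < m" "m \<le> \<pi> q" "q < n"
  shows "card {f \<in> step_solutions N b n \<pi>. int N dvd c - position \<pi> f m} \<le> band_width N b ^ (n div 2 - 1)"
proof -
  have Q: "{q} \<subseteq> openers n \<pi>" using assms by (auto simp: openers_def)
  have "card {f \<in> step_solutions N b n \<pi>. int N dvd c - position \<pi> f m} \<le> band_width N b ^ (n div 2 - card {q})"
  proof (rule card_le_determined[OF _ Q])
    show "{f \<in> step_solutions N b n \<pi>. int N dvd c - position \<pi> f m} \<subseteq> openers n \<pi> \<rightarrow>\<^sub>E steps N b"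
      by (auto simp: step_solutions_def)
    fix f g r0 assume fg: "f \<in> {f \<in> step_solutions N b n \<pi>. int N dvd c - position \<pi> f m}"
        "g \<in> {f \<in> step_solutions N b n \<pi>. int N dvd c - position \<pi> f m}"
      and off: "\<And>r. r \<notin> {q} \<Longrightarrow> f r = g r" and r0: "r0 \<in> {q}"
    define h where "h = (\<lambda>t. f t - g t)"
    have "int N dvd c - position \<pi> g m" "int N dvd c - position \<pi> f m" using fg by auto
    then have "int N dvd (c - position \<pi> g m) - (c - position \<pi> f m)" by (rule dvd_diff)
    then have "int N dvd position \<pi> h m" by (simp add: h_def position_minus)
    also have "position \<pi> h m = signed_step \<pi> h q"
      unfolding position_def
    proof (rule sum_signed_step_supported)
      show "{..<m} \<subseteq> {..<n}" using assms pi(1)[OF assms(3)] by auto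
      fix r assume r: "r \<in> {..<m}" "r \<noteq> q"
      then have "r \<noteq> \<pi> q" using assms by auto
      then have "min r (\<pi> r) \<noteq> q" using r pi(3) by (auto simp: min_def)
      then show "h (min r (\<pi> r)) = 0" using off by (simp add: h_def)
    qed (use assms in auto)
    finally have "int N dvd f q - g q" using assms by (simp add: signed_step_def h_def)
    moreover have "f q \<in> steps N b" "g q \<in> steps N b"
      using fg Q by (auto simp: step_solutions_def)
    ultimately show "f r0 = g r0" using steps_inj r0 by auto
  qed
  then show ?thesis by simp
qed

text \<open>By \<open>steps_inj\<close> the chosen step is the only one, which makes
  \<open>walk_of\<close> a two-sided inverse.\<close>

definition step_of :: "nat \<Rightarrow> nat \<Rightarrow> (nat \<Rightarrow> nat) \<Rightarrow> nat \<Rightarrow> int" where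
  "step_of N b i = (\<lambda>t\<in>openers n \<pi>. SOME d. d \<in> steps N b \<and> int N dvd int (i (Suc t)) - int (i t) - d)"

definition walk_of :: "nat \<Rightarrow> nat \<Rightarrow> (nat \<Rightarrow> int) \<Rightarrow> nat \<Rightarrow> nat" where
  "walk_of N j f = (\<lambda>t\<in>{..n}. nat ((int j + position \<pi> f t) mod int N))"

lemma step_of:
  assumes "i \<in> walks N b n \<pi> j"
  shows "t \<in> openers n \<pi> \<Longrightarrow> step_of N b i t \<in> steps N b"
    and "t < n \<Longrightarrow> int N dvd int (i (Suc t)) - int (i t) - signed_step \<pi> (step_of N b i) t"
    and "t \<le> n \<Longrightarrow> int N dvd int (i t) - int j - position \<pi> (step_of N b i) t"
proof -
  have i: "i t < N" if "t \<le> n" for t using assms that by (auto simp: walks_def)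
  have ex: "step_of N b i t \<in> steps N b \<and> int N dvd int (i (Suc t)) - int (i t) - step_of N b i t"
    if "t \<in> openers n \<pi>" for t
  proof -
    have "t < n" using that by (simp add: openers_def)
    then have "i t < N" "i (Suc t) < N" using i by simp_all
    moreover have "band N b (i t) (i (Suc t))" using assms \<open>t < n\<close> unfolding walks_def by blast
    ultimately have "\<exists>d. d \<in> steps N b \<and> int N dvd int (i (Suc t)) - int (i t) - d"
      using band_iff_step by blast
    from someI_ex[OF this] show ?thesis using that by (simp add: step_of_def)
  qed
  then show "t \<in> openers n \<pi> \<Longrightarrow> step_of N b i t \<in> steps N b" by blast
  have ss: "int N dvd int (i (Suc t)) - int (i t) - signed_step \<pi> (step_of N b i) t" if "t < n" for t
  proof (cases "t < \<pi> t")
    case True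
    then have "t \<in> openers n \<pi>" using that by (simp add: openers_def)
    from ex[OF this] show ?thesis using True by (simp add: signed_step_def)
  next
    case False
    then have "\<pi> t \<in> openers n \<pi>" using that pi[of t] by (auto simp: openers_def)
    then have "int N dvd int (i (Suc (\<pi> t))) - int (i (\<pi> t)) - step_of N b i (\<pi> t)" using ex by blast
    \<comment> \<open>The pairing condition at \<open>t\<close> and at \<open>\<pi> t\<close>:
      together they say that the step of the partner is traversed backwards.\<close>
    moreover have "i (Suc (\<pi> t)) = i t" "i (\<pi> t) = i (Suc t)"
      using assms that pi[of t] by (auto simp: walks_def)
    ultimately have "int N dvd int (i t) - int (i (Suc t)) - step_of N b i (\<pi> t)" by simp
    then have "int N dvd - (int (i t) - int (i (Suc t)) - step_of N b i (\<pi> t))" by (subst dvd_minus_iff)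
    then show ?thesis using False by (simp add: signed_step_def algebra_simps)
  qed
  then show "t < n \<Longrightarrow> int N dvd int (i (Suc t)) - int (i t) - signed_step \<pi> (step_of N b i) t" .
  show "t \<le> n \<Longrightarrow> int N dvd int (i t) - int j - position \<pi> (step_of N b i) t"
  proof (induction t)
    case 0
    then show ?case using assms by (simp add: walks_def)
  next
    case (Suc t)
    then have "int N dvd (int (i (Suc t)) - int (i t) - signed_step \<pi> (step_of N b i) t) +
        (int (i t) - int j - position \<pi> (step_of N b i) t)"
      using ss[of t] by (intro dvd_add) auto
    then show ?case by (simp add: position_Suc algebra_simps)
  qed
qed

text \<open>A walk is its starting point plus the displacements, reduced modulo \<open>N\<close>.
  The source depends on \<open>j\<close> and the target does not: this is translation
  invariance.\<close>

lemma bij_betw_walks: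
  assumes "j < N"
  shows "bij_betw (step_of N b) (walks N b n \<pi> j) (step_solutions N b n \<pi>)"
proof (rule bij_betw_byWitness[where f'="walk_of N j"])
  have N: "N > 0" using assms by simp
  have wo: "int (walk_of N j f t) = (int j + position \<pi> f t) mod int N" if "t \<le> n" for f t
    using that N by (simp add: walk_of_def)
  show "\<forall>i\<in>walks N b n \<pi> j. walk_of N j (step_of N b i) = i"
  proof
    fix i assume i: "i \<in> walks N b n \<pi> j"
    show "walk_of N j (step_of N b i) = i"
    proof
      fix t show "walk_of N j (step_of N b i) t = i t"
      proof (cases "t \<le> n")
        case True
        have "int N dvd int (i t) - (int j + position \<pi> (step_of N b i) t)"
          using step_of(3)[OF i True] by (simp add: algebra_simps)
        then have "int (i t) mod int N = (int j + position \<pi> (step_of N b i) t) mod int N"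
          by (simp add: mod_eq_dvd_iff)
        moreover have "i t < N" using i True by (auto simp: walks_def)
        ultimately have "int (walk_of N j (step_of N b i) t) = int (i t)" using wo[OF True] by simp
        then show ?thesis by simp
      next
        case False
        have "i \<in> {..n} \<rightarrow>\<^sub>E {..<N}" using i unfolding walks_def by blast
        then have "i t = undefined" by (rule PiE_arb) (use False in simp)
        then show ?thesis using False by (simp add: walk_of_def)
      qed
    qed
  qed
  have walk: "walk_of N j f \<in> walks N b n \<pi> j"
    and dv: "\<And>t. t < n \<Longrightarrow> int N dvd int (walk_of N j f (Suc t)) - int (walk_of N j f t) - signed_step \<pi> f t"
    if f: "f \<in> step_solutions N b n \<pi>" for f
  proof -
    have lt: "walk_of N j f t < N" if "t \<le> n" for t using wo[OF that, of f] N
      by (metis of_nat_0_less_iff of_nat_less_iff pos_mod_bound)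
    show dv: "int N dvd int (walk_of N j f (Suc t)) - int (walk_of N j f t) - signed_step \<pi> f t" if "t < n" for t
    proof -
      define A B where "A = int j + position \<pi> f (Suc t)" and "B = int j + position \<pi> f t"
      have "int (walk_of N j f (Suc t)) = A - int N * (A div int N)" "int (walk_of N j f t) = B - int N * (B div int N)"
        using that wo[of "Suc t" f] wo[of t f] by (simp_all add: A_def B_def minus_mult_div_eq_mod)
      then have "int (walk_of N j f (Suc t)) - int (walk_of N j f t) - signed_step \<pi> f t =
          int N * (B div int N - A div int N)"
        by (simp add: A_def B_def position_Suc algebra_simps)
      then show ?thesis by simp
    qed
    have bd: "band N b (walk_of N j f t) (walk_of N j f (Suc t))" if "t < n" for t
    proof (cases "t < \<pi> t")
      case True
      then have "f t \<in> steps N b" using f that by (auto simp: step_solutions_def openers_def)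
      then show ?thesis using dv[OF that] True that lt by (subst band_iff_step) (auto simp: signed_step_def)
    next
      case False
      then have "\<pi> t \<in> openers n \<pi>" using that pi[of t] by (auto simp: openers_def)
      then have s: "f (\<pi> t) \<in> steps N b" using f by (auto simp: step_solutions_def)
      have "int N dvd - (int (walk_of N j f (Suc t)) - int (walk_of N j f t) - signed_step \<pi> f t)"
        using dv[OF that] by (subst dvd_minus_iff)
      then have "int N dvd int (walk_of N j f t) - int (walk_of N j f (Suc t)) - f (\<pi> t)"
        using False by (simp add: signed_step_def algebra_simps)
      then show ?thesis unfolding band_commute[of N b "walk_of N j f t"] using s that lt
        by (subst band_iff_step) auto
    qed
    have "walk_of N j f t = walk_of N j f (Suc (\<pi> t))" if "t < n" for t
    proof -
      have "int N dvd position \<pi> f (Suc (\<pi> t)) - position \<pi> f t"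
        using f that by (auto simp: step_solutions_def)
      then have "(int j + position \<pi> f (Suc (\<pi> t))) mod int N = (int j + position \<pi> f t) mod int N"
        by (simp add: mod_eq_dvd_iff)
      then have "int (walk_of N j f t) = int (walk_of N j f (Suc (\<pi> t)))"
        using wo[of t f] wo[of "Suc (\<pi> t)" f] that pi(1)[OF that] by simp
      then show ?thesis by simp
    qed
    moreover have "walk_of N j f 0 = j" using wo[of 0 f] assms by simp
    moreover have "walk_of N j f \<in> {..n} \<rightarrow>\<^sub>E {..<N}" using lt by (auto simp: walk_of_def)
    ultimately show "walk_of N j f \<in> walks N b n \<pi> j" using bd by (auto simp: walks_def)
  qed
  show "\<forall>f\<in>step_solutions N b n \<pi>. step_of N b (walk_of N j f) = f"
  proof
    fix f assume f: "f \<in> step_solutions N b n \<pi>"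
    show "step_of N b (walk_of N j f) = f"
    proof
      fix t show "step_of N b (walk_of N j f) t = f t"
      proof (cases "t \<in> openers n \<pi>")
        case True
        then have t: "t < n" "t < \<pi> t" by (auto simp: openers_def)
        have "int N dvd (int (walk_of N j f (Suc t)) - int (walk_of N j f t) - signed_step \<pi> f t) -
          (int (walk_of N j f (Suc t)) - int (walk_of N j f t) - signed_step \<pi> (step_of N b (walk_of N j f)) t)"
          by (intro dvd_diff dv[OF f] step_of(2)[OF walk[OF f]] t)
        then have "int N dvd step_of N b (walk_of N j f) t - f t" using t by (simp add: signed_step_def)
        moreover have "f t \<in> steps N b" using f True by (auto simp: step_solutions_def)
        ultimately show ?thesis using step_of(1)[OF walk[OF f] True] steps_inj by blast
      next
        case False
        then show ?thesis using f by (auto simp: step_of_def step_solutions_def PiE_def extensional_def)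
      qed
    qed
  qed
  show "step_of N b ` walks N b n \<pi> j \<subseteq> step_solutions N b n \<pi>"
  proof safe
    fix i assume i: "i \<in> walks N b n \<pi> j"
    have "int N dvd position \<pi> (step_of N b i) (Suc (\<pi> t)) - position \<pi> (step_of N b i) t" if t: "t < n" for t
    proof -
      have "int N dvd (int (i t) - int j - position \<pi> (step_of N b i) t) -
         (int (i (Suc (\<pi> t))) - int j - position \<pi> (step_of N b i) (Suc (\<pi> t)))"
        using t pi(1)[OF t] by (intro dvd_diff step_of(3)[OF i]) auto
      moreover have "i (Suc (\<pi> t)) = i t" using i t by (auto simp: walks_def)
      ultimately show ?thesis by simp
    qed
    moreover have "step_of N b i \<in> openers n \<pi> \<rightarrow>\<^sub>E steps N b"
      using step_of(1)[OF i] by (auto simp: step_of_def)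
    ultimately show "step_of N b i \<in> step_solutions N b n \<pi>" by (auto simp: step_solutions_def)
  qed
  show "walk_of N j ` step_solutions N b n \<pi> \<subseteq> walks N b n \<pi> j" using walk by blast
qed

lemma card_walks: "j < N \<Longrightarrow> card (walks N b n \<pi> j) = card (step_solutions N b n \<pi>)"
  using bij_betw_walks bij_betw_same_card by blast

lemma card_walks_through:
  assumes "j < N" "q < m" "m \<le> \<pi> q" "q < n"
  shows "card {i \<in> walks N b n \<pi> j. i m = k} \<le> band_width N b ^ (n div 2 - 1)"
proof -
  have "card {i \<in> walks N b n \<pi> j. i m = k} \<le>
      card {f \<in> step_solutions N b n \<pi>. int N dvd (int k - int j) - position \<pi> f m}"
  proof (rule card_inj_on_le[of "step_of N b"])
    show "inj_on (step_of N b) {i \<in> walks N b n \<pi> j. i m = k}"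
      using bij_betw_imp_inj_on[OF bij_betw_walks[OF assms(1)]] by (rule inj_on_subset) auto
    have "m \<le> n" using assms pi(1)[OF assms(4)] by simp
    then show "step_of N b ` {i \<in> walks N b n \<pi> j. i m = k} \<subseteq>
        {f \<in> step_solutions N b n \<pi>. int N dvd (int k - int j) - position \<pi> f m}"
      using bij_betw_imp_surj_on[OF bij_betw_walks[OF assms(1)]] step_of(3) by fastforce
    show "finite {f \<in> step_solutions N b n \<pi>. int N dvd (int k - int j) - position \<pi> f m}"
      using finite_step_solutions by simp
  qed
  also have "\<dots> \<le> band_width N b ^ (n div 2 - 1)"
    by (rule card_solutions_connecting[OF assms(2-4)])
  finally show ?thesis .
qed

end

section \<open>Asymptotics of crossing pairings\<close>

lemma int_dvd_small: "\<bar>x\<bar> < int N \<Longrightarrow> int N dvd x \<Longrightarrow> x = 0"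
  using dvd_imp_le_int[of x "int N"] by linarith

text \<open>A variant of Fekete's lemma: the limit is \<open>Sup {F K / K ^ d | K. K \<ge> 1}\<close>.\<close>

lemma superhomogeneous_limit:
  fixes F :: "nat \<Rightarrow> real"
  assumes nonneg: "\<And>K. F K \<ge> 0" and mono: "\<And>K K'. K \<le> K' \<Longrightarrow> F K \<le> F K'"
    and super: "\<And>k K. k \<ge> 1 \<Longrightarrow> F (k * K) \<ge> real k ^ d * F K"
    and bound: "\<And>K. K \<ge> 1 \<Longrightarrow> F K \<le> C * real K ^ d"
  shows "convergent (\<lambda>K. F K / real K ^ d)"
proof -
  define a where "a = (\<lambda>K. F K / real K ^ d)"
  define L where "L = Sup (a ` {1..})"
  have bdd: "bdd_above (a ` {1..})"
    using bound by (intro bdd_aboveI2[where M=C]) (simp add: a_def divide_le_eq)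
  have le: "a K \<le> L" if "K \<ge> 1" for K
    unfolding L_def using bdd that by (intro cSUP_upper) auto
  have "a \<longlonglongrightarrow> L"
  proof (rule order_tendstoI)
    fix x assume "x > L"
    then show "\<forall>\<^sub>F K in sequentially. a K < x"
      using le by (intro eventually_sequentiallyI[of 1]) (meson le_less_trans)
  next
    fix x assume "x < L"
    then have "\<exists>K\<in>{1..}. x < a K"
      using less_cSUP_iff[OF _ bdd, of x] unfolding L_def by auto
    then obtain K0 where K0: "K0 \<ge> 1" "x < a K0" by auto
    have "(\<lambda>m. (1 - real K0 / real m) ^ d * a K0) \<longlonglongrightarrow> (1 - 0) ^ d * a K0"
      by (intro tendsto_intros real_tendsto_divide_at_top[OF tendsto_const] filterlim_real_sequentially)
    then have "(\<lambda>m. (1 - real K0 / real m) ^ d * a K0) \<longlonglongrightarrow> a K0" by simp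
    then have "\<forall>\<^sub>F m in sequentially. x < (1 - real K0 / real m) ^ d * a K0"
      using K0(2) by (rule order_tendstoD)
    moreover have "\<forall>\<^sub>F m in sequentially. (1 - real K0 / real m) ^ d * a K0 \<le> a m"
    proof (rule eventually_sequentiallyI[of K0])
      fix m assume m: "K0 \<le> m"
      \<comment> \<open>\<open>k * K0\<close> is the largest multiple of \<open>K0\<close> up to
        \<open>m\<close>, and replacing \<open>m\<close> by it loses at most the fraction
        \<open>K0 / m\<close>.\<close>
      define k where "k = m div K0"
      have m': "k * K0 \<le> m" "m < k * K0 + K0"
        using K0(1) dividend_less_div_times[of K0 m] by (auto simp: k_def)
      have mpos: "real m > 0" using m K0 by simp
      have "real m - real K0 \<le> real k * real K0"
        using m'(2) by (metis less_eq_real_def diff_le_eq of_nat_add of_nat_less_iff of_nat_mult)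
      then have "(real m - real K0) / real m \<le> real k * real K0 / real m"
        using mpos by (intro divide_right_mono) auto
      then have "1 - real K0 / real m \<le> real k * real K0 / real m"
        using mpos by (simp add: diff_divide_distrib)
      moreover have "0 \<le> 1 - real K0 / real m" using m mpos by simp
      ultimately have "(1 - real K0 / real m) ^ d * a K0 \<le> (real k * real K0 / real m) ^ d * a K0"
        using nonneg[of K0] by (intro mult_right_mono power_mono) (auto simp: a_def)
      also have "\<dots> = real k ^ d * F K0 / real m ^ d"
        using K0(1) by (simp add: a_def power_mult_distrib power_divide)
      also have "\<dots> \<le> F (k * K0) / real m ^ d"
        using super[of k K0] m K0(1) by (intro divide_right_mono) (auto simp: k_def div_greater_zero_iff Suc_le_eq)
      also have "\<dots> \<le> a m" unfolding a_def using mono[OF m'(1)] by (intro divide_right_mono) auto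
      finally show "(1 - real K0 / real m) ^ d * a K0 \<le> a m" .
    qed
    ultimately show "\<forall>\<^sub>F m in sequentially. x < a m" by eventually_elim linarith
  qed
  then show ?thesis unfolding a_def convergent_def by blast
qed

section \<open>Integer paths with bounded steps\<close>

context walk_pairing
begin

definition closed_paths :: "int set \<Rightarrow> (nat \<Rightarrow> int) set" where
  "closed_paths S = {y \<in> {..n} \<rightarrow>\<^sub>E S. y 0 = 0 \<and> (\<forall>t<n. y t = y (Suc (\<pi> t)))}"

text \<open>The strict bound suits blow-ups: steps up to \<open>K - 1\<close>, multiplied by
  \<open>k\<close> and perturbed by a path with values in \<open>{0..<k}\<close>, are at most
  \<open>k * (K - 1) + (k - 1) < k * K\<close>. A band of parameter \<open>b\<close> corresponds to
  \<open>K = Suc b\<close>.\<close>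

definition short_paths :: "nat \<Rightarrow> (nat \<Rightarrow> int) set" where
  "short_paths K = {y \<in> closed_paths UNIV. \<forall>t<n. \<bar>y (Suc t) - y t\<bar> < int K}"

lemma closed_pathsD:
  assumes "y \<in> closed_paths S"
  shows "y 0 = 0" "t < n \<Longrightarrow> y (Suc (\<pi> t)) = y t" "t \<le> n \<Longrightarrow> y t \<in> S" "\<not> t \<le> n \<Longrightarrow> y t = undefined"
  using assms by (auto simp: closed_paths_def PiE_def extensional_def)

text \<open>The relations only identify times with each other. So a path is a free choice of one
  value for each class of times except that of 0, and \<open>d\<close> is the number of these
  classes.\<close>

lemma card_closed_paths:
  "\<exists>d. \<forall>S. finite S \<longrightarrow> 0 \<in> S \<longrightarrow> card (closed_paths S) = card S ^ d"
proof -
  define R where "R = {(t, Suc (\<pi> t)) | t. t < n} \<union> {(Suc (\<pi> t), t) | t. t < n}"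
  \<comment> \<open>With least elements as representatives, the class of \<open>0\<close> is
    represented by \<open>0\<close> itself.\<close>
  define rep where "rep = (\<lambda>t. LEAST s. (t, s) \<in> R\<^sup>*)"
  have sym: "(s, t) \<in> R\<^sup>*" if "(t, s) \<in> R\<^sup>*" for s t
  proof -
    have "sym R" by (auto simp: R_def sym_def)
    then show ?thesis using that by (meson symD sym_rtrancl)
  qed
  have rep: "(t, rep t) \<in> R\<^sup>*" for t
    unfolding rep_def by (rule LeastI[of "\<lambda>s. (t, s) \<in> R\<^sup>*" t]) simp
  have rep_eq: "rep s = rep t" if "(s, t) \<in> R\<^sup>*" for s t
  proof -
    have "(s, u) \<in> R\<^sup>* \<longleftrightarrow> (t, u) \<in> R\<^sup>*" for u
      using that sym[OF that] by (meson rtrancl_trans)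
    then show ?thesis by (simp add: rep_def)
  qed
  have rep_rep: "rep (rep t) = rep t" for t using rep_eq[OF rep] by simp
  have rep_le: "rep t \<le> t" for t unfolding rep_def by (rule Least_le) simp
  have rep0: "rep 0 = 0" using rep_le[of 0] by simp
  have inv: "y t = y s" if "y \<in> closed_paths S" "(t, s) \<in> R\<^sup>*" for y t s S
    using that(2)
  proof (induction rule: rtrancl_induct)
    case (step u w)
    then show ?case using closed_pathsD(2)[OF that(1)] by (auto simp: R_def)
  qed simp
  define B where "B = rep ` {..n} - {0}"
  have B: "finite B" "\<And>u. u \<in> B \<Longrightarrow> u \<le> n \<and> rep u = u \<and> u \<noteq> 0"
    using rep_rep by (auto simp: B_def intro: order_trans[OF rep_le])
  have "card (closed_paths S) = card S ^ card B" if S: "finite S" "0 \<in> S" for S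
  proof -
    define G where "G = (\<lambda>g::nat \<Rightarrow> int. \<lambda>t\<in>{..n}. if rep t = 0 then 0 else g (rep t))"
    have "bij_betw (\<lambda>y. restrict y B) (closed_paths S) (B \<rightarrow>\<^sub>E S)"
    proof (rule bij_betw_byWitness[where f'=G])
      show "\<forall>y\<in>closed_paths S. G (restrict y B) = y"
      proof (intro ballI ext)
        fix y t assume y: "y \<in> closed_paths S"
        have "y t = y (rep t)" using inv[OF y rep] .
        then show "G (restrict y B) t = y t"
          using closed_pathsD(1,4)[OF y] rep_le by (auto simp: G_def B_def)
      qed
      show "\<forall>g\<in>B \<rightarrow>\<^sub>E S. restrict (G g) B = g"
      proof (intro ballI ext)
        fix g t assume "g \<in> B \<rightarrow>\<^sub>E S"
        then show "restrict (G g) B t = g t"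
          using B(2)[of t] by (cases "t \<in> B") (auto simp: G_def PiE_def extensional_def)
      qed
      show "(\<lambda>y. restrict y B) ` closed_paths S \<subseteq> B \<rightarrow>\<^sub>E S"
        using B(2) closed_pathsD(3) by auto
      show "G ` (B \<rightarrow>\<^sub>E S) \<subseteq> closed_paths S"
      proof safe
        fix g assume g: "g \<in> B \<rightarrow>\<^sub>E S"
        have "G g \<in> {..n} \<rightarrow>\<^sub>E S" 
        proof -
          have "g (rep t) \<in> S" if "t \<le> n" "rep t \<noteq> 0" for t
            by (rule PiE_mem[OF g]) (use that in \<open>simp add: B_def\<close>)
          then show ?thesis using S(2) by (auto simp: G_def)
        qed
        moreover have "G g 0 = 0" using rep0 by (simp add: G_def)
        moreover have "G g t = G g (Suc (\<pi> t))" if "t < n" for t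
        proof -
          have "(t, Suc (\<pi> t)) \<in> R\<^sup>*" using that by (auto simp: R_def)
          from rep_eq[OF this] show ?thesis using that pi(1)[OF that] by (simp add: G_def)
        qed
        ultimately show "G g \<in> closed_paths S" by (simp add: closed_paths_def)
      qed
    qed
    from bij_betw_same_card[OF this] show ?thesis using B(1) by (simp add: card_PiE)
  qed
  then show ?thesis by blast
qed

lemma finite_closed_paths: "finite S \<Longrightarrow> finite (closed_paths S)"
  by (rule finite_subset[of _ "{..n} \<rightarrow>\<^sub>E S"]) (auto simp: closed_paths_def intro!: finite_PiE)

lemma closed_paths_mono: "S \<subseteq> T \<Longrightarrow> closed_paths S \<subseteq> closed_paths T"
  by (auto simp: closed_paths_def)

lemma short_paths_subset: "short_paths K \<subseteq> closed_paths {- int (n * K)..int (n * K)}"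
proof
  fix y assume y: "y \<in> short_paths K"
  then have c: "y \<in> closed_paths UNIV" and s: "\<And>t. t < n \<Longrightarrow> \<bar>y (Suc t) - y t\<bar> < int K"
    by (auto simp: short_paths_def)
  have "\<bar>y t\<bar> \<le> int (t * K)" if "t \<le> n" for t
    using that
  proof (induction t)
    case 0
    then show ?case using closed_pathsD(1)[OF c] by simp
  next
    case (Suc t)
    then show ?case using s[of t] by (simp add: distrib_right)
  qed
  moreover have "int (t * K) \<le> int (n * K)" if "t \<le> n" for t using that by (simp add: mult_right_mono)
  ultimately have "\<bar>y t\<bar> \<le> int (n * K)" if "t \<le> n" for t
    using that order_trans by blast
  then have "y t \<in> {- int (n * K)..int (n * K)}" if "t \<le> n" for t
    using that abs_le_iff by fastforce
  then show "y \<in> closed_paths {- int (n * K)..int (n * K)}"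
    using c by (auto simp: closed_paths_def PiE_def)
qed

lemma finite_short_paths: "finite (short_paths K)"
  by (rule finite_subset[OF short_paths_subset finite_closed_paths]) simp

lemma closed_paths_short: "closed_paths {0..<int K} \<subseteq> short_paths K"
proof
  fix y assume y: "y \<in> closed_paths {0..<int K}"
  have "\<bar>y (Suc t) - y t\<bar> < int K" if "t < n" for t
    using closed_pathsD(3)[OF y, of t] closed_pathsD(3)[OF y, of "Suc t"] that by auto
  then show "y \<in> short_paths K"
    using closed_paths_mono[of "{0..<int K}" UNIV] y by (auto simp: short_paths_def)
qed

text \<open>Blowing up a path by the factor \<open>k\<close> and adding one with values in \<open>{0..<k}\<close> is injective, by division with
  remainder. This replaces the approximation of lattice point counts by volumes.\<close>

lemma short_paths_scale:
  "card (closed_paths {0..<int k}) * card (short_paths K) \<le> card (short_paths (k * K))"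
proof (cases "k = 0")
  case True
  then have "closed_paths {0..<int k} = {}" by (auto simp: closed_paths_def)
  then show ?thesis by simp
next
  case False
  define \<Phi> where "\<Phi> = (\<lambda>(r, y). \<lambda>t\<in>{..n}. int k * y t + r t :: int)"
  have "card (closed_paths {0..<int k} \<times> short_paths K) \<le> card (short_paths (k * K))"
  proof (rule card_inj_on_le[of \<Phi>])
    show "inj_on \<Phi> (closed_paths {0..<int k} \<times> short_paths K)"
    proof (rule inj_onI, clarify)
      fix r y r' y' assume a: "r \<in> closed_paths {0..<int k}" "y \<in> short_paths K"
        "r' \<in> closed_paths {0..<int k}" "y' \<in> short_paths K" and e: "\<Phi> (r, y) = \<Phi> (r', y')"
      have y: "y \<in> closed_paths UNIV" "y' \<in> closed_paths UNIV" using a by (auto simp: short_paths_def)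
      have "r t = r' t \<and> y t = y' t" for t
      proof (cases "t \<le> n")
        case True
        have eq: "int k * y t + r t = int k * y' t + r' t"
          using fun_cong[OF e, of t] True by (simp add: \<Phi>_def)
        have "0 \<le> r t" "r t < int k" "0 \<le> r' t" "r' t < int k"
          using closed_pathsD(3)[OF a(1) True] closed_pathsD(3)[OF a(3) True] by auto
        moreover from this have "r t = r' t"
          using arg_cong[OF eq, of "\<lambda>x. x mod int k"] by simp
        ultimately show ?thesis using eq False by simp
      next
        case False
        then show ?thesis
          using closed_pathsD(4)[OF a(1)] closed_pathsD(4)[OF a(3)] closed_pathsD(4)[OF y(1)] closed_pathsD(4)[OF y(2)]
          by simp
      qed
      then show "r = r' \<and> y = y'" by auto
    qed
    show "\<Phi> ` (closed_paths {0..<int k} \<times> short_paths K) \<subseteq> short_paths (k * K)"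
    proof clarify
      fix r y assume r: "r \<in> closed_paths {0..<int k}" and y: "y \<in> short_paths K"
      have yc: "y \<in> closed_paths UNIV" using y by (simp add: short_paths_def)
      have "\<Phi> (r, y) \<in> closed_paths UNIV"
        using closed_pathsD(1,2)[OF r] closed_pathsD(1,2)[OF yc] pi(1)
        by (auto simp: \<Phi>_def closed_paths_def Suc_le_eq)
      moreover have "\<bar>\<Phi> (r, y) (Suc t) - \<Phi> (r, y) t\<bar> < int (k * K)" if t: "t < n" for t
      proof -
        have "0 \<le> r t" "r t < int k" "0 \<le> r (Suc t)" "r (Suc t) < int k"
          using closed_pathsD(3)[OF r, of t] closed_pathsD(3)[OF r, of "Suc t"] t by auto
        then have 1: "\<bar>r (Suc t) - r t\<bar> \<le> int k - 1" by linarith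
        have "\<bar>y (Suc t) - y t\<bar> \<le> int K - 1" using y t by (simp add: short_paths_def)
        then have "int k * \<bar>y (Suc t) - y t\<bar> \<le> int k * (int K - 1)" by (intro mult_left_mono) auto
        also have "\<dots> = int k * int K - int k" by (simp add: algebra_simps)
        finally have 2: "\<bar>int k * (y (Suc t) - y t)\<bar> \<le> int k * int K - int k" by (simp only: abs_mult abs_of_nat)
        have "\<Phi> (r, y) (Suc t) - \<Phi> (r, y) t = int k * (y (Suc t) - y t) + (r (Suc t) - r t)"
          using t by (simp add: \<Phi>_def algebra_simps)
        then show ?thesis using 1 2 by simp
      qed
      ultimately show "\<Phi> (r, y) \<in> short_paths (k * K)" by (simp add: short_paths_def)
    qed
  qed (rule finite_short_paths)
  then show ?thesis by (simp add: card_cartesian_product)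
qed

text \<open>\<open>d\<close> is the number of free classes of times. It is not compared with
  \<open>n div 2 - 2\<close> here; the explicit lower bound is what makes that comparison possible
  in \<open>short_paths_crossing_limit\<close>.\<close>

lemma short_paths_asymptotics:
  "\<exists>d. convergent (\<lambda>K. real (card (short_paths K)) / real K ^ d) \<and> (\<forall>K\<ge>1. K ^ d \<le> card (short_paths K))"
proof -
  obtain d where d: "\<And>S. finite S \<Longrightarrow> 0 \<in> S \<Longrightarrow> card (closed_paths S) = card S ^ d"
    using card_closed_paths by blast
  have "convergent (\<lambda>K. real (card (short_paths K)) / real K ^ d)"
  proof (rule superhomogeneous_limit)
    show "real (card (short_paths K)) \<le> real (card (short_paths K'))" if "K \<le> K'" for K K'
      using that by (intro of_nat_mono card_mono finite_short_paths) (fastforce simp: short_paths_def)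
    show "real k ^ d * real (card (short_paths K)) \<le> real (card (short_paths (k * K)))" if "k \<ge> 1" for k K
    proof -
      have "card (closed_paths {0..<int k}) = k ^ d" using d[of "{0..<int k}"] that by simp
      then have "k ^ d * card (short_paths K) \<le> card (short_paths (k * K))" using short_paths_scale[of k K] by simp
      then show ?thesis by (metis of_nat_le_iff of_nat_mult of_nat_power)
    qed
    fix K :: nat assume K: "K \<ge> 1"
    have "card (short_paths K) \<le> card (closed_paths {- int (n * K)..int (n * K)})"
      by (intro card_mono short_paths_subset finite_closed_paths) simp
    also have "\<dots> = (2 * (n * K) + 1) ^ d" 
    proof -
      have e: "card {- int a..int a} = 2 * a + 1" for a :: nat unfolding card_atLeastAtMost_int by linarith
      show ?thesis unfolding e[symmetric] by (rule d) auto
    qed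
    also have "\<dots> \<le> ((2 * n + 1) * K) ^ d" using K by (intro power_mono) (auto simp: algebra_simps)
    finally show "real (card (short_paths K)) \<le> real (2 * n + 1) ^ d * real K ^ d"
      by (metis of_nat_le_iff of_nat_mult of_nat_power power_mult_distrib)
  qed auto
  moreover have "K ^ d \<le> card (short_paths K)" if "K \<ge> 1" for K
    using d[of "{0..<int K}"] that card_mono[OF finite_short_paths closed_paths_short, of K] by simp
  ultimately show ?thesis by blast
qed

lemma position_bound:
  assumes "\<And>t. t \<in> openers n \<pi> \<Longrightarrow> \<bar>f t\<bar> \<le> int b" "u \<le> n" "w \<le> n"
  shows "\<bar>position \<pi> f u - position \<pi> f w\<bar> \<le> int (n * b)"
proof -
  have st: "\<bar>signed_step \<pi> f t\<bar> \<le> int b" if "t < n" for t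
    using assms(1)[of t] assms(1)[of "\<pi> t"] opener_or_image[OF that] pi[of t] that
    by (auto simp: signed_step_def openers_def)
  have le: "\<bar>position \<pi> f u - position \<pi> f w\<bar> \<le> int (n * b)" if "w \<le> u" "u \<le> n" for u w
  proof -
    have "\<bar>position \<pi> f u - position \<pi> f w\<bar> \<le> (\<Sum>r\<in>{w..<u}. \<bar>signed_step \<pi> f r\<bar>)"
      unfolding position_diff[OF that(1)] by (rule sum_abs)
    also have "\<dots> \<le> of_nat (card {w..<u}) * int b"
      using st that by (intro sum_bounded_above) auto
    also have "\<dots> \<le> int (n * b)" using that by (simp add: mult_right_mono)
    finally show ?thesis .
  qed
  show ?thesis using le[of w u] le[of u w] assms by (cases "w \<le> u") (auto simp: abs_minus_commute)
qed

text \<open>Within \<open>n\<close> steps the displacement varies by at most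
  \<open>n * b < N\<close>, so a difference divisible by \<open>N\<close> is zero and congruences
  become equations.\<close>

lemma card_solutions_eq_short_paths:
  assumes "n * b < N" "2 * b + 1 \<le> N"
  shows "card (step_solutions N b n \<pi>) = card (short_paths (Suc b))"
proof -
  define D where "D = (\<lambda>y. \<lambda>t\<in>openers n \<pi>. y (Suc t) - y t :: int)"
  define P where "P = (\<lambda>f. restrict (position \<pi> f) {..n})"
  have S: "steps N b = {- int b..int b}" using assms by (simp add: steps_def)
  have posD: "position \<pi> (D y) t = y t" if "y \<in> short_paths (Suc b)" "t \<le> n" for y t
    using that(2)
  proof (induction t)
    case 0
    then show ?case using that(1) by (simp add: short_paths_def closed_paths_def)
  next
    case (Suc t)
    have c: "y \<in> closed_paths UNIV" using that(1) by (simp add: short_paths_def)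
    have "signed_step \<pi> (D y) t = y (Suc t) - y t"
    proof (cases "t < \<pi> t")
      case True
      then show ?thesis using Suc by (simp add: signed_step_def D_def openers_def)
    next
      case False
      then have o: "\<pi> t \<in> openers n \<pi>" "\<pi> t < n" using Suc.prems pi[of t] by (auto simp: openers_def)
      have "y (Suc (\<pi> t)) = y t" "y (\<pi> t) = y (Suc t)"
        using closed_pathsD(2)[OF c, of t] closed_pathsD(2)[OF c, of "\<pi> t"] Suc.prems o pi(3) by auto
      then show ?thesis using False o by (simp add: signed_step_def D_def)
    qed
    then show ?case using Suc by (simp add: position_Suc)
  qed
  have fb: "\<bar>f t\<bar> \<le> int b" if "f \<in> step_solutions N b n \<pi>" "t \<in> openers n \<pi>" for f t
  proof -
    have "f t \<in> steps N b" using that by (auto simp: step_solutions_def)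
    then show ?thesis unfolding S by auto
  qed
  have "bij_betw P (step_solutions N b n \<pi>) (short_paths (Suc b))"
  proof (rule bij_betw_byWitness[where f'=D])
    show "\<forall>f\<in>step_solutions N b n \<pi>. D (P f) = f"
    proof (intro ballI ext)
      fix f t assume f: "f \<in> step_solutions N b n \<pi>"
      have "f \<in> openers n \<pi> \<rightarrow>\<^sub>E steps N b" using f by (simp add: step_solutions_def)
      then show "D (P f) t = f t"
        by (cases "t \<in> openers n \<pi>")
           (auto simp: D_def P_def PiE_def extensional_def openers_def position_Suc signed_step_def)
    qed
    show "\<forall>y\<in>short_paths (Suc b). P (D y) = y"
    proof (intro ballI ext)
      fix y t assume y: "y \<in> short_paths (Suc b)"
      then have "y \<in> closed_paths UNIV" by (simp add: short_paths_def)
      then show "P (D y) t = y t"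
        using posD[OF y, of t] closed_pathsD(4)[of y UNIV t] by (cases "t \<le> n") (auto simp: P_def)
    qed
    show "P ` step_solutions N b n \<pi> \<subseteq> short_paths (Suc b)"
    proof safe
      fix f assume f: "f \<in> step_solutions N b n \<pi>"
      have "position \<pi> f t = position \<pi> f (Suc (\<pi> t))" if "t < n" for t
      proof -
        have "\<bar>position \<pi> f (Suc (\<pi> t)) - position \<pi> f t\<bar> \<le> int (n * b)"
          using that pi(1)[OF that] fb[OF f] by (intro position_bound) auto
        then have "\<bar>position \<pi> f (Suc (\<pi> t)) - position \<pi> f t\<bar> < int N"
          using assms(1) by linarith
        moreover have "int N dvd position \<pi> f (Suc (\<pi> t)) - position \<pi> f t"
          using f that by (simp add: step_solutions_def)
        ultimately have "position \<pi> f (Suc (\<pi> t)) - position \<pi> f t = 0"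
          by (rule int_dvd_small)
        then show ?thesis by simp
      qed
      moreover have "\<bar>position \<pi> f (Suc t) - position \<pi> f t\<bar> < int (Suc b)" if "t < n" for t
        using fb[OF f, of t] fb[OF f, of "\<pi> t"] opener_or_image[OF that] pi[of t] that
        by (auto simp: position_Suc signed_step_def openers_def)
      ultimately show "P f \<in> short_paths (Suc b)"
        using pi(1) by (auto simp: short_paths_def closed_paths_def P_def Suc_le_eq)
    qed
    show "D ` short_paths (Suc b) \<subseteq> step_solutions N b n \<pi>"
    proof safe
      fix y assume y: "y \<in> short_paths (Suc b)"
      then have c: "y \<in> closed_paths UNIV" by (simp add: short_paths_def)
      have "D y \<in> openers n \<pi> \<rightarrow>\<^sub>E steps N b"
      proof
        fix t assume t: "t \<in> openers n \<pi>"
        then have "\<bar>y (Suc t) - y t\<bar> < int (Suc b)" using y by (simp add: short_paths_def openers_def)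
        then show "D y t \<in> steps N b" unfolding S using t by (auto simp: D_def)
      qed (simp add: D_def)
      moreover have "position \<pi> (D y) (Suc (\<pi> t)) - position \<pi> (D y) t = 0" if "t < n" for t
        using posD[OF y, of t] posD[OF y, of "Suc (\<pi> t)"] closed_pathsD(2)[OF c that] pi(1)[OF that] that
        by simp
      ultimately show "D y \<in> step_solutions N b n \<pi>" by (simp add: step_solutions_def)
    qed
  qed
  then show ?thesis by (rule bij_betw_same_card)
qed

text \<open>The growth exponent \<open>d\<close> may be smaller than that of the normalization, and
  then the limit is 0. What has to be excluded is a larger \<open>d\<close>, and the bound for
  crossing pairings does so.\<close>

lemma short_paths_crossing_limit:
  assumes "crossing n \<pi>"
  shows "convergent (\<lambda>b. real (card (short_paths (Suc b))) / real (2 * b + 1) ^ (n div 2 - 2))"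
proof -
  define e where "e = n div 2 - 2"
  obtain d where conv: "convergent (\<lambda>K. real (card (short_paths K)) / real K ^ d)"
    and lower: "\<And>K. K \<ge> 1 \<Longrightarrow> K ^ d \<le> card (short_paths K)"
    using short_paths_asymptotics by blast
  have upper: "card (short_paths (Suc b)) \<le> (2 * b + 1) ^ e" for b
  proof -
    \<comment> \<open>Any size without wrapping around will do; it transfers the crossing bound from
      the cycle to integer paths.\<close>
    define N where "N = n * b + 2 * b + 1"
    have "card (short_paths (Suc b)) = card (step_solutions N b n \<pi>)"
      by (rule card_solutions_eq_short_paths[symmetric]) (auto simp: N_def)
    also have "\<dots> \<le> band_width N b ^ e" unfolding e_def by (rule card_solutions_crossing[OF assms])
    also have "band_width N b = 2 * b + 1" by (simp add: band_width_def N_def)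
    finally show ?thesis .
  qed
  have "d \<le> e"
  proof (rule ccontr)
    assume "\<not> d \<le> e"
    then have de: "Suc e \<le> d" by simp
    \<comment> \<open>With this choice \<open>(2 * Suc b) ^ e\<close> is
      \<open>b * Suc b ^ e\<close>, which is less than \<open>Suc b ^ Suc e\<close>.\<close>
    define b where "b = (2::nat) ^ e"
    have "Suc b ^ Suc e \<le> Suc b ^ d" using de by (intro power_increasing) auto
    also have "\<dots> \<le> (2 * b + 1) ^ e" using lower[of "Suc b"] upper[of b] by simp
    also have "\<dots> \<le> (2 * Suc b) ^ e" by (intro power_mono) auto
    also have "\<dots> = b * Suc b ^ e" unfolding power_mult_distrib b_def ..
    finally show False by simp
  qed
  obtain L where L: "(\<lambda>K. real (card (short_paths K)) / real K ^ d) \<longlonglongrightarrow> L"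
    using conv by (auto simp: convergent_def)
  have L': "(\<lambda>b. real (card (short_paths (Suc b))) / real (Suc b) ^ d) \<longlonglongrightarrow> L"
    using L by (rule LIMSEQ_Suc)
  have r: "(\<lambda>b. real (Suc b) / real (2 * b + 1)) \<longlonglongrightarrow> 1 / 2" by real_asymp
  have z: "(\<lambda>b. 1 / real (2 * b + 1)) \<longlonglongrightarrow> 0" by real_asymp
  have "(\<lambda>b. real (card (short_paths (Suc b))) / real (Suc b) ^ d *
      ((real (Suc b) / real (2 * b + 1)) ^ d * (1 / real (2 * b + 1)) ^ (e - d))) \<longlonglongrightarrow> L * ((1 / 2) ^ d * 0 ^ (e - d))"
    by (intro tendsto_mult tendsto_power L' r z)
  moreover have "real (card (short_paths (Suc b))) / real (Suc b) ^ d *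
      ((real (Suc b) / real (2 * b + 1)) ^ d * (1 / real (2 * b + 1)) ^ (e - d)) =
      real (card (short_paths (Suc b))) / real (2 * b + 1) ^ e" for b
  proof -
    have "real (2 * b + 1) ^ e = real (2 * b + 1) ^ d * real (2 * b + 1) ^ (e - d)"
      using \<open>d \<le> e\<close> by (simp flip: power_add)
    moreover have "real (Suc b) ^ d \<noteq> 0" by simp
    ultimately show ?thesis by (simp only: power_divide power_one) (simp add: field_simps)
  qed
  ultimately show ?thesis unfolding e_def convergent_def by auto
qed

end

text \<open>The denominator is the number of solutions for a noncrossing pairing, so this is
  \<open>N\<close> times the weight of \<open>\<pi>\<close> relative to a noncrossing one.\<close>

definition crossing_weight :: "nat \<Rightarrow> nat \<Rightarrow> nat \<Rightarrow> (nat \<Rightarrow> nat) \<Rightarrow> real" where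
  "crossing_weight N b n \<pi> = real N * real (card (step_solutions N b n \<pi>)) / real (band_width N b) ^ (n div 2)"

lemma crossing_weight_convergent:
  assumes \<pi>: "\<pi> \<in> pairings {..<n}" "crossing n \<pi>"
    and b: "filterlim b at_top sequentially"
    and rate: "filterlim (\<lambda>N. real (b N) / sqrt (real N)) at_top sequentially \<or>
         (\<exists>c>0. (\<lambda>N. real (b N) / sqrt (real N)) \<longlonglongrightarrow> c)"
  shows "convergent (\<lambda>N. crossing_weight N (b N) n \<pi>)"
proof -
  interpret walk_pairing n \<pi> by standard (rule \<pi>)
  define e where "e = n div 2 - 2"
  have n2: "n div 2 = 2 + e" using card_solutions_crossing(2)[OF \<pi>(2)] by (simp add: e_def)
  have split: "crossing_weight N (b N) n \<pi> = real N / real (band_width N (b N)) ^ 2 *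
      (real (card (step_solutions N (b N) n \<pi>)) / real (band_width N (b N)) ^ e)" for N
    unfolding crossing_weight_def n2 power_add by simp
  from rate show ?thesis
  proof
    assume inf: "filterlim (\<lambda>N. real (b N) / sqrt (real N)) at_top sequentially"
    have "(\<lambda>N. crossing_weight N (b N) n \<pi>) \<longlonglongrightarrow> 0"
    proof (rule Lim_null_comparison)
      \<comment> \<open>One summand for each case of the band width: N / \<xi>^2 equals 1 / N for a
        full band and is at most N / b^2 otherwise.\<close>
      show "(\<lambda>N. inverse (real N) + inverse (real (b N) / sqrt (real N)) ^ 2) \<longlonglongrightarrow> 0"
        using tendsto_add[OF lim_inverse_n tendsto_power[OF tendsto_inverse_0_at_top[OF inf], of 2]] by simp
      show "\<forall>\<^sub>F N in sequentially. norm (crossing_weight N (b N) n \<pi>) \<le>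
          inverse (real N) + inverse (real (b N) / sqrt (real N)) ^ 2"
        using eventually_gt_at_top[of 0] filterlim_at_top_dense[THEN iffD1, OF inf, rule_format, of 0]
      proof eventually_elim
        case (elim N)
        have bp: "real (b N) > 0" using elim(2) by (auto simp: zero_less_divide_iff)
        define x where "x = real (band_width N (b N))"
        have x: "x > 0" using band_width_pos[OF elim(1)] by (simp add: x_def)
        have "real (card (step_solutions N (b N) n \<pi>)) \<le> x ^ e"
          using card_solutions_crossing(1)[OF \<pi>(2), of N "b N"] unfolding x_def e_def
          by (metis of_nat_le_iff of_nat_power)
        then have "real (card (step_solutions N (b N) n \<pi>)) / x ^ e \<le> 1" using x by simp
        then have "real N / x ^ 2 * (real (card (step_solutions N (b N) n \<pi>)) / x ^ e) \<le> real N / x ^ 2 * 1"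
          by (intro mult_left_mono) auto
        then have 1: "norm (crossing_weight N (b N) n \<pi>) \<le> real N / x ^ 2"
          using x unfolding split x_def[symmetric] by (simp add: abs_of_nonneg)
        have "real N / x ^ 2 \<le> inverse (real N) + inverse (real (b N) / sqrt (real N)) ^ 2"
        proof (cases "2 * b N + 1 \<le> N")
          case False
          then have "x = real N" by (simp add: x_def band_width_def)
          then show ?thesis using elim(1) by (simp add: power2_eq_square field_simps)
        next
          case True
          then have "x = real (2 * b N + 1)" by (simp add: x_def band_width_def)
          then have "real (b N) ^ 2 \<le> x ^ 2" by (intro power_mono) auto
          then have "real N / x ^ 2 \<le> real N / real (b N) ^ 2" using bp x by (intro divide_left_mono) auto
          also have "\<dots> = inverse (real (b N) / sqrt (real N)) ^ 2" using elim(1) by (simp add: power_divide)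
          finally show ?thesis using elim(1) by (simp add: add_increasing)
        qed
        with 1 show ?case by linarith
      qed
    qed
    then show ?thesis by (rule convergentI)
  next
    assume "\<exists>c>0. (\<lambda>N. real (b N) / sqrt (real N)) \<longlonglongrightarrow> c"
    then obtain c where c: "c > 0" "(\<lambda>N. real (b N) / sqrt (real N)) \<longlonglongrightarrow> c" by blast
    have is0: "(\<lambda>N. 1 / sqrt (real N)) \<longlonglongrightarrow> 0" by real_asymp
    have "(\<lambda>N. real (b N) / sqrt (real N) * (1 / sqrt (real N))) \<longlonglongrightarrow> c * 0"
      by (intro tendsto_mult c is0)
    then have bN: "(\<lambda>N. real (b N) / sqrt (real N) * (1 / sqrt (real N))) \<longlonglongrightarrow> 0" by simp
    \<comment> \<open>The band is eventually shorter than any fixed fraction of \<open>N\<close>.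
      This excludes the full band as well as wrapping around.\<close>
    have small: "\<forall>\<^sub>F N in sequentially. m * b N < N" for m
    proof -
      have "\<forall>\<^sub>F N in sequentially. real (b N) / sqrt (real N) * (1 / sqrt (real N)) < 1 / (real m + 1)"
        using bN by (rule order_tendstoD) simp
      then show ?thesis using eventually_gt_at_top[of 0]
      proof eventually_elim
        case (elim N)
        then have "real (b N) / real N < 1 / (real m + 1)" by simp
        then have "real (b N) * (real m + 1) < real N" using elim(2) by (simp add: field_simps)
        then have "real (m * b N) < real N" by (simp add: algebra_simps)
        then show ?case by linarith
      qed
    qed
    have ev: "\<forall>\<^sub>F N in sequentially. 2 * b N + 1 \<le> N \<and> n * b N < N"
      using small[of 2] small[of n] by eventually_elim auto
    \<comment> \<open>(2 b + 1) / sqrt N tends to 2 c, so that N / \<xi>^2 tends to 1 / (4 c^2);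
      here \<open>c > 0\<close> is essential.\<close>
    have "(\<lambda>N. 2 * (real (b N) / sqrt (real N)) + 1 / sqrt (real N)) \<longlonglongrightarrow> 2 * c + 0"
      by (intro tendsto_add tendsto_mult tendsto_const c is0)
    then have "(\<lambda>N. inverse ((2 * (real (b N) / sqrt (real N)) + 1 / sqrt (real N)) ^ 2)) \<longlonglongrightarrow> inverse ((2 * c + 0) ^ 2)"
      using c(1) by (intro tendsto_inverse tendsto_power) auto
    then have A: "convergent (\<lambda>N. inverse ((2 * (real (b N) / sqrt (real N)) + 1 / sqrt (real N)) ^ 2))"
      by (rule convergentI)
    obtain L where "(\<lambda>b. real (card (short_paths (Suc b))) / real (2 * b + 1) ^ e) \<longlonglongrightarrow> L"
      using short_paths_crossing_limit[OF \<pi>(2)] unfolding e_def convergent_def by blast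
    then have "(\<lambda>N. real (card (short_paths (Suc (b N)))) / real (2 * b N + 1) ^ e) \<longlonglongrightarrow> L"
      using b by (rule filterlim_compose)
    then have B: "convergent (\<lambda>N. real (card (short_paths (Suc (b N)))) / real (2 * b N + 1) ^ e)"
      by (rule convergentI)
    have "\<forall>\<^sub>F N in sequentially. inverse ((2 * (real (b N) / sqrt (real N)) + 1 / sqrt (real N)) ^ 2) *
        (real (card (short_paths (Suc (b N)))) / real (2 * b N + 1) ^ e) = crossing_weight N (b N) n \<pi>"
      using ev eventually_gt_at_top[of 0]
    proof eventually_elim
      case (elim N)
      have "2 * (real (b N) / sqrt (real N)) + 1 / sqrt (real N) = real (2 * b N + 1) / sqrt (real N)"
        by (simp add: add_divide_distrib)
      then have "inverse ((2 * (real (b N) / sqrt (real N)) + 1 / sqrt (real N)) ^ 2) = real N / real (2 * b N + 1) ^ 2"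
        by (simp add: power_divide)
      moreover have "band_width N (b N) = 2 * b N + 1" using elim by (simp add: band_width_def)
      moreover have "card (step_solutions N (b N) n \<pi>) = card (short_paths (Suc (b N)))"
        using elim by (intro card_solutions_eq_short_paths) auto
      ultimately show ?case unfolding split by simp
    qed
    then have "convergent (\<lambda>N. inverse ((2 * (real (b N) / sqrt (real N)) + 1 / sqrt (real N)) ^ 2) *
        (real (card (short_paths (Suc (b N)))) / real (2 * b N + 1) ^ e)) = convergent (\<lambda>N. crossing_weight N (b N) n \<pi>)"
      by (rule convergent_cong)
    then show ?thesis using convergent_mult[OF A B] by simp
  qed
qed

section \<open>Powers of the banded matrix\<close>

fun mpow :: "nat \<Rightarrow> (nat \<Rightarrow> nat \<Rightarrow> complex) \<Rightarrow> nat \<Rightarrow> nat \<Rightarrow> nat \<Rightarrow> complex" where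
  "mpow N A 0 j k = (if j = k then 1 else 0)"
| "mpow N A (Suc m) j k = (\<Sum>l<N. mpow N A m j l * A l k)"

lemma mpow_add:
  assumes "k < N"
  shows "mpow N A (m + m') j k = (\<Sum>l<N. mpow N A m j l * mpow N A m' l k)"
  using assms
proof (induction m' arbitrary: k)
  case 0
  then show ?case by (simp add: if_distrib[of "\<lambda>x. _ * x"] sum.delta cong: if_cong)
next
  case (Suc m')
  have "mpow N A (m + Suc m') j k = (\<Sum>l<N. (\<Sum>r<N. mpow N A m j r * mpow N A m' r l) * A l k)"
    using Suc by simp
  also have "\<dots> = (\<Sum>l<N. \<Sum>r<N. mpow N A m j r * mpow N A m' r l * A l k)"
    by (simp add: sum_distrib_right)
  also have "\<dots> = (\<Sum>r<N. \<Sum>l<N. mpow N A m j r * mpow N A m' r l * A l k)"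
    by (rule sum.swap)
  also have "\<dots> = (\<Sum>l<N. mpow N A m j l * mpow N A (Suc m') l k)"
    by (simp add: sum_distrib_left mult.assoc)
  finally show ?case .
qed

lemma mpow_hermitian:
  assumes "\<And>r s. r < N \<Longrightarrow> s < N \<Longrightarrow> A s r = cnj (A r s)" "j < N" "k < N"
  shows "mpow N A m k j = cnj (mpow N A m j k)"
  using assms(2,3)
proof (induction m arbitrary: k)
  case (Suc m)
  have one: "mpow N A 1 k l = A k l" if "l < N" for l
    using Suc.prems by (simp add: if_distrib[of "\<lambda>x. x * _"] sum.delta cong: if_cong)
  have "mpow N A (Suc m) k j = (\<Sum>l<N. mpow N A 1 k l * mpow N A m l j)"
    using mpow_add[OF Suc.prems(1), of A 1 m k] by simp
  also have "\<dots> = (\<Sum>l<N. A k l * mpow N A m l j)"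
    using one by (intro sum.cong) (auto simp del: mpow.simps)
  also have "\<dots> = (\<Sum>l<N. cnj (mpow N A m j l * A l k))"
  proof (rule sum.cong[OF refl])
    fix l assume "l \<in> {..<N}"
    then have l: "l < N" by simp
    show "A k l * mpow N A m l j = cnj (mpow N A m j l * A l k)"
      using Suc.IH[OF Suc.prems(1) l] assms(1)[OF l Suc.prems(2)] by simp
  qed
  finally show ?case by simp
qed simp

definition paths :: "nat \<Rightarrow> nat \<Rightarrow> nat \<Rightarrow> nat \<Rightarrow> (nat \<Rightarrow> nat) set" where
  "paths N m j k = {i \<in> {..m} \<rightarrow>\<^sub>E {..<N}. i 0 = j \<and> i m = k}"

lemma finite_paths: "finite (paths N m j k)"
  by (rule finite_subset[of _ "{..m} \<rightarrow>\<^sub>E {..<N}"]) (auto simp: paths_def intro!: finite_PiE)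

lemma paths_less: "i \<in> paths N m j k \<Longrightarrow> t \<le> m \<Longrightarrow> i t < N"
  by (auto simp: paths_def)

lemma mpow_paths:
  assumes "j < N" "k < N"
  shows "mpow N A m j k = (\<Sum>i\<in>paths N m j k. \<Prod>t<m. A (i t) (i (Suc t)))"
  using assms(2)
proof (induction m arbitrary: k)
  case 0
  have "paths N 0 j k = (if j = k then {\<lambda>t\<in>{..0}. j} else {})"
    using assms by (auto simp: paths_def PiE_def extensional_def fun_eq_iff)
  then show ?case by simp
next
  case (Suc m)
  define P where "P = {i \<in> {..m} \<rightarrow>\<^sub>E {..<N}. i 0 = j}"
  have fin: "finite P" by (rule finite_subset[of _ "{..m} \<rightarrow>\<^sub>E {..<N}"]) (auto simp: P_def intro!: finite_PiE)
  have im: "(\<lambda>i. i m) ` P \<subseteq> {..<N}" by (auto simp: P_def)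
  have sub: "paths N m j l = {i\<in>P. i m = l}" for l by (auto simp: paths_def P_def)
  have "mpow N A (Suc m) j k = (\<Sum>l<N. \<Sum>i\<in>{i\<in>P. i m = l}. (\<Prod>t<m. A (i t) (i (Suc t))) * A (i m) k)"
    using Suc.IH by (simp add: sub sum_distrib_right)
  also have "\<dots> = (\<Sum>i\<in>P. (\<Prod>t<m. A (i t) (i (Suc t))) * A (i m) k)"
    by (rule sum.group[OF fin _ im]) simp
  also have "\<dots> = (\<Sum>i\<in>paths N (Suc m) j k. \<Prod>t<Suc m. A (i t) (i (Suc t)))"
  proof (rule sum.reindex_bij_witness[where i="\<lambda>i. restrict i {..m}" and j="\<lambda>i. i(Suc m := k)"])
    fix i assume i: "i \<in> P"
    show "restrict (i(Suc m := k)) {..m} = i" using i by (auto simp: P_def PiE_def extensional_def fun_eq_iff)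
    show "i(Suc m := k) \<in> paths N (Suc m) j k"
      using i Suc.prems by (auto simp: P_def paths_def PiE_def Pi_def extensional_def)
    show "(\<Prod>t<Suc m. A ((i(Suc m := k)) t) ((i(Suc m := k)) (Suc t))) = (\<Prod>t<m. A (i t) (i (Suc t))) * A (i m) k"
      by simp
  next
    fix i assume i: "i \<in> paths N (Suc m) j k"
    show "(restrict i {..m})(Suc m := k) = i"
      using i by (auto simp: paths_def PiE_def extensional_def fun_eq_iff)
    show "restrict i {..m} \<in> P" using i by (auto simp: paths_def P_def)
  qed
  finally show ?case .
qed

text \<open>Double counting, to exchange the pairings of a given walk for the walks that respect a
  given pairing.\<close>

lemma sum_card_swap:
  assumes "finite A" "finite B"
  shows "(\<Sum>a\<in>A. card {b\<in>B. R a b}) = (\<Sum>b\<in>B. card {a\<in>A. R a b})"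
proof -
  have "(\<Sum>a\<in>A. card {b\<in>B. R a b}) = (\<Sum>a\<in>A. \<Sum>b\<in>B. if R a b then 1 else 0)"
    using assms by (simp flip: sum.inter_filter)
  also have "\<dots> = (\<Sum>b\<in>B. \<Sum>a\<in>A. if R a b then 1 else 0)" by (rule sum.swap)
  also have "\<dots> = (\<Sum>b\<in>B. card {a\<in>A. R a b})"
    using assms by (simp flip: sum.inter_filter)
  finally show ?thesis .
qed

lemma sum_telescope_path:
  fixes g :: "nat \<Rightarrow> int"
  shows "(\<Sum>t<m. g (i (Suc t))) - (\<Sum>t<m. g (i t)) = g (i m) - g (i 0)"
  using sum_lessThan_telescope[of "\<lambda>t. g (i t)" m] by (simp add: sum_subtractf)

text \<open>The pairing matches starts of steps with ends of steps, so every vertex is equally often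
  a start and an end. Telescoping the indicator function of the initial vertex identifies the final
  one.\<close>

lemma (in walk_pairing) walk_closed:
  fixes i :: "nat \<Rightarrow> nat"
  assumes "\<forall>t<n. i t = i (Suc (\<pi> t))"
  shows "i n = i 0"
proof -
  define g where "g = (\<lambda>x. if x = i 0 then 1 else 0 :: int)"
  have "bij_betw \<pi> {..<n} {..<n}" by (rule bij_betw_byWitness[where f'=\<pi>]) (use pi in auto)
  then have "(\<Sum>t<n. g (i (Suc t))) = (\<Sum>t<n. g (i (Suc (\<pi> t))))"
    by (rule sum.reindex_bij_betw[symmetric])
  also have "\<dots> = (\<Sum>t<n. g (i t))" using assms by (intro sum.cong) auto
  finally have "g (i n) = g (i 0)" using sum_telescope_path[where g=g and i=i and m=n] by simp
  then show ?thesis by (auto simp: g_def split: if_splits)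
qed

text \<open>By \<open>expectation_mp\<close> this is every diagonal entry of the expected power, and
  not only their average.\<close>

definition trace_moment :: "real \<Rightarrow> nat \<Rightarrow> nat \<Rightarrow> nat \<Rightarrow> real" where
  "trace_moment v N b m = (v / real (band_width N b)) ^ (m div 2) *
     real (\<Sum>\<pi>\<in>pairings {..<m}. card (step_solutions N b m \<pi>))"

text \<open>By \<open>matchings_Un\<close> the product of the two expectations accounts for the
  pairings that preserve \<open>S\<close>; those that connect \<open>S\<close> and \<open>T\<close>
  remain.\<close>

lemma (in gue_space) wick_covariance:
  fixes p q :: "'t \<Rightarrow> nat"
  assumes "finite S" "finite T" "S \<inter> T = {}" "\<And>t. t \<in> S \<union> T \<Longrightarrow> p t < N \<and> q t < N"
  shows "expectation (\<lambda>\<omega>. \<Prod>t\<in>S \<union> T. X \<omega> $$ (p t, q t)) -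
      expectation (\<lambda>\<omega>. \<Prod>t\<in>S. X \<omega> $$ (p t, q t)) * expectation (\<lambda>\<omega>. \<Prod>t\<in>T. X \<omega> $$ (p t, q t)) =
    of_real (v ^ (card (S \<union> T) div 2)) * of_nat (card {\<pi>\<in>matchings (S \<union> T) p q. \<not> \<pi> ` S \<subseteq> S})"
proof -
  have fin: "finite (matchings (S \<union> T) p q)" using assms by (simp add: finite_matchings)
  have "matchings (S \<union> T) p q = {\<pi>\<in>matchings (S \<union> T) p q. \<pi> ` S \<subseteq> S} \<union> {\<pi>\<in>matchings (S \<union> T) p q. \<not> \<pi> ` S \<subseteq> S}"
    by auto
  then have split: "card (matchings (S \<union> T) p q) = card {\<pi>\<in>matchings (S \<union> T) p q. \<pi> ` S \<subseteq> S} +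
      card {\<pi>\<in>matchings (S \<union> T) p q. \<not> \<pi> ` S \<subseteq> S}"
    using fin by (subst card_Un_disjoint[symmetric]) auto
  have pow: "v ^ (card S div 2) * real (card (matchings S p q)) * (v ^ (card T div 2) * real (card (matchings T p q)))
    = v ^ (card (S \<union> T) div 2) * real (card (matchings S p q) * card (matchings T p q))"
  \<comment> \<open>Without a matching of \<open>S\<close> both sides vanish; otherwise
    \<open>card S\<close> is even and the halved cardinalities add up.\<close>
  proof (cases "matchings S p q = {}")
    case False
    then have "even (card S)" using pairings_even_card[OF assms(1)] by (auto simp: matchings_def)
    then have "card (S \<union> T) div 2 = card S div 2 + card T div 2"
      using card_Un_disjoint[OF assms(1-3)] by (simp add: div_plus_div_distrib_dvd_left)
    then show ?thesis by (simp add: power_add)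
  qed simp
  have "expectation (\<lambda>\<omega>. \<Prod>t\<in>S. X \<omega> $$ (p t, q t)) * expectation (\<lambda>\<omega>. \<Prod>t\<in>T. X \<omega> $$ (p t, q t)) =
    complex_of_real (v ^ (card S div 2) * real (card (matchings S p q)) * (v ^ (card T div 2) * real (card (matchings T p q))))"
    using wick[OF assms(1), of p q] wick[OF assms(2), of p q] assms(4) by simp
  also have "\<dots> = of_real (v ^ (card (S \<union> T) div 2)) * of_nat (card {\<pi>\<in>matchings (S \<union> T) p q. \<pi> ` S \<subseteq> S})"
    unfolding pow matchings_Un[OF assms(3)] by simp
  finally show ?thesis
    using wick[of "S \<union> T" p q] assms unfolding split by (simp add: algebra_simps)
qed

section \<open>Mean and covariance of the entries of powers\<close>

locale banded_gue = gue_space +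
  fixes b :: nat
  assumes N_pos: "N > 0"
begin

definition Xi :: "'a \<Rightarrow> nat \<Rightarrow> nat \<Rightarrow> complex" where
  "Xi \<omega> r s = periodic_band N b (X \<omega>) $$ (r, s)"

definition weight :: "nat \<Rightarrow> nat \<Rightarrow> real" where
  "weight r s = (if band N b r s then 1 / sqrt (real (band_width N b)) else 0)"

lemma Xi_eq: "r < N \<Longrightarrow> s < N \<Longrightarrow> Xi \<omega> r s = of_real (weight r s) * X \<omega> $$ (r, s)"
  by (simp add: Xi_def periodic_band_def weight_def band_def band_width_def)

lemma Xi_all_moments: "r < N \<Longrightarrow> s < N \<Longrightarrow> all_moments (\<lambda>\<omega>. Xi \<omega> r s)"
  unfolding Xi_eq by (intro all_moments_mult all_moments_const X_all_moments)

lemma Xi_hermitian: "AE \<omega> in M. \<forall>r<N. \<forall>s<N. Xi \<omega> s r = cnj (Xi \<omega> r s)"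
  using X_hermitian
proof eventually_elim
  case (elim \<omega>)
  show ?case
  proof (intro allI impI)
    fix r s assume rs: "r < N" "s < N"
    then have "X \<omega> $$ (s, r) = cnj (X \<omega> $$ (r, s))" using elim by blast
    then show "Xi \<omega> s r = cnj (Xi \<omega> r s)"
      using rs by (simp add: Xi_eq weight_def band_commute[of N b s r])
  qed
qed

abbreviation mp :: "nat \<Rightarrow> 'a \<Rightarrow> nat \<Rightarrow> nat \<Rightarrow> complex" where
  "mp m \<omega> \<equiv> mpow N (Xi \<omega>) m"

lemma mp_all_moments: "j < N \<Longrightarrow> k < N \<Longrightarrow> all_moments (\<lambda>\<omega>. mp m \<omega> j k)"
proof (induction m arbitrary: k)
  case (Suc m)
  show ?case unfolding mpow.simps
    by (intro all_moments_sum all_moments_mult Suc.IH Suc.prems Xi_all_moments) auto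
qed auto

definition path_weight :: "nat \<Rightarrow> (nat \<Rightarrow> nat) \<Rightarrow> real" where
  "path_weight m i = (\<Prod>t<m. weight (i t) (i (Suc t)))"

lemma path_weight_eq:
  "path_weight m i = (if \<forall>t<m. band N b (i t) (i (Suc t)) then (1 / sqrt (real (band_width N b))) ^ m else 0)"
  unfolding path_weight_def weight_def by (auto simp: prod_zero_iff)

lemma path_product:
  assumes "i \<in> paths N m j k"
  shows "(\<Prod>t<m. Xi \<omega> (i t) (i (Suc t))) = of_real (path_weight m i) * (\<Prod>t<m. X \<omega> $$ (i t, i (Suc t)))"
proof -
  have "(\<Prod>t<m. Xi \<omega> (i t) (i (Suc t))) = (\<Prod>t<m. of_real (weight (i t) (i (Suc t))) * X \<omega> $$ (i t, i (Suc t)))"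
    using paths_less[OF assms] by (intro prod.cong refl Xi_eq) auto
  then show ?thesis by (simp add: prod.distrib path_weight_def)
qed

lemma mp_eq_paths:
  assumes "j < N" "k < N"
  shows "mp m \<omega> j k = (\<Sum>i\<in>paths N m j k. of_real (path_weight m i) * (\<Prod>t<m. X \<omega> $$ (i t, i (Suc t))))"
  unfolding mpow_paths[OF assms] using path_product by (intro sum.cong refl) auto

lemma X_prod_all_moments:
  "(\<And>t. t \<in> S \<Longrightarrow> p t < N \<and> q t < N) \<Longrightarrow> all_moments (\<lambda>\<omega>. \<Prod>t\<in>S. X \<omega> $$ (p t, q t))"
  by (intro all_moments_prod X_all_moments) auto

lemma sqrt_band_width_power:
  assumes "even m"
  shows "(1 / sqrt (real (band_width N b))) ^ m = 1 / real (band_width N b) ^ (m div 2)"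
proof -
  obtain h where "m = 2 * h" using assms by auto
  then show ?thesis by (simp add: power_mult power_one_over)
qed

text \<open>After the Wick formula and the exchange of sums, each pairing contributes its walks from
  \<open>j\<close> to \<open>k\<close>. They return to \<open>j\<close>, so off-diagonal entries
  vanish; their number does not depend on \<open>j\<close>, so the diagonal is constant.\<close>

lemma expectation_mp:
  assumes "j < N" "k < N"
  shows "expectation (\<lambda>\<omega>. mp m \<omega> j k) = (if j = k then of_real (trace_moment v N b m) else 0)"
proof -
  define w where "w = (1 / sqrt (real (band_width N b))) ^ m"
  define P where "P = {i\<in>paths N m j k. \<forall>t<m. band N b (i t) (i (Suc t))}"
  have fP: "finite P" unfolding P_def using finite_paths by simp
  have "expectation (\<lambda>\<omega>. mp m \<omega> j k) =
    (\<Sum>i\<in>paths N m j k. of_real (path_weight m i) * expectation (\<lambda>\<omega>. \<Prod>t<m. X \<omega> $$ (i t, i (Suc t))))"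
    unfolding mp_eq_paths[OF assms]
  proof (subst Bochner_Integration.integral_sum)
    fix i assume i: "i \<in> paths N m j k"
    show "integrable M (\<lambda>\<omega>. complex_of_real (path_weight m i) * (\<Prod>t<m. X \<omega> $$ (i t, i (Suc t))))"
      using paths_less[OF i]
      by (intro all_moments_integrable all_moments_mult all_moments_const X_prod_all_moments) auto
  qed simp
  also have "\<dots> = (\<Sum>i\<in>paths N m j k. of_real (path_weight m i) *
      (of_real (v ^ (m div 2)) * of_nat (card (matchings {..<m} i (\<lambda>t. i (Suc t))))))"
  proof (rule sum.cong[OF refl])
    fix i assume i: "i \<in> paths N m j k"
    show "of_real (path_weight m i) * expectation (\<lambda>\<omega>. \<Prod>t<m. X \<omega> $$ (i t, i (Suc t))) =
      of_real (path_weight m i) * (of_real (v ^ (m div 2)) * of_nat (card (matchings {..<m} i (\<lambda>t. i (Suc t)))))"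
      using wick[of "{..<m}" i "\<lambda>t. i (Suc t)"] paths_less[OF i] by simp
  qed
  also have "\<dots> = (\<Sum>i\<in>paths N m j k. if \<forall>t<m. band N b (i t) (i (Suc t)) then
      of_real (w * v ^ (m div 2)) * of_nat (card (matchings {..<m} i (\<lambda>t. i (Suc t)))) else 0)"
    by (intro sum.cong refl) (auto simp: path_weight_eq w_def)
  also have "\<dots> = (\<Sum>i\<in>P. of_real (w * v ^ (m div 2)) * of_nat (card (matchings {..<m} i (\<lambda>t. i (Suc t)))))"
    unfolding P_def by (rule sum.inter_filter[symmetric]) (rule finite_paths)
  also have "\<dots> = of_real (w * v ^ (m div 2) * real (\<Sum>i\<in>P. card (matchings {..<m} i (\<lambda>t. i (Suc t)))))"
    by (simp add: sum_distrib_left)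
  also have "(\<Sum>i\<in>P. card (matchings {..<m} i (\<lambda>t. i (Suc t)))) =
      (\<Sum>\<pi>\<in>pairings {..<m}. card {i\<in>P. \<forall>t\<in>{..<m}. i t = i (Suc (\<pi> t))})"
    unfolding matchings_def by (rule sum_card_swap[OF fP]) (simp add: finite_pairings)
  also have "\<dots> = (\<Sum>\<pi>\<in>pairings {..<m}. if j = k then card (step_solutions N b m \<pi>) else 0)"
  proof (rule sum.cong[OF refl])
    fix \<pi> assume "\<pi> \<in> pairings {..<m}"
    then interpret walk_pairing m \<pi> by unfold_locales
    have "{i\<in>P. \<forall>t\<in>{..<m}. i t = i (Suc (\<pi> t))} = {i\<in>walks N b m \<pi> j. i m = k}"
      by (auto simp: P_def paths_def walks_def)
    also have "\<dots> = (if j = k then walks N b m \<pi> j else {})"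
    proof -
      have "i m = j" if "i \<in> walks N b m \<pi> j" for i
        using walk_closed[of i] that unfolding walks_def by blast
      then show ?thesis by auto
    qed
    finally have e: "{i\<in>P. \<forall>t\<in>{..<m}. i t = i (Suc (\<pi> t))} = (if j = k then walks N b m \<pi> j else {})" .
    show "card {i\<in>P. \<forall>t\<in>{..<m}. i t = i (Suc (\<pi> t))} = (if j = k then card (step_solutions N b m \<pi>) else 0)"
      unfolding e using card_walks[OF assms(1), of b] by (cases "j = k") simp_all
  qed
  finally have E: "expectation (\<lambda>\<omega>. mp m \<omega> j k) = of_real (w * v ^ (m div 2) *
      real (\<Sum>\<pi>\<in>pairings {..<m}. if j = k then card (step_solutions N b m \<pi>) else 0))" .
  show ?thesis
  \<comment> \<open>If there is no pairing, both sides are 0; otherwise \<open>m\<close> is even and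
    the power of the square root becomes a power of the band width.\<close>
  proof (cases "pairings {..<m} = {}")
    case True
    then show ?thesis unfolding E trace_moment_def by simp
  next
    case False
    then have "even m" using pairings_even_card[of "{..<m}"] by auto
    then have "w * v ^ (m div 2) = (v / real (band_width N b)) ^ (m div 2)"
      unfolding w_def sqrt_band_width_power[OF \<open>even m\<close>] by (simp add: power_divide)
    then show ?thesis unfolding E trace_moment_def by simp
  qed
qed

text \<open>Puts the positions of two paths, of which the first has length \<open>m\<close>, into one index set.\<close>

definition joined :: "nat \<Rightarrow> (nat \<Rightarrow> nat) \<Rightarrow> (nat \<Rightarrow> nat) \<Rightarrow> nat \<Rightarrow> nat" where
  "joined m i i' t = (if t < m then i t else i' (t - m))"

lemma prod_joined:
  fixes f :: "nat \<Rightarrow> nat \<Rightarrow> complex"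
  shows "(\<Prod>t\<in>{m..<m + m'}. f (joined m i i' t) (joined m (\<lambda>t. i (Suc t)) (\<lambda>t. i' (Suc t)) t)) =
    (\<Prod>t<m'. f (i' t) (i' (Suc t)))"
  by (rule prod.reindex_bij_witness[where i="\<lambda>t. t + m" and j="\<lambda>t. t - m"]) (auto simp: joined_def Suc_diff_le)

lemma prod_joined_left:
  fixes f :: "nat \<Rightarrow> nat \<Rightarrow> complex"
  shows "(\<Prod>t<m. f (joined m i i' t) (joined m (\<lambda>t. i (Suc t)) (\<lambda>t. i' (Suc t)) t)) =
    (\<Prod>t<m. f (i t) (i (Suc t)))"
  by (rule prod.cong) (auto simp: joined_def)

lemma expectation_mp_prod:
  assumes "j < N" "k < N" "j' < N" "k' < N"
  shows "expectation (\<lambda>\<omega>. mp m \<omega> j k * mp m' \<omega> k' j') =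
    (\<Sum>i\<in>paths N m j k. \<Sum>i'\<in>paths N m' k' j'. of_real (path_weight m i * path_weight m' i') *
      expectation (\<lambda>\<omega>. \<Prod>t\<in>{..<m} \<union> {m..<m + m'}. X \<omega> $$ (joined m i i' t, joined m (\<lambda>t. i (Suc t)) (\<lambda>t. i' (Suc t)) t)))"
proof -
  have J: "joined m i i' t < N \<and> joined m (\<lambda>t. i (Suc t)) (\<lambda>t. i' (Suc t)) t < N"
    if "i \<in> paths N m j k" "i' \<in> paths N m' k' j'" "t \<in> {..<m} \<union> {m..<m + m'}" for i i' t
    using paths_less[OF that(1)] paths_less[OF that(2)] that(3) by (auto simp: joined_def)
  have "mp m \<omega> j k * mp m' \<omega> k' j' = (\<Sum>i\<in>paths N m j k. \<Sum>i'\<in>paths N m' k' j'. of_real (path_weight m i * path_weight m' i') *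
      (\<Prod>t\<in>{..<m} \<union> {m..<m + m'}. X \<omega> $$ (joined m i i' t, joined m (\<lambda>t. i (Suc t)) (\<lambda>t. i' (Suc t)) t)))" for \<omega>
    unfolding mp_eq_paths[OF assms(1,2)] mp_eq_paths[OF assms(4,3)] sum_product
    by (subst prod.union_disjoint) (auto simp: prod_joined[where f="\<lambda>a b. X \<omega> $$ (a, b)"]
        prod_joined_left[where f="\<lambda>a b. X \<omega> $$ (a, b)"] intro!: sum.cong)
  then have "expectation (\<lambda>\<omega>. mp m \<omega> j k * mp m' \<omega> k' j') =
    expectation (\<lambda>\<omega>. \<Sum>i\<in>paths N m j k. \<Sum>i'\<in>paths N m' k' j'. of_real (path_weight m i * path_weight m' i') *
      (\<Prod>t\<in>{..<m} \<union> {m..<m + m'}. X \<omega> $$ (joined m i i' t, joined m (\<lambda>t. i (Suc t)) (\<lambda>t. i' (Suc t)) t)))"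
    by simp
  also have "\<dots> = (\<Sum>i\<in>paths N m j k. \<Sum>i'\<in>paths N m' k' j'. expectation (\<lambda>\<omega>. of_real (path_weight m i * path_weight m' i') *
      (\<Prod>t\<in>{..<m} \<union> {m..<m + m'}. X \<omega> $$ (joined m i i' t, joined m (\<lambda>t. i (Suc t)) (\<lambda>t. i' (Suc t)) t))))"
  proof -
    have int: "all_moments (\<lambda>\<omega>. of_real (path_weight m i * path_weight m' i') *
      (\<Prod>t\<in>{..<m} \<union> {m..<m + m'}. X \<omega> $$ (joined m i i' t, joined m (\<lambda>t. i (Suc t)) (\<lambda>t. i' (Suc t)) t)))"
      if "i \<in> paths N m j k" "i' \<in> paths N m' k' j'" for i i'
      by (intro all_moments_mult all_moments_const X_prod_all_moments J[OF that])
    show ?thesis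
      by (subst Bochner_Integration.integral_sum, intro all_moments_integrable all_moments_sum int, assumption+,
          intro sum.cong refl, subst Bochner_Integration.integral_sum, intro all_moments_integrable int, assumption+, rule refl)
  qed
  finally show ?thesis by simp
qed

text \<open>A matching identifies the row indices with the column indices as multisets. The inner
  vertices of the paths occur in both and cancel, which leaves \<open>j\<close>, \<open>k'\<close>
  against \<open>k\<close>, \<open>j'\<close>; the hypotheses rule out the two ways in which these
  can agree.\<close>

lemma expectation_mp_prod_eq_0:
  assumes "j < N" "k < N" "j' < N" "k' < N" and ne: "\<not> (j = k \<and> j' = k')" "\<not> (j = j' \<and> k = k')"
  shows "expectation (\<lambda>\<omega>. mp m \<omega> j k * mp m' \<omega> k' j') = 0"
  unfolding expectation_mp_prod[OF assms(1-4)]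
proof (intro sum.neutral ballI)
  fix i i' assume i: "i \<in> paths N m j k" "i' \<in> paths N m' k' j'"
  let ?S = "{..<m} \<union> {m..<m + m'}"
  let ?p = "joined m i i'" and ?q = "joined m (\<lambda>t. i (Suc t)) (\<lambda>t. i' (Suc t))"
  have J: "?p t < N \<and> ?q t < N" if "t \<in> ?S" for t
    using paths_less[OF i(1)] paths_less[OF i(2)] that by (auto simp: joined_def)
  have "matchings ?S ?p ?q = {}"
  proof (rule equals0I)
    fix \<pi> assume \<pi>: "\<pi> \<in> matchings ?S ?p ?q"
    have bal: "g j + g k' = g k + g j'" for g :: "nat \<Rightarrow> int"
    proof -
      have "\<pi> permutes ?S" using \<pi> by (auto simp: matchings_def pairings_def)
      then have "(\<Sum>t\<in>?S. g (?q t)) = (\<Sum>t\<in>?S. g (?q (\<pi> t)))"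
        using sum.permute[of \<pi> ?S "\<lambda>t. g (?q t)"] by (simp add: comp_def)
      also have "\<dots> = (\<Sum>t\<in>?S. g (?p t))" using \<pi> by (intro sum.cong) (auto simp: matchings_def)
      finally have eq: "(\<Sum>t\<in>?S. g (?q t)) = (\<Sum>t\<in>?S. g (?p t))" .
      have L: "(\<Sum>t\<in>?S. g (joined m a a' t)) = (\<Sum>t<m. g (a t)) + (\<Sum>t<m'. g (a' t))" for a a'
      proof -
        have "(\<Sum>t\<in>{m..<m + m'}. g (joined m a a' t)) = (\<Sum>t<m'. g (a' t))"
          by (rule sum.reindex_bij_witness[where i="\<lambda>t. t + m" and j="\<lambda>t. t - m"]) (auto simp: joined_def)
        moreover have "(\<Sum>t<m. g (joined m a a' t)) = (\<Sum>t<m. g (a t))"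
          by (rule sum.cong) (auto simp: joined_def)
        ultimately show ?thesis by (subst sum.union_disjoint) auto
      qed
      have "g (i m) - g (i 0) + (g (i' m') - g (i' 0)) = 0"
        using eq sum_telescope_path[of g i m] sum_telescope_path[of g i' m'] unfolding L by simp
      then show ?thesis using i by (simp add: paths_def)
    qed
    show False
      using bal[of "\<lambda>x. if x = j then 1 else 0"] bal[of "\<lambda>x. if x = k then 1 else 0"]
        bal[of "\<lambda>x. if x = k' then 1 else 0"] ne by (auto split: if_splits)
  qed
  then show "complex_of_real (path_weight m i * path_weight m' i') *
      expectation (\<lambda>\<omega>. \<Prod>t\<in>?S. X \<omega> $$ (?p t, ?q t)) = 0"
    using wick[of ?S ?p ?q] J by simp
qed

text \<open>A path from \<open>j\<close> to \<open>k\<close> followed by one back is a walk of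
  length \<open>2 * m\<close> that is at \<open>k\<close> at time \<open>m\<close>. Only the
  pairings connecting the two halves count, and for these the prescribed vertex costs one degree of
  freedom: at most \<open>\<xi> ^ (m - 1)\<close> walks against the normalization
  \<open>\<xi> ^ m\<close>.\<close>

lemma covariance_bound:
  assumes "j < N" "k < N"
  shows "norm (expectation (\<lambda>\<omega>. mp m \<omega> j k * mp m \<omega> k j) -
      expectation (\<lambda>\<omega>. mp m \<omega> j k) * expectation (\<lambda>\<omega>. mp m \<omega> k j))
    \<le> real (card (pairings {..<2 * m})) * v ^ m / real (band_width N b)"
proof -
  define \<xi> where "\<xi> = real (band_width N b)"
  have \<xi>: "\<xi> > 0" using band_width_pos[OF N_pos] by (simp add: \<xi>_def)
  let ?S = "{..<m} \<union> {m..<m + m}"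
  let ?p = "joined m" and ?q = "\<lambda>i i'. joined m (\<lambda>t. i (Suc t)) (\<lambda>t. i' (Suc t))"
  define P where "P = {i\<in>paths N m j k. \<forall>t<m. band N b (i t) (i (Suc t))}"
  define P' where "P' = {i\<in>paths N m k j. \<forall>t<m. band N b (i t) (i (Suc t))}"
  have fP: "finite P" "finite P'" unfolding P_def P'_def using finite_paths by simp_all
  define C where "C = {\<pi>\<in>pairings ?S. \<not> \<pi> ` {..<m} \<subseteq> {..<m}}"
  have fC: "finite C" unfolding C_def by (simp add: finite_pairings)
  define c where "c = (\<lambda>i i'. card {\<pi>\<in>matchings ?S (?p i i') (?q i i'). \<not> \<pi> ` {..<m} \<subseteq> {..<m}})"
  have J: "?p i i' t < N \<and> ?q i i' t < N"
    if "i \<in> paths N m j k" "i' \<in> paths N m k j" "t \<in> ?S" for i i' t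
    using paths_less[OF that(1)] paths_less[OF that(2)] that(3) by (auto simp: joined_def)
  have E1: "expectation (\<lambda>\<omega>. mp m \<omega> j k) = (\<Sum>i\<in>paths N m j k. of_real (path_weight m i) *
      expectation (\<lambda>\<omega>. \<Prod>t<m. X \<omega> $$ (i t, i (Suc t))))" if "j < N" "k < N" for j k
    unfolding mp_eq_paths[OF that]
  proof (subst Bochner_Integration.integral_sum)
    fix i assume i: "i \<in> paths N m j k"
    show "integrable M (\<lambda>\<omega>. complex_of_real (path_weight m i) * (\<Prod>t<m. X \<omega> $$ (i t, i (Suc t))))"
      using paths_less[OF i]
      by (intro all_moments_integrable all_moments_mult all_moments_const X_prod_all_moments) auto
  qed simp
  have "expectation (\<lambda>\<omega>. mp m \<omega> j k * mp m \<omega> k j) - expectation (\<lambda>\<omega>. mp m \<omega> j k) * expectation (\<lambda>\<omega>. mp m \<omega> k j) =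
    (\<Sum>i\<in>paths N m j k. \<Sum>i'\<in>paths N m k j. of_real (path_weight m i * path_weight m i') *
      (expectation (\<lambda>\<omega>. \<Prod>t\<in>?S. X \<omega> $$ (?p i i' t, ?q i i' t)) -
       expectation (\<lambda>\<omega>. \<Prod>t<m. X \<omega> $$ (?p i i' t, ?q i i' t)) * expectation (\<lambda>\<omega>. \<Prod>t\<in>{m..<m + m}. X \<omega> $$ (?p i i' t, ?q i i' t))))"
    unfolding expectation_mp_prod[OF assms assms] E1[OF assms] E1[OF assms(2,1)] sum_product
      prod_joined[where f="\<lambda>a b. X _ $$ (a, b)"] prod_joined_left[where f="\<lambda>a b. X _ $$ (a, b)"]
    by (simp add: right_diff_distrib sum_subtractf mult_ac)
  also have "\<dots> = (\<Sum>i\<in>paths N m j k. \<Sum>i'\<in>paths N m k j. of_real (path_weight m i * path_weight m i') *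
      (of_real (v ^ m) * of_nat (c i i')))"
  proof (intro sum.cong refl arg_cong2[of _ _ _ _ "(*)"])
    fix i i' assume i: "i \<in> paths N m j k" "i' \<in> paths N m k j"
    have "card ?S = m + m" by (subst card_Un_disjoint) auto
    then show "expectation (\<lambda>\<omega>. \<Prod>t\<in>?S. X \<omega> $$ (?p i i' t, ?q i i' t)) -
       expectation (\<lambda>\<omega>. \<Prod>t<m. X \<omega> $$ (?p i i' t, ?q i i' t)) * expectation (\<lambda>\<omega>. \<Prod>t\<in>{m..<m + m}. X \<omega> $$ (?p i i' t, ?q i i' t))
      = of_real (v ^ m) * of_nat (c i i')"
      unfolding c_def using J[OF i] by (subst wick_covariance) auto
  qed
  also have "\<dots> = (\<Sum>i\<in>paths N m j k. \<Sum>i'\<in>paths N m k j.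
      if (\<forall>t<m. band N b (i t) (i (Suc t))) \<and> (\<forall>t<m. band N b (i' t) (i' (Suc t)))
      then of_real (1 / \<xi> ^ m * v ^ m) * of_nat (c i i') else 0)"
  proof (intro sum.cong refl)
    fix i i'
    have if_mult: "x * x = y \<Longrightarrow> (if A then x else 0) * (if B then x else 0) = (if A \<and> B then y else 0)"
      for A B and x y :: real by auto
    have if_of_real: "of_real (if A then y else 0) * (complex_of_real z * u) = (if A then of_real (y * z) * u else 0)"
      for A and y z :: real and u by simp
    have "(1 / sqrt \<xi>) ^ m * (1 / sqrt \<xi>) ^ m = 1 / \<xi> ^ m"
      using \<xi> by (simp add: power_mult_distrib[symmetric] power_one_over)
    then have "path_weight m i * path_weight m i' =
      (if (\<forall>t<m. band N b (i t) (i (Suc t))) \<and> (\<forall>t<m. band N b (i' t) (i' (Suc t))) then 1 / \<xi> ^ m else 0)"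
      
      unfolding path_weight_eq \<xi>_def[symmetric] by (rule if_mult)
    then show "of_real (path_weight m i * path_weight m i') * (of_real (v ^ m) * of_nat (c i i')) =
      (if (\<forall>t<m. band N b (i t) (i (Suc t))) \<and> (\<forall>t<m. band N b (i' t) (i' (Suc t)))
      then complex_of_real (1 / \<xi> ^ m * v ^ m) * of_nat (c i i') else 0)"
      by (simp only: if_of_real)
  qed
  also have "\<dots> = (\<Sum>i\<in>P. \<Sum>i'\<in>P'. of_real (1 / \<xi> ^ m * v ^ m) * of_nat (c i i'))"
  proof -
    have inner: "(\<Sum>y\<in>D. if A \<and> B y then f y else 0) = (if A then \<Sum>y\<in>{y\<in>D. B y}. f y else 0)"
      if "finite D" for D :: "(nat \<Rightarrow> nat) set" and A B and f :: "(nat \<Rightarrow> nat) \<Rightarrow> complex"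
      using that by (cases A) (simp_all add: sum.inter_filter)
    show ?thesis unfolding P_def P'_def inner[OF finite_paths] by (rule sum.inter_filter[OF finite_paths, symmetric])
  qed
  also have "\<dots> = of_real (v ^ m / \<xi> ^ m * real (\<Sum>i\<in>P. \<Sum>i'\<in>P'. c i i'))"
    by (simp add: sum_distrib_left)
  finally have E: "expectation (\<lambda>\<omega>. mp m \<omega> j k * mp m \<omega> k j) - expectation (\<lambda>\<omega>. mp m \<omega> j k) * expectation (\<lambda>\<omega>. mp m \<omega> k j) =
     of_real (v ^ m / \<xi> ^ m * real (\<Sum>i\<in>P. \<Sum>i'\<in>P'. c i i'))" .
  have "(\<Sum>i\<in>P. \<Sum>i'\<in>P'. c i i') = (\<Sum>x\<in>P \<times> P'. card {\<pi>\<in>C. \<forall>t\<in>?S. ?p (fst x) (snd x) t = ?q (fst x) (snd x) (\<pi> t)})"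
    unfolding sum.cartesian_product split_beta c_def C_def matchings_def
    by (intro sum.cong refl arg_cong[of _ _ card]) auto
  also have "\<dots> = (\<Sum>\<pi>\<in>C. card {x\<in>P \<times> P'. \<forall>t\<in>?S. ?p (fst x) (snd x) t = ?q (fst x) (snd x) (\<pi> t)})"
    using fP fC by (intro sum_card_swap) auto
  also have "\<dots> \<le> (\<Sum>\<pi>\<in>C. band_width N b ^ (m - 1))"
  proof (rule sum_mono)
    fix \<pi> assume \<pi>: "\<pi> \<in> C"
    have S2: "?S = {..<2 * m}" by auto
    interpret walk_pairing "2 * m" \<pi> using \<pi> unfolding C_def S2 by unfold_locales auto
    have "\<exists>q<m. \<not> \<pi> q < m" using \<pi> by (auto simp: C_def)
    then obtain q where q: "q < m" "m \<le> \<pi> q" using linorder_not_less by blast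
    have "card {x\<in>P \<times> P'. \<forall>t\<in>?S. ?p (fst x) (snd x) t = ?q (fst x) (snd x) (\<pi> t)} \<le>
        card {i \<in> walks N b (2 * m) \<pi> j. i m = k}"
    proof (rule card_inj_on_le)
      let ?f = "\<lambda>x. \<lambda>t\<in>{..2 * m}. joined m (fst x) (snd x) t"
      have snd0: "snd x 0 = k" "fst x m = k" "fst x 0 = j" "snd x m = j" if "x \<in> P \<times> P'" for x
        using that by (auto simp: P_def P'_def paths_def)
      \<comment> \<open>The first path ends where the second begins, so the vertex at time
        \<open>m\<close> may be read from either.\<close>
      have at_m: "?f x t = (if t \<le> m then fst x t else snd x (t - m))" if "x \<in> P \<times> P'" "t \<le> 2 * m" for x t
        using snd0[OF that(1)] that(2) by (auto simp: joined_def)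
      have suc: "?f x (Suc t) = joined m (\<lambda>t. fst x (Suc t)) (\<lambda>t. snd x (Suc t)) t" if "x \<in> P \<times> P'" "t < 2 * m" for x t
      proof -
        consider "Suc t < m" | "Suc t = m" | "m \<le> t" by linarith
        then show ?thesis using at_m[OF that(1), of "Suc t"] that(2)
          by cases (auto simp: joined_def Suc_diff_le)
      qed
      show "inj_on ?f {x\<in>P \<times> P'. \<forall>t\<in>?S. ?p (fst x) (snd x) t = ?q (fst x) (snd x) (\<pi> t)}"
      proof (rule inj_onI)
        fix x y assume "x \<in> {x\<in>P \<times> P'. \<forall>t\<in>?S. ?p (fst x) (snd x) t = ?q (fst x) (snd x) (\<pi> t)}"
          "y \<in> {x\<in>P \<times> P'. \<forall>t\<in>?S. ?p (fst x) (snd x) t = ?q (fst x) (snd x) (\<pi> t)}" and e: "?f x = ?f y"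
        then have xy: "x \<in> P \<times> P'" "y \<in> P \<times> P'" by auto
        have "fst x t = fst y t" for t
        proof (cases "t \<le> m")
          case True
          then show ?thesis using fun_cong[OF e, of t] at_m[OF xy(1), of t] at_m[OF xy(2), of t] by auto
        next
          case False
          then show ?thesis using xy by (auto simp: P_def paths_def PiE_def extensional_def)
        qed
        moreover have "snd x t = snd y t" for t
        proof (cases "t \<le> m")
          case True
          then show ?thesis
            using fun_cong[OF e, of "t + m"] at_m[OF xy(1), of "t + m"] at_m[OF xy(2), of "t + m"] snd0[OF xy(1)] snd0[OF xy(2)]
            by (cases "t = 0") auto
        next
          case False
          then show ?thesis using xy by (auto simp: P'_def paths_def PiE_def extensional_def)
        qed
        ultimately show "x = y" by (auto simp: prod_eq_iff)
      qed
      show "?f ` {x\<in>P \<times> P'. \<forall>t\<in>?S. ?p (fst x) (snd x) t = ?q (fst x) (snd x) (\<pi> t)} \<subseteq> {i \<in> walks N b (2 * m) \<pi> j. i m = k}"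
      proof
        fix y assume "y \<in> ?f ` {x\<in>P \<times> P'. \<forall>t\<in>?S. ?p (fst x) (snd x) t = ?q (fst x) (snd x) (\<pi> t)}"
        then obtain x where y: "y = ?f x" and x: "x \<in> P \<times> P'"
          and match: "\<And>t. t < 2 * m \<Longrightarrow> ?p (fst x) (snd x) t = ?q (fst x) (snd x) (\<pi> t)"
          unfolding S2 by auto
        have xP: "fst x \<in> paths N m j k" "snd x \<in> paths N m k j"
          "\<And>t. t < m \<Longrightarrow> band N b (fst x t) (fst x (Suc t))" "\<And>t. t < m \<Longrightarrow> band N b (snd x t) (snd x (Suc t))"
          using x by (auto simp: P_def P'_def)
        have "y t < N" if "t \<le> 2 * m" for t
          using at_m[OF x that] paths_less[OF xP(1), of t] paths_less[OF xP(2), of "t - m"] that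
          unfolding y by (auto split: if_splits)
        then have "y \<in> {..2 * m} \<rightarrow>\<^sub>E {..<N}" unfolding y by auto
        moreover have "y 0 = j" "y m = k" using at_m[OF x, of 0] at_m[OF x, of m] snd0[OF x] unfolding y by auto
        moreover have "band N b (y t) (y (Suc t))" if "t < 2 * m" for t
          using suc[OF x that] xP(3)[of t] xP(4)[of "t - m"] that unfolding y by (auto simp: joined_def)
        moreover have "y t = y (Suc (\<pi> t))" if "t < 2 * m" for t
          using suc[OF x, of "\<pi> t"] pi(1)[OF that] match[OF that] that unfolding y by simp
        ultimately show "y \<in> {i \<in> walks N b (2 * m) \<pi> j. i m = k}" by (simp add: walks_def)
      qed
      show "finite {i \<in> walks N b (2 * m) \<pi> j. i m = k}"
        by (rule finite_subset[of _ "{..2 * m} \<rightarrow>\<^sub>E {..<N}"]) (auto simp: walks_def intro!: finite_PiE)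
    qed
    also have "\<dots> \<le> band_width N b ^ (2 * m div 2 - 1)"
      using q by (intro card_walks_through assms) auto
    finally show "card {x\<in>P \<times> P'. \<forall>t\<in>?S. ?p (fst x) (snd x) t = ?q (fst x) (snd x) (\<pi> t)} \<le> band_width N b ^ (m - 1)"
      by simp
  qed
  also have "\<dots> \<le> card (pairings {..<2 * m}) * band_width N b ^ (m - 1)"
  proof -
    have "?S = {..<2 * m}" by auto
    then have "card C \<le> card (pairings {..<2 * m})" unfolding C_def by (intro card_mono finite_pairings) auto
    then show ?thesis by simp
  qed
  finally have "(\<Sum>i\<in>P. \<Sum>i'\<in>P'. c i i') \<le> card (pairings {..<2 * m}) * band_width N b ^ (m - 1)" .
  then have cnt: "real (\<Sum>i\<in>P. \<Sum>i'\<in>P'. c i i') \<le> real (card (pairings {..<2 * m})) * \<xi> ^ (m - 1)"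
    unfolding \<xi>_def by (metis of_nat_le_iff of_nat_mult of_nat_power)
  show ?thesis
  \<comment> \<open>For \<open>m = 0\<close> the exponent \<open>m - 1\<close> is truncated, but
    then the entries are deterministic.\<close>
  proof (cases "m = 0")
    case True
    then show ?thesis using v_pos by (simp add: prob_space)
  next
    case False
    have "norm (complex_of_real (v ^ m / \<xi> ^ m * real (\<Sum>i\<in>P. \<Sum>i'\<in>P'. c i i'))) = v ^ m / \<xi> ^ m * real (\<Sum>i\<in>P. \<Sum>i'\<in>P'. c i i')"
      using v_pos \<xi> by (simp only: norm_of_real) (intro abs_of_nonneg mult_nonneg_nonneg, auto intro!: sum_nonneg)
    also have "\<dots> \<le> v ^ m / \<xi> ^ m * (real (card (pairings {..<2 * m})) * \<xi> ^ (m - 1))"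
      using v_pos \<xi> by (intro mult_left_mono cnt) auto
    also have "\<dots> = real (card (pairings {..<2 * m})) * v ^ m / \<xi>"
    proof -
      have "\<xi> ^ m = \<xi> * \<xi> ^ (m - 1)" using False power_minus_mult[of m \<xi>] by (simp add: mult.commute)
      then show ?thesis using \<xi> by (simp add: field_simps)
    qed
    finally show ?thesis unfolding E \<xi>_def[symmetric] .
  qed
qed

end

section \<open>Quadratic forms of powers\<close>

definition qform :: "nat \<Rightarrow> (nat \<Rightarrow> real) \<Rightarrow> (nat \<Rightarrow> nat \<Rightarrow> complex) \<Rightarrow> (nat \<Rightarrow> real) \<Rightarrow> complex" where
  "qform N a B c = (\<Sum>r<N. \<Sum>s<N. of_real (a r) * B r s * of_real (c s))"

text \<open>Norm at most one rather than equal to one, because a coordinate vector whose index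
  exceeds \<open>N\<close> is zero.\<close>

definition contraction :: "nat \<Rightarrow> (nat \<Rightarrow> real) \<Rightarrow> bool" where
  "contraction N a \<longleftrightarrow> (\<Sum>r<N. (a r)\<^sup>2) \<le> 1"

lemma norm_sum_mult_sq_le:
  fixes y :: "'b \<Rightarrow> complex" and c :: "'b \<Rightarrow> real"
  shows "(norm (\<Sum>s\<in>A. y s * of_real (c s)))\<^sup>2 \<le> (\<Sum>s\<in>A. (norm (y s))\<^sup>2) * (\<Sum>s\<in>A. (c s)\<^sup>2)"
proof -
  have "norm (\<Sum>s\<in>A. y s * of_real (c s)) \<le> (\<Sum>s\<in>A. norm (y s) * \<bar>c s\<bar>)"
    by (rule order_trans[OF norm_sum]) (simp add: norm_mult)
  then have "(norm (\<Sum>s\<in>A. y s * of_real (c s)))\<^sup>2 \<le> (\<Sum>s\<in>A. norm (y s) * \<bar>c s\<bar>)\<^sup>2"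
    by (intro power_mono) auto
  also have "\<dots> \<le> (\<Sum>s\<in>A. (norm (y s))\<^sup>2) * (\<Sum>s\<in>A. \<bar>c s\<bar>\<^sup>2)"
    by (rule Cauchy_Schwarz_ineq_sum)
  finally show ?thesis by simp
qed

text \<open>Cauchy-Schwarz for the row vector y = a B, whose squared norm is the form of B B* at
  a.\<close>

lemma qform_sq_le:
  assumes c: "contraction N c"
    and B': "\<And>r r'. r < N \<Longrightarrow> r' < N \<Longrightarrow> B' r r' = (\<Sum>s<N. B r s * cnj (B r' s))"
  shows "(norm (qform N a B c))\<^sup>2 \<le> Re (qform N a B' a)"
proof -
  define y where "y = (\<lambda>s. \<Sum>r<N. of_real (a r) * B r s)"
  have "qform N a B c = (\<Sum>s<N. y s * of_real (c s))"
    unfolding qform_def y_def sum_distrib_right by (rule sum.swap)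
  then have "(norm (qform N a B c))\<^sup>2 \<le> (\<Sum>s<N. (norm (y s))\<^sup>2) * (\<Sum>s<N. (c s)\<^sup>2)"
    using norm_sum_mult_sq_le[of y c "{..<N}"] by simp
  also have "\<dots> \<le> (\<Sum>s<N. (norm (y s))\<^sup>2) * 1"
    using c unfolding contraction_def by (intro mult_left_mono sum_nonneg) auto
  also have "\<dots> = Re (\<Sum>s<N. y s * cnj (y s))"
    unfolding complex_norm_square[symmetric] by simp
  also have "(\<Sum>s<N. y s * cnj (y s)) = (\<Sum>s<N. \<Sum>r<N. \<Sum>r'<N. of_real (a r) * (B r s * cnj (B r' s)) * of_real (a r'))"
    unfolding y_def cnj_sum sum_product by (simp add: mult_ac)
  also have "\<dots> = (\<Sum>r<N. \<Sum>s<N. \<Sum>r'<N. of_real (a r) * (B r s * cnj (B r' s)) * of_real (a r'))"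
    by (rule sum.swap)
  also have "\<dots> = (\<Sum>r<N. \<Sum>r'<N. \<Sum>s<N. of_real (a r) * (B r s * cnj (B r' s)) * of_real (a r'))"
    by (intro sum.cong refl sum.swap)
  also have "\<dots> = qform N a B' a"
    unfolding qform_def by (intro sum.cong refl) (simp add: B' sum_distrib_left sum_distrib_right)
  finally show ?thesis .
qed

lemma trace_moment_nonneg: "v > 0 \<Longrightarrow> trace_moment v N b m \<ge> 0"
  unfolding trace_moment_def by (intro mult_nonneg_nonneg zero_le_power of_nat_0_le_iff) simp

lemma trace_moment_le:
  assumes "v > 0" "N > 0"
  shows "trace_moment v N b m \<le> real (card (pairings {..<m})) * v ^ (m div 2)"
proof -
  define x where "x = real (band_width N b) ^ (m div 2)"
  have x: "x > 0" using band_width_pos[OF assms(2)] by (simp add: x_def)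
  have "(\<Sum>\<pi>\<in>pairings {..<m}. card (step_solutions N b m \<pi>)) \<le> card (pairings {..<m}) * band_width N b ^ (m div 2)"
    using sum_bounded_above[of "pairings {..<m}" "\<lambda>\<pi>. card (step_solutions N b m \<pi>)" "band_width N b ^ (m div 2)"]
      walk_pairing.card_solutions_le[OF walk_pairing.intro] by simp
  then have "real (\<Sum>\<pi>\<in>pairings {..<m}. card (step_solutions N b m \<pi>)) \<le> real (card (pairings {..<m})) * x"
    unfolding x_def by (metis of_nat_le_iff of_nat_mult of_nat_power)
  then have "trace_moment v N b m \<le> v ^ (m div 2) / x * (real (card (pairings {..<m})) * x)"
    unfolding trace_moment_def power_divide x_def[symmetric]
    using assms x by (intro mult_left_mono) auto
  then show ?thesis using x by (simp add: mult.commute)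
qed

context prob_space
begin

text \<open>As the two second moments have a common bound, the pointwise estimate by (|Y|^2 + |Z|^2)
  / 2 can replace Cauchy-Schwarz.\<close>

lemma expectation_mult_cnj_le:
  assumes Y: "all_moments Y" and Z: "all_moments Z"
    and "expectation (\<lambda>\<omega>. (norm (Y \<omega>))\<^sup>2) \<le> C" "expectation (\<lambda>\<omega>. (norm (Z \<omega>))\<^sup>2) \<le> C"
  shows "norm (expectation (\<lambda>\<omega>. Y \<omega> * cnj (Z \<omega>))) \<le> C"
proof -
  have i: "integrable M (\<lambda>\<omega>. (norm (Y \<omega>))\<^sup>2)" "integrable M (\<lambda>\<omega>. (norm (Z \<omega>))\<^sup>2)"
    using all_moments_power[OF Y] all_moments_power[OF Z] by auto
  have p: "integrable M (\<lambda>\<omega>. Y \<omega> * cnj (Z \<omega>))"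
    by (intro all_moments_integrable all_moments_mult all_moments_cnj Y Z)
  have "norm (expectation (\<lambda>\<omega>. Y \<omega> * cnj (Z \<omega>))) \<le> expectation (\<lambda>\<omega>. norm (Y \<omega> * cnj (Z \<omega>)))"
    by (rule integral_norm_bound)
  also have "\<dots> \<le> expectation (\<lambda>\<omega>. ((norm (Y \<omega>))\<^sup>2 + (norm (Z \<omega>))\<^sup>2) / 2)"
  proof (rule integral_mono)
    show "integrable M (\<lambda>\<omega>. norm (Y \<omega> * cnj (Z \<omega>)))" using p by simp
    show "integrable M (\<lambda>\<omega>. ((norm (Y \<omega>))\<^sup>2 + (norm (Z \<omega>))\<^sup>2) / 2)" using i by simp
    fix \<omega>
    have "0 \<le> (norm (Y \<omega>) - norm (Z \<omega>))\<^sup>2" by simp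
    then show "norm (Y \<omega> * cnj (Z \<omega>)) \<le> ((norm (Y \<omega>))\<^sup>2 + (norm (Z \<omega>))\<^sup>2) / 2"
      by (simp add: norm_mult power2_diff)
  qed
  also have "\<dots> = (expectation (\<lambda>\<omega>. (norm (Y \<omega>))\<^sup>2) + expectation (\<lambda>\<omega>. (norm (Z \<omega>))\<^sup>2)) / 2"
    using i by simp
  also have "\<dots> \<le> C" using assms(3,4) by simp
  finally show ?thesis .
qed

end

context banded_gue
begin

lemma qform_all_moments: "all_moments (\<lambda>\<omega>. qform N a (mp m \<omega>) c)"
  unfolding qform_def
  by (intro all_moments_sum all_moments_mult all_moments_const mp_all_moments) auto

lemma AE_mp_hermitian: "AE \<omega> in M. \<forall>m. \<forall>j<N. \<forall>k<N. mp m \<omega> k j = cnj (mp m \<omega> j k)"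
  using Xi_hermitian
proof eventually_elim
  case (elim \<omega>)
  then have "\<And>r s. r < N \<Longrightarrow> s < N \<Longrightarrow> Xi \<omega> s r = cnj (Xi \<omega> r s)" by blast
  then show ?case using mpow_hermitian[of N "Xi \<omega>"] by blast
qed

text \<open>Iteration of |<a, B c>|^2 \<le> <a, B^2 a> for self-adjoint B. After the first round
  both vectors are \<open>a\<close>, so every further squaring only doubles the power of the
  matrix.\<close>

lemma AE_qform_power_le:
  assumes a: "contraction N a" and c: "contraction N c"
  shows "AE \<omega> in M. \<forall>q. norm (qform N a (mp m \<omega>) c) ^ (2 ^ Suc q) \<le> Re (qform N a (mp (2 ^ Suc q * m) \<omega>) a)"
  using AE_mp_hermitian
proof eventually_elim
  case (elim \<omega>)
  have sq: "(norm (qform N a (mp m \<omega>) c))\<^sup>2 \<le> Re (qform N a (mp (2 * m) \<omega>) a)" if "contraction N c" for m c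
  proof (rule qform_sq_le[OF that])
    fix r r' assume r: "r < N" "r' < N"
    have "mp (2 * m) \<omega> r r' = (\<Sum>s<N. mp m \<omega> r s * mp m \<omega> s r')"
      using mpow_add[OF r(2), of "Xi \<omega>" m m r] by (simp add: mult_2)
    also have "\<dots> = (\<Sum>s<N. mp m \<omega> r s * cnj (mp m \<omega> r' s))"
    proof (rule sum.cong[OF refl])
      fix s assume "s \<in> {..<N}"
      then have "mp m \<omega> s r' = cnj (mp m \<omega> r' s)" using elim r by blast
      then show "mp m \<omega> r s * mp m \<omega> s r' = mp m \<omega> r s * cnj (mp m \<omega> r' s)" by simp
    qed
    finally show "mp (2 * m) \<omega> r r' = (\<Sum>s<N. mp m \<omega> r s * cnj (mp m \<omega> r' s))" .
  qed
  show ?case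
  proof
    fix q show "norm (qform N a (mp m \<omega>) c) ^ (2 ^ Suc q) \<le> Re (qform N a (mp (2 ^ Suc q * m) \<omega>) a)"
    proof (induction q)
      case 0
      show ?case using sq[OF c] by simp
    next
      case (Suc q)
      have "norm (qform N a (mp m \<omega>) c) ^ (2 ^ Suc (Suc q)) = (norm (qform N a (mp m \<omega>) c) ^ (2 ^ Suc q))\<^sup>2"
        by (simp add: power_mult[symmetric] mult.commute)
      also have "\<dots> \<le> (Re (qform N a (mp (2 ^ Suc q * m) \<omega>) a))\<^sup>2"
        using Suc by (intro power_mono) auto
      also have "\<dots> \<le> (norm (qform N a (mp (2 ^ Suc q * m) \<omega>) a))\<^sup>2"
        by (simp add: cmod_power2)
      also have "\<dots> \<le> Re (qform N a (mp (2 * (2 ^ Suc q * m)) \<omega>) a)" by (rule sq[OF a])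
      finally show ?case by (simp add: mult.assoc)
    qed
  qed
qed

lemma expectation_qform:
  "expectation (\<lambda>\<omega>. qform N a (mp m \<omega>) c) = of_real (trace_moment v N b m * (\<Sum>r<N. a r * c r))"
proof -
  have "expectation (\<lambda>\<omega>. qform N a (mp m \<omega>) c) =
    (\<Sum>r<N. \<Sum>s<N. of_real (a r) * expectation (\<lambda>\<omega>. mp m \<omega> r s) * of_real (c s))"
    unfolding qform_def
    by (subst Bochner_Integration.integral_sum,
        intro all_moments_integrable all_moments_sum all_moments_mult all_moments_const mp_all_moments, simp, simp,
        intro sum.cong refl, subst Bochner_Integration.integral_sum,
        intro all_moments_integrable all_moments_mult all_moments_const mp_all_moments, simp, simp, simp)
  also have "\<dots> = (\<Sum>r<N. \<Sum>s<N. if r = s then of_real (a r * trace_moment v N b m * c r) else 0)"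
    by (intro sum.cong refl) (auto simp: expectation_mp)
  also have "\<dots> = of_real (trace_moment v N b m * (\<Sum>r<N. a r * c r))"
    by (simp add: sum.delta' sum_distrib_left mult_ac)
  finally show ?thesis .
qed

text \<open>A power with exponent \<open>p\<close> is at most 1 plus the one with exponent
  \<open>2 ^ Suc p\<close>, which a single form at \<open>a\<close> dominates. Its mean is known
  exactly and is bounded uniformly in \<open>N\<close> by \<open>trace_moment_le\<close>.\<close>

lemma expectation_qform_power_le:
  assumes a: "contraction N a" and c: "contraction N c"
  shows "expectation (\<lambda>\<omega>. norm (qform N a (mp m \<omega>) c) ^ p) \<le> 1 + trace_moment v N b (2 ^ Suc p * m)"
proof -
  let ?Y = "\<lambda>\<omega>. norm (qform N a (mp m \<omega>) c)"
  let ?Z = "\<lambda>\<omega>. qform N a (mp (2 ^ Suc p * m) \<omega>) a"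
  have iY: "integrable M (\<lambda>\<omega>. ?Y \<omega> ^ k)" for k using all_moments_power[OF qform_all_moments] .
  have iZ: "integrable M ?Z" by (rule all_moments_integrable[OF qform_all_moments])
  have "p < 2 ^ p" by (rule less_exp)
  then have p2: "p \<le> 2 ^ Suc p" unfolding power_Suc by linarith
  have "expectation (\<lambda>\<omega>. ?Y \<omega> ^ p) \<le> expectation (\<lambda>\<omega>. 1 + Re (?Z \<omega>))"
  proof (rule integral_mono_AE)
    show "integrable M (\<lambda>\<omega>. 1 + Re (?Z \<omega>))" using iZ by simp
    show "AE \<omega> in M. ?Y \<omega> ^ p \<le> 1 + Re (?Z \<omega>)"
      using AE_qform_power_le[OF a c, of m]
    proof eventually_elim
      case (elim \<omega>)
      have "?Y \<omega> ^ p \<le> 1 + ?Y \<omega> ^ (2 ^ Suc p)"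
      proof (cases "?Y \<omega> \<le> 1")
        case True
        then have "?Y \<omega> ^ p \<le> 1" by (intro power_le_one) auto
        then show ?thesis by (simp add: add_increasing2)
      next
        case False
        then have "?Y \<omega> ^ p \<le> ?Y \<omega> ^ (2 ^ Suc p)" by (intro power_increasing p2) auto
        then show ?thesis by simp
      qed
      then show ?case using elim[rule_format, of p] by linarith
    qed
  qed (rule iY)
  also have "\<dots> = 1 + expectation (\<lambda>\<omega>. Re (?Z \<omega>))" using iZ by (simp add: prob_space)
  also have "expectation (\<lambda>\<omega>. Re (?Z \<omega>)) = Re (expectation ?Z)" using iZ by simp
  also have "\<dots> = trace_moment v N b (2 ^ Suc p * m) * (\<Sum>r<N. (a r)\<^sup>2)"
    unfolding expectation_qform by (simp add: power2_eq_square)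
  also have "\<dots> \<le> trace_moment v N b (2 ^ Suc p * m) * 1"
    using a trace_moment_nonneg[OF v_pos] unfolding contraction_def by (intro mult_left_mono) auto
  finally show ?thesis by simp
qed

definition centred :: "nat \<Rightarrow> nat \<Rightarrow> nat \<Rightarrow> 'a \<Rightarrow> complex" where
  "centred m r s \<omega> = mp m \<omega> r s - (if r = s then of_real (trace_moment v N b m) else 0)"

lemma centred_all_moments: "r < N \<Longrightarrow> s < N \<Longrightarrow> all_moments (centred m r s)"
  unfolding centred_def by (intro all_moments_diff all_moments_const mp_all_moments)

text \<open>Almost surely, conjugating an entry swaps its indices. This produces the products
  treated in \<open>expectation_mp_prod_eq_0\<close> and \<open>covariance_bound\<close>.\<close>

lemma expectation_centred_mult:
  assumes "r < N" "s < N" "r' < N" "s' < N"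
  shows "expectation (\<lambda>\<omega>. centred m r s \<omega> * cnj (centred m r' s' \<omega>)) =
    expectation (\<lambda>\<omega>. mp m \<omega> r s * mp m \<omega> s' r') - expectation (\<lambda>\<omega>. mp m \<omega> r s) * expectation (\<lambda>\<omega>. mp m \<omega> s' r')"
proof -
  define t where "t = (\<lambda>(r::nat) s. if r = s then complex_of_real (trace_moment v N b m) else 0)"
  have tc: "cnj (t r' s') = t s' r'" by (simp add: t_def)
  have "expectation (\<lambda>\<omega>. centred m r s \<omega> * cnj (centred m r' s' \<omega>)) =
    expectation (\<lambda>\<omega>. (mp m \<omega> r s - t r s) * (mp m \<omega> s' r' - t s' r'))"
  proof (rule integral_cong_AE)
    show "(\<lambda>\<omega>. centred m r s \<omega> * cnj (centred m r' s' \<omega>)) \<in> borel_measurable M"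
      by (intro all_moments_measurable all_moments_mult all_moments_cnj centred_all_moments assms)
    show "(\<lambda>\<omega>. (mp m \<omega> r s - t r s) * (mp m \<omega> s' r' - t s' r')) \<in> borel_measurable M"
      by (intro all_moments_measurable all_moments_mult all_moments_diff all_moments_const mp_all_moments assms)
    show "AE \<omega> in M. centred m r s \<omega> * cnj (centred m r' s' \<omega>) = (mp m \<omega> r s - t r s) * (mp m \<omega> s' r' - t s' r')"
      using AE_mp_hermitian
    proof eventually_elim
      case (elim \<omega>)
      then have "mp m \<omega> s' r' = cnj (mp m \<omega> r' s')" using assms by blast
      then show ?case unfolding centred_def by (simp add: tc[symmetric]) (simp add: t_def)
    qed
  qed
  also have "\<dots> = expectation (\<lambda>\<omega>. mp m \<omega> r s * mp m \<omega> s' r' - t r s * mp m \<omega> s' r' - mp m \<omega> r s * t s' r' + t r s * t s' r')"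
    by (simp add: algebra_simps)
  also have "\<dots> = expectation (\<lambda>\<omega>. mp m \<omega> r s * mp m \<omega> s' r') - t r s * expectation (\<lambda>\<omega>. mp m \<omega> s' r')
      - expectation (\<lambda>\<omega>. mp m \<omega> r s) * t s' r' + t r s * t s' r'"
  proof -
    have i: "integrable M (\<lambda>\<omega>. mp m \<omega> r s * mp m \<omega> s' r')" "integrable M (\<lambda>\<omega>. mp m \<omega> s' r')" "integrable M (\<lambda>\<omega>. mp m \<omega> r s)"
      by (intro all_moments_integrable all_moments_mult mp_all_moments assms)+
    then show ?thesis by (simp add: prob_space)
  qed
  also have "\<dots> = expectation (\<lambda>\<omega>. mp m \<omega> r s * mp m \<omega> s' r') - expectation (\<lambda>\<omega>. mp m \<omega> r s) * expectation (\<lambda>\<omega>. mp m \<omega> s' r')"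
    unfolding expectation_mp[OF assms(1,2)] expectation_mp[OF assms(4,3)] by (simp add: t_def)
  finally show ?thesis .
qed

definition cov_bound :: "nat \<Rightarrow> real" where
  "cov_bound m = real (card (pairings {..<2 * m})) * v ^ m / real (band_width N b)"

lemma expectation_centred_sq:
  assumes "r < N" "s < N"
  shows "expectation (\<lambda>\<omega>. (norm (centred m r s \<omega>))\<^sup>2) \<le> cov_bound m"
proof -
  have "expectation (\<lambda>\<omega>. (norm (centred m r s \<omega>))\<^sup>2) = Re (of_real (expectation (\<lambda>\<omega>. (norm (centred m r s \<omega>))\<^sup>2)))"
    by simp
  also have "\<dots> \<le> norm (complex_of_real (expectation (\<lambda>\<omega>. (norm (centred m r s \<omega>))\<^sup>2)))"
    by (rule complex_Re_le_cmod)
  also have "complex_of_real (expectation (\<lambda>\<omega>. (norm (centred m r s \<omega>))\<^sup>2)) =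
      expectation (\<lambda>\<omega>. centred m r s \<omega> * cnj (centred m r s \<omega>))"
    unfolding integral_complex_of_real[symmetric] complex_norm_square ..
  also have "norm \<dots> \<le> cov_bound m"
    unfolding expectation_centred_mult[OF assms assms] cov_bound_def by (rule covariance_bound[OF assms])
  finally show ?thesis .
qed

text \<open>By the balance of row and column indices, the covariance of two entries vanishes unless their indices are paired, so only
  \<open>O(N\<^sup>2)\<close> of the \<open>N\<^sup>4\<close> terms survive.\<close>

lemma variance_qform:
  assumes a: "contraction N a" and c: "contraction N c"
  shows "expectation (\<lambda>\<omega>. (norm (qform N a (mp m \<omega>) c - of_real (trace_moment v N b m * (\<Sum>r<N. a r * c r))))\<^sup>2)
    \<le> 2 * cov_bound m"
proof -
  define C where "C = cov_bound m"
  have C: "C \<ge> 0" using v_pos by (simp add: C_def cov_bound_def)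
  define K where "K = (\<lambda>r s r' s'. expectation (\<lambda>\<omega>. centred m r s \<omega> * cnj (centred m r' s' \<omega>)))"
  define D where "D = (\<lambda>\<omega>. \<Sum>r<N. \<Sum>s<N. of_real (a r * c s) * centred m r s \<omega>)"
  have D: "qform N a (mp m \<omega>) c - of_real (trace_moment v N b m * (\<Sum>r<N. a r * c r)) = D \<omega>" for \<omega>
  proof -
    have "(\<Sum>r<N. \<Sum>s<N. of_real (a r * c s) * (if r = s then complex_of_real (trace_moment v N b m) else 0)) =
      of_real (trace_moment v N b m * (\<Sum>r<N. a r * c r))"
      by (simp add: if_distrib[of "\<lambda>x. _ * x"] sum.delta' sum_distrib_left mult_ac cong: if_cong)
    then show ?thesis
      unfolding D_def centred_def qform_def by (simp add: right_diff_distrib sum_subtractf mult_ac)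
  qed
  have Dam: "all_moments D" unfolding D_def
    by (intro all_moments_sum all_moments_mult all_moments_const centred_all_moments) auto
  \<comment> \<open>Two diagonal entries, or twice the same entry: in all other cases the covariance
    is 0.\<close>
  have Kle: "norm (K r s r' s') \<le> (if r = s \<and> r' = s' then C else 0) + (if r = r' \<and> s = s' then C else 0)"
    if "r < N" "s < N" "r' < N" "s' < N" for r s r' s'
  proof (cases "(r = s \<and> r' = s') \<or> (r = r' \<and> s = s')")
    case True
    have "norm (K r s r' s') \<le> C" unfolding K_def C_def
      using that by (intro expectation_mult_cnj_le centred_all_moments expectation_centred_sq)
    then show ?thesis using True C by auto
  next
    case False
    have "K r s r' s' = 0"
    proof -
      have "expectation (\<lambda>\<omega>. mp m \<omega> r s * mp m \<omega> s' r') = 0"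
        using that False by (intro expectation_mp_prod_eq_0) auto
      then show ?thesis unfolding K_def expectation_centred_mult[OF that]
        using False expectation_mp[OF that(1,2), of m] expectation_mp[OF that(4,3), of m] by auto
    qed
    then show ?thesis using C by simp
  qed
  have "complex_of_real (expectation (\<lambda>\<omega>. (norm (D \<omega>))\<^sup>2)) = expectation (\<lambda>\<omega>. D \<omega> * cnj (D \<omega>))"
    unfolding integral_complex_of_real[symmetric] complex_norm_square ..
  also have "\<dots> = expectation (\<lambda>\<omega>. \<Sum>r<N. \<Sum>s<N. \<Sum>r'<N. \<Sum>s'<N.
      of_real (a r * c s * (a r' * c s')) * (centred m r s \<omega> * cnj (centred m r' s' \<omega>)))"
  proof -
    have in1: "x * cnj (D \<omega>) = (\<Sum>r'<N. \<Sum>s'<N. x * cnj (of_real (a r' * c s') * centred m r' s' \<omega>))" for x \<omega>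
      unfolding D_def by (simp add: cnj_sum sum_distrib_left)
    have "D \<omega> * cnj (D \<omega>) = (\<Sum>r<N. \<Sum>s<N. of_real (a r * c s) * centred m r s \<omega> * cnj (D \<omega>))" for \<omega>
      by (subst (1) D_def) (simp only: sum_distrib_right)
    then show ?thesis unfolding in1 by (simp add: mult_ac)
  qed
  also have "\<dots> = (\<Sum>r<N. \<Sum>s<N. \<Sum>r'<N. \<Sum>s'<N. of_real (a r * c s * (a r' * c s')) * K r s r' s')"
  proof -
    have am: "all_moments (\<lambda>\<omega>. of_real (a r * c s * (a r' * c s')) * (centred m r s \<omega> * cnj (centred m r' s' \<omega>)))"
      if "r < N" "s < N" "r' < N" "s' < N" for r s r' s'
      using that by (intro all_moments_mult all_moments_const all_moments_cnj centred_all_moments)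
    have E: "expectation (\<lambda>\<omega>. \<Sum>x<N. Y x \<omega>) = (\<Sum>x<N. expectation (Y x))" if "\<And>x. x < N \<Longrightarrow> all_moments (Y x)"
      for Y :: "nat \<Rightarrow> 'a \<Rightarrow> complex"
      using that by (intro Bochner_Integration.integral_sum all_moments_integrable) auto
    have "expectation (\<lambda>\<omega>. \<Sum>r<N. \<Sum>s<N. \<Sum>r'<N. \<Sum>s'<N.
        of_real (a r * c s * (a r' * c s')) * (centred m r s \<omega> * cnj (centred m r' s' \<omega>))) =
      (\<Sum>r<N. \<Sum>s<N. \<Sum>r'<N. \<Sum>s'<N.
        expectation (\<lambda>\<omega>. of_real (a r * c s * (a r' * c s')) * (centred m r s \<omega> * cnj (centred m r' s' \<omega>))))"
      apply (subst E)
       apply (intro all_moments_sum am; simp)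
      apply (rule sum.cong[OF refl])
      apply (subst E)
       apply (intro all_moments_sum am; simp)
      apply (rule sum.cong[OF refl])
      apply (subst E)
       apply (intro all_moments_sum am; simp)
      apply (rule sum.cong[OF refl])
      apply (subst E)
       apply (intro all_moments_sum am; simp)
      apply (rule refl)
      done
    then show ?thesis by (simp add: K_def)
  qed
  finally have E: "complex_of_real (expectation (\<lambda>\<omega>. (norm (D \<omega>))\<^sup>2)) = \<dots>" .
  have "expectation (\<lambda>\<omega>. (norm (D \<omega>))\<^sup>2) \<le> norm (complex_of_real (expectation (\<lambda>\<omega>. (norm (D \<omega>))\<^sup>2)))"
    by simp
  also have "\<dots> \<le> (\<Sum>r<N. \<Sum>s<N. \<Sum>r'<N. \<Sum>s'<N. \<bar>a r * c s * (a r' * c s')\<bar> *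
      ((if r = s \<and> r' = s' then C else 0) + (if r = r' \<and> s = s' then C else 0)))"
    unfolding E
    by (intro sum_norm_le, unfold norm_mult norm_of_real, intro mult_left_mono Kle abs_ge_zero; simp)
  also have "\<dots> = (\<Sum>r<N. \<Sum>s<N. \<Sum>r'<N. \<Sum>s'<N. \<bar>a r * c s * (a r' * c s')\<bar> * (if r = s \<and> r' = s' then C else 0)) +
      (\<Sum>r<N. \<Sum>s<N. \<Sum>r'<N. \<Sum>s'<N. \<bar>a r * c s * (a r' * c s')\<bar> * (if r = r' \<and> s = s' then C else 0))"
    by (simp only: distrib_left sum.distrib)
  also have "(\<Sum>r<N. \<Sum>s<N. \<Sum>r'<N. \<Sum>s'<N. \<bar>a r * c s * (a r' * c s')\<bar> * (if r = s \<and> r' = s' then C else 0)) =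
      (\<Sum>r<N. \<Sum>r'<N. \<bar>a r * c r * (a r' * c r')\<bar> * C)"
  proof (rule sum.cong[OF refl])
    fix r assume r: "r \<in> {..<N}"
    have "(\<Sum>s<N. \<Sum>r'<N. \<Sum>s'<N. \<bar>a r * c s * (a r' * c s')\<bar> * (if r = s \<and> r' = s' then C else 0)) =
      (\<Sum>s<N. if r = s then \<Sum>r'<N. \<Sum>s'<N. if r' = s' then \<bar>a r * c s * (a r' * c s')\<bar> * C else 0 else 0)"
      by (rule sum.cong[OF refl]) (simp add: if_distrib[of "\<lambda>x. _ * x"] cong: if_cong)
    then show "(\<Sum>s<N. \<Sum>r'<N. \<Sum>s'<N. \<bar>a r * c s * (a r' * c s')\<bar> * (if r = s \<and> r' = s' then C else 0)) =
      (\<Sum>r'<N. \<bar>a r * c r * (a r' * c r')\<bar> * C)"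
      using r by (simp add: sum.delta')
  qed
  also have "\<dots> = C * (\<Sum>r<N. \<bar>a r\<bar> * \<bar>c r\<bar>)\<^sup>2"
    by (simp add: power2_eq_square sum_product sum_distrib_left abs_mult mult_ac)
  also have "(\<Sum>r<N. \<Sum>s<N. \<Sum>r'<N. \<Sum>s'<N. \<bar>a r * c s * (a r' * c s')\<bar> * (if r = r' \<and> s = s' then C else 0)) =
      (\<Sum>r<N. \<Sum>s<N. \<bar>a r * c s * (a r * c s)\<bar> * C)"
  proof (intro sum.cong refl)
    fix r s assume rs: "r \<in> {..<N}" "s \<in> {..<N}"
    have "(\<Sum>r'<N. \<Sum>s'<N. \<bar>a r * c s * (a r' * c s')\<bar> * (if r = r' \<and> s = s' then C else 0)) =
      (\<Sum>r'<N. if r = r' then \<Sum>s'<N. if s = s' then \<bar>a r * c s * (a r' * c s')\<bar> * C else 0 else 0)"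
      by (rule sum.cong[OF refl]) (simp add: if_distrib[of "\<lambda>x. _ * x"] cong: if_cong)
    then show "(\<Sum>r'<N. \<Sum>s'<N. \<bar>a r * c s * (a r' * c s')\<bar> * (if r = r' \<and> s = s' then C else 0)) =
      \<bar>a r * c s * (a r * c s)\<bar> * C"
      using rs by (simp add: sum.delta')
  qed
  also have "\<dots> = C * ((\<Sum>r<N. (a r)\<^sup>2) * (\<Sum>s<N. (c s)\<^sup>2))"
    by (subst sum_product) (simp add: power2_eq_square sum_distrib_left abs_mult mult_ac)
  \<comment> \<open>Both patterns contribute at most \<open>C\<close>, since the vectors have norm
    at most one; this is the origin of the factor 2.\<close>
  also have "C * (\<Sum>r<N. \<bar>a r\<bar> * \<bar>c r\<bar>)\<^sup>2 + C * ((\<Sum>r<N. (a r)\<^sup>2) * (\<Sum>s<N. (c s)\<^sup>2)) \<le> C * 1 + C * 1"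
  proof (intro add_mono mult_left_mono C)
    have pr: "(\<Sum>r<N. (a r)\<^sup>2) * (\<Sum>s<N. (c s)\<^sup>2) \<le> 1 * 1"
      using a c unfolding contraction_def by (intro mult_mono) (auto intro: sum_nonneg)
    then show "(\<Sum>r<N. (a r)\<^sup>2) * (\<Sum>s<N. (c s)\<^sup>2) \<le> 1" by simp
    have "(\<Sum>r<N. \<bar>a r\<bar> * \<bar>c r\<bar>)\<^sup>2 \<le> (\<Sum>r<N. \<bar>a r\<bar>\<^sup>2) * (\<Sum>r<N. \<bar>c r\<bar>\<^sup>2)"
      by (rule Cauchy_Schwarz_ineq_sum)
    then show "(\<Sum>r<N. \<bar>a r\<bar> * \<bar>c r\<bar>)\<^sup>2 \<le> 1" using pr by simp
  qed
  finally show ?thesis unfolding D C_def by simp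
qed

end

section \<open>Convergence of all moments\<close>

text \<open>For fixed \<open>\<epsilon>\<close> the limit in \<open>N\<close> removes
  \<open>A\<close> and \<open>B\<close>; afterwards \<open>\<epsilon>\<close> is made small against
  the uniform bound \<open>C\<close>.\<close>

lemma tendsto_0_of_eps:
  fixes f A B :: "nat \<Rightarrow> real"
  assumes "\<And>\<epsilon>. \<epsilon> > 0 \<Longrightarrow> \<forall>\<^sub>F N in sequentially. 0 \<le> f N \<and> f N \<le> A N / \<epsilon> + \<epsilon> * C + B N"
    and "A \<longlonglongrightarrow> 0" "B \<longlonglongrightarrow> 0" "C \<ge> 0"
  shows "f \<longlonglongrightarrow> 0"
proof (rule order_tendstoI)
  fix x :: real assume "x < 0"
  then show "\<forall>\<^sub>F N in sequentially. x < f N" using assms(1)[of 1] by (auto elim: eventually_mono)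
next
  fix x :: real assume x: "0 < x"
  define \<epsilon> where "\<epsilon> = x / (3 * (C + 1))"
  have \<epsilon>: "\<epsilon> > 0" "\<epsilon> * C < x / 2"
  proof -
    have "0 \<le> C * x" using x assms(4) by simp
    then have "0 < C * x + x * 3" using x by linarith
    then show "\<epsilon> > 0" "\<epsilon> * C < x / 2"
      using x assms(4) by (auto simp: \<epsilon>_def field_simps)
  qed
  have "(\<lambda>N. A N / \<epsilon> + B N) \<longlonglongrightarrow> 0 / \<epsilon> + 0" using \<epsilon> by (intro tendsto_intros assms) auto
  then have "\<forall>\<^sub>F N in sequentially. A N / \<epsilon> + B N < x / 2" using x by (intro order_tendstoD) auto
  then show "\<forall>\<^sub>F N in sequentially. f N < x"
    using assms(1)[OF \<epsilon>(1)] by eventually_elim (use \<epsilon>(2) in linarith)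
qed

lemma norm_add_power_le:
  fixes x y :: complex
  shows "norm (x + y) ^ p \<le> 2 ^ p * (norm x ^ p + norm y ^ p)"
proof -
  have "norm (x + y) ^ p \<le> (2 * max (norm x) (norm y)) ^ p"
    using norm_triangle_ineq[of x y] by (intro power_mono) auto
  also have "\<dots> \<le> 2 ^ p * (norm x ^ p + norm y ^ p)"
    unfolding power_mult_distrib by (intro mult_left_mono) (auto simp: max_def)
  finally show ?thesis .
qed

text \<open>Young's inequality with weights: the factor that is merely bounded receives the small
  weight.\<close>

lemma mult_le_eps:
  fixes x y :: real
  assumes "\<epsilon> > 0"
  shows "x * y \<le> x\<^sup>2 / \<epsilon> + \<epsilon> * y\<^sup>2"
proof -
  have "0 \<le> (x - \<epsilon> * y)\<^sup>2 + x\<^sup>2 + (\<epsilon> * y)\<^sup>2" by simp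
  then have "2 * (\<epsilon> * (x * y)) \<le> 2 * (x\<^sup>2 + \<epsilon>\<^sup>2 * y\<^sup>2)"
    by (simp add: power2_diff power_mult_distrib algebra_simps)
  then have "\<epsilon> * (x * y) \<le> \<epsilon> * (x\<^sup>2 / \<epsilon> + \<epsilon> * y\<^sup>2)"
    using assms by (simp add: distrib_left power2_eq_square)
  then show ?thesis using assms by simp
qed

locale prob_sequence =
  fixes M :: "nat \<Rightarrow> 'w measure"
  assumes prob: "N > 0 \<Longrightarrow> prob_space (M N)"
begin

text \<open>Convergence to a constant in every \<open>L^p\<close>, expressed by integrals because
  the probability space changes with \<open>N\<close>. Unlike convergence in one fixed
  \<open>L^p\<close>, it passes to products.\<close>

definition conv_moments :: "(nat \<Rightarrow> 'w \<Rightarrow> complex) \<Rightarrow> complex \<Rightarrow> bool" where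
  "conv_moments Y y \<longleftrightarrow> (\<forall>N>0. prob_space.all_moments (M N) (Y N)) \<and>
     (\<forall>p>0. (\<lambda>N. \<integral>\<omega>. norm (Y N \<omega> - y) ^ p \<partial>M N) \<longlonglongrightarrow> 0)"

lemma conv_moments_am: "conv_moments Y y \<Longrightarrow> N > 0 \<Longrightarrow> prob_space.all_moments (M N) (Y N)"
  by (simp add: conv_moments_def)

text \<open>The p-th power of |Y - y| is |Y - y| times its (p - 1)-st power. In
  \<open>mult_le_eps\<close> the first factor is small in mean square and the second has bounded
  second moments.\<close>

lemma conv_moments_I:
  assumes am: "\<And>N. N > 0 \<Longrightarrow> prob_space.all_moments (M N) (Y N)"
    and L2: "(\<lambda>N. \<integral>\<omega>. (norm (Y N \<omega> - y))\<^sup>2 \<partial>M N) \<longlonglongrightarrow> 0"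
    and bd: "\<And>p. \<exists>C. \<forall>N>0. (\<integral>\<omega>. norm (Y N \<omega>) ^ p \<partial>M N) \<le> C"
  shows "conv_moments Y y"
  unfolding conv_moments_def
proof (intro conjI allI impI)
  fix p :: nat assume p: "p > 0"
  define q where "q = 2 * (p - 1)"
  obtain C where C: "\<And>N. N > 0 \<Longrightarrow> (\<integral>\<omega>. norm (Y N \<omega>) ^ q \<partial>M N) \<le> C"
    using bd[of q] by blast
  define D where "D = 2 ^ q * (max C 0 + norm y ^ q)"
  show "(\<lambda>N. \<integral>\<omega>. norm (Y N \<omega> - y) ^ p \<partial>M N) \<longlonglongrightarrow> 0"
  proof (rule tendsto_0_of_eps[OF _ L2, where B = "\<lambda>_. 0" and C = D])
    fix \<epsilon> :: real assume \<epsilon>: "\<epsilon> > 0"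
    show "\<forall>\<^sub>F N in sequentially. 0 \<le> (\<integral>\<omega>. norm (Y N \<omega> - y) ^ p \<partial>M N) \<and>
      (\<integral>\<omega>. norm (Y N \<omega> - y) ^ p \<partial>M N) \<le> (\<integral>\<omega>. (norm (Y N \<omega> - y))\<^sup>2 \<partial>M N) / \<epsilon> + \<epsilon> * D + 0"
      using eventually_gt_at_top[of 0]
    proof eventually_elim
      case (elim N)
      interpret prob_space "M N" by (rule prob[OF elim])
      have Dm: "all_moments (\<lambda>\<omega>. Y N \<omega> - y)" by (intro all_moments_diff all_moments_const am elim)
      note i = all_moments_power[OF Dm] all_moments_power[OF am[OF elim]]
      have "(\<integral>\<omega>. norm (Y N \<omega> - y) ^ p \<partial>M N) \<le> (\<integral>\<omega>. (norm (Y N \<omega> - y))\<^sup>2 / \<epsilon> + \<epsilon> * norm (Y N \<omega> - y) ^ q \<partial>M N)"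
      proof (rule integral_mono)
        show "integrable (M N) (\<lambda>\<omega>. (norm (Y N \<omega> - y))\<^sup>2 / \<epsilon> + \<epsilon> * norm (Y N \<omega> - y) ^ q)"
          using i by simp
        fix \<omega>
        have "norm (Y N \<omega> - y) ^ p = norm (Y N \<omega> - y) * norm (Y N \<omega> - y) ^ (p - 1)"
          using power_minus_mult[OF p, of "norm (Y N \<omega> - y)"] by (simp add: mult.commute)
        also have "\<dots> \<le> (norm (Y N \<omega> - y))\<^sup>2 / \<epsilon> + \<epsilon> * (norm (Y N \<omega> - y) ^ (p - 1))\<^sup>2"
          by (rule mult_le_eps[OF \<epsilon>])
        finally show "norm (Y N \<omega> - y) ^ p \<le> (norm (Y N \<omega> - y))\<^sup>2 / \<epsilon> + \<epsilon> * norm (Y N \<omega> - y) ^ q"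
          by (simp add: q_def power_mult[symmetric] mult.commute)
      qed (rule i)
      also have "\<dots> = (\<integral>\<omega>. (norm (Y N \<omega> - y))\<^sup>2 \<partial>M N) / \<epsilon> + \<epsilon> * (\<integral>\<omega>. norm (Y N \<omega> - y) ^ q \<partial>M N)"
        using i by simp
      also have "(\<integral>\<omega>. norm (Y N \<omega> - y) ^ q \<partial>M N) \<le> D"
      proof -
        have "(\<integral>\<omega>. norm (Y N \<omega> - y) ^ q \<partial>M N) \<le> (\<integral>\<omega>. 2 ^ q * (norm (Y N \<omega>) ^ q + norm y ^ q) \<partial>M N)"
        proof (rule integral_mono)
          fix \<omega> show "norm (Y N \<omega> - y) ^ q \<le> 2 ^ q * (norm (Y N \<omega>) ^ q + norm y ^ q)"
            using norm_add_power_le[of "Y N \<omega>" "- y" q] by simp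
        qed (use i in simp_all)
        also have "\<dots> = 2 ^ q * ((\<integral>\<omega>. norm (Y N \<omega>) ^ q \<partial>M N) + norm y ^ q)"
          using i by (simp add: prob_space)
        also have "\<dots> \<le> D" using C[OF elim] by (simp add: D_def)
        finally show ?thesis .
      qed
      finally show ?case using \<epsilon> by (simp add: mult_left_mono)
    qed
  qed (simp_all add: D_def)
qed (rule am)

text \<open>Y Z - y z = (Y - y) Z + y (Z - z). The first summand calls for
  \<open>mult_le_eps\<close>, as \<open>Z\<close> is bounded only in its moments.\<close>

lemma conv_moments_mult:
  assumes Y: "conv_moments Y y" and Z: "conv_moments Z z"
  shows "conv_moments (\<lambda>N \<omega>. Y N \<omega> * Z N \<omega>) (y * z)"
  unfolding conv_moments_def
proof (intro conjI allI impI)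
  show "prob_space.all_moments (M N) (\<lambda>\<omega>. Y N \<omega> * Z N \<omega>)" if "N > 0" for N
    using prob_space.all_moments_mult[OF prob[OF that]] conv_moments_am[OF Y that] conv_moments_am[OF Z that] by blast
  fix p :: nat assume p: "p > 0"
  have lim: "(\<lambda>N. \<integral>\<omega>. norm (Y N \<omega> - y) ^ q \<partial>M N) \<longlonglongrightarrow> 0" "(\<lambda>N. \<integral>\<omega>. norm (Z N \<omega> - z) ^ q \<partial>M N) \<longlonglongrightarrow> 0"
    if "q > 0" for q using Y Z that by (auto simp: conv_moments_def)
  have p2: "2 * p > 0" using p by simp
  define D where "D = 2 ^ p * (2 ^ (2 * p) * (1 + norm z ^ (2 * p)))"
  show "(\<lambda>N. \<integral>\<omega>. norm (Y N \<omega> * Z N \<omega> - y * z) ^ p \<partial>M N) \<longlonglongrightarrow> 0"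
  proof (rule tendsto_0_of_eps[where C = D])
    show "(\<lambda>N. 2 ^ p * (\<integral>\<omega>. norm (Y N \<omega> - y) ^ (2 * p) \<partial>M N)) \<longlonglongrightarrow> 0"
      using tendsto_mult_right_zero[OF lim(1)[OF p2]] .
    show "(\<lambda>N. 2 ^ p * norm y ^ p * (\<integral>\<omega>. norm (Z N \<omega> - z) ^ p \<partial>M N)) \<longlonglongrightarrow> 0"
      using tendsto_mult_right_zero[OF lim(2)[OF p]] .
    show "D \<ge> 0" by (simp add: D_def)
    fix \<epsilon> :: real assume \<epsilon>: "\<epsilon> > 0"
    \<comment> \<open>Convergence is used here only as an eventual bound, by 1; it bounds the
      moments of \<open>Z\<close> by the constant inside \<open>D\<close>.\<close>
    have "\<forall>\<^sub>F N in sequentially. (\<integral>\<omega>. norm (Z N \<omega> - z) ^ (2 * p) \<partial>M N) < 1"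
      using lim(2)[OF p2] by (rule order_tendstoD) simp
    then show "\<forall>\<^sub>F N in sequentially. 0 \<le> (\<integral>\<omega>. norm (Y N \<omega> * Z N \<omega> - y * z) ^ p \<partial>M N) \<and>
      (\<integral>\<omega>. norm (Y N \<omega> * Z N \<omega> - y * z) ^ p \<partial>M N) \<le>
      2 ^ p * (\<integral>\<omega>. norm (Y N \<omega> - y) ^ (2 * p) \<partial>M N) / \<epsilon> + \<epsilon> * D + 2 ^ p * norm y ^ p * (\<integral>\<omega>. norm (Z N \<omega> - z) ^ p \<partial>M N)"
      using eventually_gt_at_top[of 0]
    proof eventually_elim
      case (elim N)
      interpret prob_space "M N" by (rule prob[OF elim(2)])
      have Ym: "all_moments (Y N)" and Zm: "all_moments (Z N)"
        using conv_moments_am[OF Y elim(2)] conv_moments_am[OF Z elim(2)] .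
      have YD: "all_moments (\<lambda>\<omega>. Y N \<omega> - y)" and ZD: "all_moments (\<lambda>\<omega>. Z N \<omega> - z)"
        and P: "all_moments (\<lambda>\<omega>. Y N \<omega> * Z N \<omega> - y * z)"
        by (intro all_moments_diff all_moments_mult all_moments_const Ym Zm)+
      note i = all_moments_power[OF YD] all_moments_power[OF ZD] all_moments_power[OF P] all_moments_power[OF Zm]
      let ?a = "\<lambda>\<omega>. norm (Y N \<omega> - y)" and ?b = "\<lambda>\<omega>. norm (Z N \<omega> - z)" and ?c = "\<lambda>\<omega>. norm (Z N \<omega>)"
      have "(\<integral>\<omega>. norm (Y N \<omega> * Z N \<omega> - y * z) ^ p \<partial>M N) \<le>
        (\<integral>\<omega>. 2 ^ p * (?a \<omega> ^ (2 * p) / \<epsilon> + \<epsilon> * ?c \<omega> ^ (2 * p) + norm y ^ p * ?b \<omega> ^ p) \<partial>M N)"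
      proof (rule integral_mono)
        show "integrable (M N) (\<lambda>\<omega>. 2 ^ p * (?a \<omega> ^ (2 * p) / \<epsilon> + \<epsilon> * ?c \<omega> ^ (2 * p) + norm y ^ p * ?b \<omega> ^ p))"
          using i by simp
        fix \<omega>
        have "Y N \<omega> * Z N \<omega> - y * z = (Y N \<omega> - y) * Z N \<omega> + y * (Z N \<omega> - z)" by (simp add: algebra_simps)
        then have "norm (Y N \<omega> * Z N \<omega> - y * z) ^ p \<le> 2 ^ p * ((?a \<omega> * ?c \<omega>) ^ p + (norm y * ?b \<omega>) ^ p)"
          using norm_add_power_le[of "(Y N \<omega> - y) * Z N \<omega>" "y * (Z N \<omega> - z)" p] by (simp add: norm_mult)
        moreover have "(?a \<omega> * ?c \<omega>) ^ p \<le> ?a \<omega> ^ (2 * p) / \<epsilon> + \<epsilon> * ?c \<omega> ^ (2 * p)"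
          using mult_le_eps[OF \<epsilon>, of "?a \<omega> ^ p" "?c \<omega> ^ p"] by (simp add: power_mult_distrib power_mult[symmetric] mult.commute)
        ultimately show "norm (Y N \<omega> * Z N \<omega> - y * z) ^ p \<le>
            2 ^ p * (?a \<omega> ^ (2 * p) / \<epsilon> + \<epsilon> * ?c \<omega> ^ (2 * p) + norm y ^ p * ?b \<omega> ^ p)"
          by (elim order_trans) (simp add: power_mult_distrib)
      qed (rule i)
      also have "\<dots> = 2 ^ p * ((\<integral>\<omega>. ?a \<omega> ^ (2 * p) \<partial>M N) / \<epsilon> + \<epsilon> * (\<integral>\<omega>. ?c \<omega> ^ (2 * p) \<partial>M N) + norm y ^ p * (\<integral>\<omega>. ?b \<omega> ^ p \<partial>M N))"
        using i by simp
      also have "\<dots> \<le> 2 ^ p * ((\<integral>\<omega>. ?a \<omega> ^ (2 * p) \<partial>M N) / \<epsilon> + \<epsilon> * (2 ^ (2 * p) * (1 + norm z ^ (2 * p))) + norm y ^ p * (\<integral>\<omega>. ?b \<omega> ^ p \<partial>M N))"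
      proof -
        have "(\<integral>\<omega>. ?c \<omega> ^ (2 * p) \<partial>M N) \<le> (\<integral>\<omega>. 2 ^ (2 * p) * (?b \<omega> ^ (2 * p) + norm z ^ (2 * p)) \<partial>M N)"
        proof (rule integral_mono)
          fix \<omega> show "?c \<omega> ^ (2 * p) \<le> 2 ^ (2 * p) * (?b \<omega> ^ (2 * p) + norm z ^ (2 * p))"
            using norm_add_power_le[of "Z N \<omega> - z" z "2 * p"] by simp
        qed (use i in simp_all)
        also have "\<dots> = 2 ^ (2 * p) * ((\<integral>\<omega>. ?b \<omega> ^ (2 * p) \<partial>M N) + norm z ^ (2 * p))"
          using i by (simp add: prob_space)
        also have "\<dots> \<le> 2 ^ (2 * p) * (1 + norm z ^ (2 * p))" using elim(1) by simp
        finally show ?thesis using \<epsilon> by (intro mult_left_mono add_mono) auto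
      qed
      also have "\<dots> = 2 ^ p * (\<integral>\<omega>. ?a \<omega> ^ (2 * p) \<partial>M N) / \<epsilon> + \<epsilon> * D + 2 ^ p * norm y ^ p * (\<integral>\<omega>. ?b \<omega> ^ p \<partial>M N)"
        by (simp add: D_def algebra_simps)
      finally show ?case by simp
    qed
  qed
qed

lemma conv_moments_expectation:
  assumes "conv_moments Y y"
  shows "(\<lambda>N. \<integral>\<omega>. Y N \<omega> \<partial>M N) \<longlonglongrightarrow> y"
proof (rule LIM_zero_cancel, rule Lim_null_comparison)
  show "(\<lambda>N. \<integral>\<omega>. norm (Y N \<omega> - y) ^ 1 \<partial>M N) \<longlonglongrightarrow> 0"
  proof -
    have "\<forall>p>0. (\<lambda>N. \<integral>\<omega>. norm (Y N \<omega> - y) ^ p \<partial>M N) \<longlonglongrightarrow> 0"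
      using assms by (simp add: conv_moments_def)
    from this[rule_format, of 1] show ?thesis by simp
  qed
  show "\<forall>\<^sub>F N in sequentially. norm ((\<integral>\<omega>. Y N \<omega> \<partial>M N) - y) \<le> (\<integral>\<omega>. norm (Y N \<omega> - y) ^ 1 \<partial>M N)"
    using eventually_gt_at_top[of 0]
  proof eventually_elim
    case (elim N)
    interpret prob_space "M N" by (rule prob[OF elim])
    have "(\<integral>\<omega>. Y N \<omega> \<partial>M N) - y = (\<integral>\<omega>. Y N \<omega> - y \<partial>M N)"
      using all_moments_integrable[OF conv_moments_am[OF assms elim]] by (simp add: prob_space)
    then show ?case using integral_norm_bound[of "M N" "\<lambda>\<omega>. Y N \<omega> - y"] by simp
  qed
qed

end

text \<open>The moments of the semicircle law of variance \<open>v\<close>, with noncrossing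
  pairings in place of Catalan numbers.\<close>

definition nc_moment :: "real \<Rightarrow> nat \<Rightarrow> real" where
  "nc_moment v m = v ^ (m div 2) * real (card {\<pi>\<in>pairings {..<m}. \<not> crossing m \<pi>})"

text \<open>The noncrossing pairings have the full number of solutions at every \<open>N\<close>, so
  they cancel exactly.\<close>

lemma trace_moment_minus_nc_moment:
  assumes "N > 0"
  shows "real N * (trace_moment v N b m - nc_moment v m) =
    v ^ (m div 2) * (\<Sum>\<pi>\<in>{\<pi>\<in>pairings {..<m}. crossing m \<pi>}. crossing_weight N b m \<pi>)"
proof -
  define x where "x = real (band_width N b) ^ (m div 2)"
  have x: "x > 0" using band_width_pos[OF assms] by (simp add: x_def)
  define s where "s = (\<lambda>\<pi>. real (card (step_solutions N b m \<pi>)))"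
  let ?C = "{\<pi>\<in>pairings {..<m}. crossing m \<pi>}" and ?NC = "{\<pi>\<in>pairings {..<m}. \<not> crossing m \<pi>}"
  have fin: "finite (pairings {..<m})" by (simp add: finite_pairings)
  have "(\<Sum>\<pi>\<in>pairings {..<m}. s \<pi>) = (\<Sum>\<pi>\<in>?NC. s \<pi>) + (\<Sum>\<pi>\<in>?C. s \<pi>)"
    using fin by (subst sum.union_disjoint[symmetric]) (auto intro!: sum.cong)
  also have "(\<Sum>\<pi>\<in>?NC. s \<pi>) = real (card ?NC) * x"
    using walk_pairing.card_solutions_noncrossing[OF walk_pairing.intro] by (simp add: s_def x_def)
  finally have "trace_moment v N b m = v ^ (m div 2) / x * (real (card ?NC) * x + (\<Sum>\<pi>\<in>?C. s \<pi>))"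
    by (simp add: trace_moment_def power_divide x_def s_def)
  then have "trace_moment v N b m - nc_moment v m = v ^ (m div 2) * ((\<Sum>\<pi>\<in>?C. s \<pi>) / x)"
    using x by (simp add: nc_moment_def field_simps)
  then have "real N * (trace_moment v N b m - nc_moment v m) = v ^ (m div 2) * (real N * ((\<Sum>\<pi>\<in>?C. s \<pi>) / x))"
    by (simp only: mult.left_commute)
  also have "real N * ((\<Sum>\<pi>\<in>?C. s \<pi>) / x) = (\<Sum>\<pi>\<in>?C. crossing_weight N b m \<pi>)"
    unfolding crossing_weight_def x_def[symmetric]
    by (simp add: sum_distrib_left sum_divide_distrib s_def)
  finally show ?thesis .
qed

lemma trace_moment_limits:
  assumes b: "filterlim b at_top sequentially"
    and rate: "filterlim (\<lambda>N. real (b N) / sqrt (real N)) at_top sequentially \<or>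
         (\<exists>c>0. (\<lambda>N. real (b N) / sqrt (real N)) \<longlonglongrightarrow> c)"
  shows "convergent (\<lambda>N. real N * (trace_moment v N (b N) m - nc_moment v m))"
    and "(\<lambda>N. trace_moment v N (b N) m) \<longlonglongrightarrow> nc_moment v m"
proof -
  have "convergent (\<lambda>N. v ^ (m div 2) * (\<Sum>\<pi>\<in>{\<pi>\<in>pairings {..<m}. crossing m \<pi>}. crossing_weight N (b N) m \<pi>))"
    by (intro convergent_mult convergent_const convergent_sum) (use crossing_weight_convergent[OF _ _ b rate] in auto)
  moreover have "\<forall>\<^sub>F N in sequentially. v ^ (m div 2) * (\<Sum>\<pi>\<in>{\<pi>\<in>pairings {..<m}. crossing m \<pi>}. crossing_weight N (b N) m \<pi>)
      = real N * (trace_moment v N (b N) m - nc_moment v m)"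
    using eventually_gt_at_top[of 0] by eventually_elim (simp only: trace_moment_minus_nc_moment)
  ultimately show c: "convergent (\<lambda>N. real N * (trace_moment v N (b N) m - nc_moment v m))"
    using convergent_cong by fastforce
  then obtain L where L: "(\<lambda>N. real N * (trace_moment v N (b N) m - nc_moment v m)) \<longlonglongrightarrow> L"
    by (auto simp: convergent_def)
  have "(\<lambda>N. real N * (trace_moment v N (b N) m - nc_moment v m) * inverse (real N)) \<longlonglongrightarrow> L * 0"
    by (intro tendsto_mult L lim_inverse_n)
  then have "(\<lambda>N. real N * (trace_moment v N (b N) m - nc_moment v m) * inverse (real N)) \<longlonglongrightarrow> 0" by simp
  then have "(\<lambda>N. trace_moment v N (b N) m - nc_moment v m) \<longlonglongrightarrow> 0"
  proof (rule Lim_transform_eventually)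
    show "\<forall>\<^sub>F N in sequentially. real N * (trace_moment v N (b N) m - nc_moment v m) * inverse (real N) =
        trace_moment v N (b N) m - nc_moment v m"
      using eventually_gt_at_top[of 0] by eventually_elim simp
  qed
  then show "(\<lambda>N. trace_moment v N (b N) m) \<longlonglongrightarrow> nc_moment v m" by (rule LIM_zero_cancel)
qed

section \<open>Words in the three families\<close>

lemma index_mult_carrier:
  assumes "A \<in> carrier_mat N N" "B \<in> carrier_mat N N" "r < N" "s < N"
  shows "(A * B) $$ (r, s) = (\<Sum>l<N. A $$ (r, l) * B $$ (l, s))"
  using assms by (simp add: scalar_prod_def atLeast0LessThan)

lemma mat_trace_commute:
  assumes "A \<in> carrier_mat N N" "B \<in> carrier_mat N N"
  shows "mat_trace (A * B) = mat_trace (B * A)"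
proof -
  have "mat_trace (A * B) = (\<Sum>r<N. \<Sum>l<N. A $$ (r, l) * B $$ (l, r))"
    using assms by (auto simp: mat_trace_def scalar_prod_def atLeast0LessThan intro!: sum.cong)
  also have "\<dots> = (\<Sum>l<N. \<Sum>r<N. B $$ (l, r) * A $$ (r, l))"
    by (subst sum.swap) (simp add: mult.commute)
  also have "\<dots> = mat_trace (B * A)"
    using assms by (auto simp: mat_trace_def scalar_prod_def atLeast0LessThan intro!: sum.cong)
  finally show ?thesis .
qed

lemma qform_outer:
  "qform N a (\<lambda>r s. p r * q s) c = (\<Sum>r<N. of_real (a r) * p r) * (\<Sum>s<N. q s * of_real (c s))"
  unfolding qform_def sum_product by (simp add: mult_ac)

text \<open>\<open>Some j\<close> stands for the \<open>j\<close>-th unit vector, with \<open>j\<close> counted from \<open>1\<close> (and the zero vector if \<open>j\<close> is not in \<open>{1..N}\<close>),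
  and \<open>None\<close> for the unit vector with constant entries. Every letter other than \<open>Band\<close> is the rank one matrix
  formed by its two directions.\<close>

definition dvec :: "nat \<Rightarrow> nat option \<Rightarrow> nat \<Rightarrow> real" where
  "dvec N a r = (case a of None \<Rightarrow> 1 / sqrt (real N) | Some j \<Rightarrow> if Suc r = j then 1 else 0)"

primrec left_dir :: "model_index \<Rightarrow> nat option" where
  "left_dir Band = None"
| "left_dir (MatrixUnit j k) = Some j"
| "left_dir Ones = None"

primrec right_dir :: "model_index \<Rightarrow> nat option" where
  "right_dir Band = None"
| "right_dir (MatrixUnit j k) = Some k"
| "right_dir Ones = None"

lemma sum_unit_vector: "(\<Sum>r<N. if Suc r = j then f r else (0::real)) = (if 1 \<le> j \<and> j \<le> N then f (j - 1) else 0)"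
proof (cases j)
  case (Suc i)
  then show ?thesis by (simp add: sum.delta' eq_commute[of _ i] Suc_le_eq)
qed simp

lemma contraction_dvec: "contraction N (dvec N a)"
proof (cases a)
  case None
  have "(\<Sum>r<N. (dvec N a r)\<^sup>2) = real N * (1 / real N)"
    by (simp add: dvec_def None power_divide)
  then show ?thesis by (simp add: contraction_def)
next
  case (Some j)
  have "(\<Sum>r<N. (dvec N a r)\<^sup>2) = (\<Sum>r<N. if Suc r = j then 1 else 0)"
    by (intro sum.cong) (auto simp: dvec_def Some)
  then show ?thesis by (simp add: contraction_def sum_unit_vector)
qed

text \<open>The directions are asymptotically orthonormal: a coordinate vector and the constant one
  have inner product at most 1 / sqrt N. \<open>Some 0\<close> stands for the zero vector, for which
  the value 1 at \<open>a = c\<close> would be false.\<close>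

lemma inner_dvec_tendsto:
  assumes "a \<noteq> Some 0" "c \<noteq> Some 0"
  shows "(\<lambda>N. \<Sum>r<N. dvec N a r * dvec N c r) \<longlonglongrightarrow> (if a = c then 1 else 0)"
proof -
  have mixed: "(\<lambda>N. \<Sum>r<N. dvec N (Some j) r * dvec N None r) \<longlonglongrightarrow> 0" for j
  proof (rule Lim_null_comparison)
    show "(\<lambda>N. 1 / sqrt (real N)) \<longlonglongrightarrow> 0" by real_asymp
    have "(\<Sum>r<N. dvec N (Some j) r * dvec N None r) = (\<Sum>r<N. if Suc r = j then 1 / sqrt (real N) else 0)" for N
      by (intro sum.cong) (auto simp: dvec_def)
    then have "(\<Sum>r<N. dvec N (Some j) r * dvec N None r) = (if 1 \<le> j \<and> j \<le> N then 1 / sqrt (real N) else 0)" for N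
      by (simp add: sum_unit_vector)
    then show "\<forall>\<^sub>F N in sequentially. norm (\<Sum>r<N. dvec N (Some j) r * dvec N None r) \<le> 1 / sqrt (real N)"
      by (intro always_eventually) auto
  qed
  show ?thesis
  proof (cases a; cases c)
    assume "a = None" "c = None"
    moreover have "(\<lambda>N. \<Sum>r<N. dvec N None r * dvec N None r) \<longlonglongrightarrow> 1"
    proof (rule tendsto_eventually)
      show "\<forall>\<^sub>F N in sequentially. (\<Sum>r<N. dvec N None r * dvec N None r) = 1"
        using eventually_gt_at_top[of 0] by eventually_elim (simp add: dvec_def)
    qed
    ultimately show ?thesis by simp
  next
    fix j assume "a = None" "c = Some j"
    then show ?thesis using mixed[of j] by (simp add: mult.commute)
  next
    fix j assume "a = Some j" "c = None"
    then show ?thesis using mixed[of j] by simp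
  next
    fix j k assume jk: "a = Some j" "c = Some k"
    show ?thesis
    proof (rule tendsto_eventually)
      show "\<forall>\<^sub>F N in sequentially. (\<Sum>r<N. dvec N a r * dvec N c r) = (if a = c then 1 else 0)"
        using eventually_ge_at_top[of j]
      proof eventually_elim
        case (elim N)
        have "(\<Sum>r<N. dvec N a r * dvec N c r) = (\<Sum>r<N. if Suc r = j then (if j = k then 1 else 0) else 0)"
          by (intro sum.cong) (auto simp: dvec_def jk)
        then show ?case using elim jk assms by (simp add: sum_unit_vector)
      qed
    qed
  qed
qed

section \<open>Traces of words as products of quadratic forms\<close>

locale banded_model = prob_sequence M for M :: "nat \<Rightarrow> 'w measure" +
  fixes X :: "nat \<Rightarrow> 'w \<Rightarrow> complex mat" and b :: "nat \<Rightarrow> nat" and v :: real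
  assumes v_pos: "v > 0"
    and gue: "\<And>N. N > 0 \<Longrightarrow> prob_space.gue (M N) N v (X N)"
    and b_at_top: "filterlim b at_top sequentially"
    and rate: "filterlim (\<lambda>N. real (b N) / sqrt (real N)) at_top sequentially \<or>
         (\<exists>c>0. (\<lambda>N. real (b N) / sqrt (real N)) \<longlonglongrightarrow> c)"
begin

lemma banded_gue: "N > 0 \<Longrightarrow> banded_gue (M N) N v (X N)"
  using prob gue v_pos
  by (auto intro!: banded_gue.intro gue_space.intro simp: gue_space_axioms_def banded_gue_axioms_def)

definition word_mat :: "nat \<Rightarrow> model_index list \<Rightarrow> 'w \<Rightarrow> complex mat" where
  "word_mat N xs \<omega> = eval_monomial N (\<lambda>i. model X b N i \<omega>) (Monomial xs)"

lemma model_carrier [simp]: "model X b N i \<omega> \<in> carrier_mat N N"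
  by (cases i) (simp_all add: periodic_band_def matrix_unit_def normalized_ones_def)

lemma word_mat_Nil: "word_mat N [] \<omega> = 1\<^sub>m N"
  and word_mat_Cons: "word_mat N (x # xs) \<omega> = model X b N x \<omega> * word_mat N xs \<omega>"
  by (simp_all add: word_mat_def eval_monomial_def)

lemma word_mat_carrier [simp]: "word_mat N xs \<omega> \<in> carrier_mat N N"
  by (induction xs) (simp_all add: word_mat_Nil word_mat_Cons mult_carrier_mat[of _ N N _ N])

lemma word_mat_append: "word_mat N (xs @ ys) \<omega> = word_mat N xs \<omega> * word_mat N ys \<omega>"
  by (induction xs)
     (simp_all add: word_mat_Nil word_mat_Cons assoc_mult_mat[of _ N N _ N _ N] left_mult_one_mat[of _ N N])

lemma model_rank_one:
  assumes "L \<noteq> Band" "r < N" "s < N"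
  shows "model X b N L \<omega> $$ (r, s) = of_real (dvec N (left_dir L) r) * of_real (dvec N (right_dir L) s)"
proof (cases L)
  case Ones
  have "complex_of_real (1 / sqrt (real N)) * of_real (1 / sqrt (real N)) = of_real (1 / real N)"
    unfolding of_real_mult[symmetric] by simp
  then show ?thesis using assms Ones by (simp add: normalized_ones_def dvec_def)
qed (use assms in \<open>auto simp: matrix_unit_def dvec_def\<close>)

definition word_form :: "nat \<Rightarrow> nat option \<Rightarrow> model_index list \<Rightarrow> nat option \<Rightarrow> 'w \<Rightarrow> complex" where
  "word_form N a xs c \<omega> = qform N (dvec N a) (\<lambda>r s. word_mat N xs \<omega> $$ (r, s)) (dvec N c)"

lemma qform_cong: "(\<And>r s. r < N \<Longrightarrow> s < N \<Longrightarrow> B r s = B' r s) \<Longrightarrow> qform N a B c = qform N a B' c"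
  unfolding qform_def by (intro sum.cong refl) auto

text \<open>A rank one matrix in the middle of a product cuts the form in two, one ending at its
  left vector and one starting at its right vector.\<close>

lemma word_form_split:
  assumes "L \<noteq> Band"
  shows "word_form N a (xs @ L # ys) c \<omega> = word_form N a xs (left_dir L) \<omega> * word_form N (right_dir L) ys c \<omega>"
proof -
  let ?W = "\<lambda>zs r s. word_mat N zs \<omega> $$ (r, s)"
  define p where "p = (\<lambda>r. \<Sum>l<N. ?W xs r l * of_real (dvec N (left_dir L) l))"
  define q where "q = (\<lambda>s. \<Sum>l<N. of_real (dvec N (right_dir L) l) * ?W ys l s)"
  have "?W (xs @ L # ys) r s = p r * q s" if "r < N" "s < N" for r s
  proof -
    have c: "(model X b N L \<omega> * word_mat N ys \<omega>) \<in> carrier_mat N N" by (rule mult_carrier_mat[of _ N N _ N]) simp_all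
    have "?W (xs @ L # ys) r s = (\<Sum>l<N. ?W xs r l * (model X b N L \<omega> * word_mat N ys \<omega>) $$ (l, s))"
      unfolding word_mat_append word_mat_Cons using that by (intro index_mult_carrier c) simp_all
    also have "\<dots> = (\<Sum>l<N. ?W xs r l * (of_real (dvec N (left_dir L) l) * q s))"
    proof (intro sum.cong refl arg_cong2[of _ _ _ _ "(*)"])
      fix l assume "l \<in> {..<N}"
      then show "(model X b N L \<omega> * word_mat N ys \<omega>) $$ (l, s) = of_real (dvec N (left_dir L) l) * q s"
        using that assms by (subst index_mult_carrier[where N=N])
          (auto simp: q_def sum_distrib_left model_rank_one mult.assoc intro!: sum.cong)
    qed
    finally show ?thesis by (simp add: p_def sum_distrib_left sum_distrib_right mult_ac)
  qed
  then have "word_form N a (xs @ L # ys) c \<omega> = qform N (dvec N a) (\<lambda>r s. p r * q s) (dvec N c)"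
    unfolding word_form_def by (intro qform_cong)
  also have "\<dots> = (\<Sum>r<N. of_real (dvec N a r) * p r) * (\<Sum>s<N. q s * of_real (dvec N c s))"
    by (rule qform_outer)
  also have "(\<Sum>r<N. of_real (dvec N a r) * p r) = word_form N a xs (left_dir L) \<omega>"
    by (simp add: word_form_def qform_def p_def sum_distrib_left mult.assoc)
  also have "(\<Sum>s<N. q s * of_real (dvec N c s)) = word_form N (right_dir L) ys c \<omega>"
    unfolding word_form_def qform_def q_def sum_distrib_right by (rule sum.swap)
  finally show ?thesis .
qed

lemma trace_word_commute: "mat_trace (word_mat N (xs @ ys) \<omega>) = mat_trace (word_mat N (ys @ xs) \<omega>)"
  unfolding word_mat_append by (rule mat_trace_commute[of _ N]) simp_all

text \<open>The trace of a rank one matrix x y^T times W is the single form of W at y and x, without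
  a sum of \<open>N\<close> diagonal entries.\<close>

lemma trace_word_form:
  assumes "L \<noteq> Band"
  shows "mat_trace (word_mat N (L # xs) \<omega>) = word_form N (right_dir L) xs (left_dir L) \<omega>"
proof -
  have "mat_trace (word_mat N (L # xs) \<omega>) = (\<Sum>r<N. (model X b N L \<omega> * word_mat N xs \<omega>) $$ (r, r))"
    unfolding word_mat_Cons mat_trace_def using carrier_matD(1)[OF model_carrier] by simp
  also have "\<dots> = (\<Sum>r<N. \<Sum>l<N. of_real (dvec N (right_dir L) l) * word_mat N xs \<omega> $$ (l, r) * of_real (dvec N (left_dir L) r))"
  proof (rule sum.cong[OF refl])
    fix r assume "r \<in> {..<N}"
    then show "(model X b N L \<omega> * word_mat N xs \<omega>) $$ (r, r) =
        (\<Sum>l<N. of_real (dvec N (right_dir L) l) * word_mat N xs \<omega> $$ (l, r) * of_real (dvec N (left_dir L) r))"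
      using assms by (subst index_mult_carrier[where N=N])
        (auto simp: model_rank_one mult_ac intro!: sum.cong)
  qed
  also have "\<dots> = word_form N (right_dir L) xs (left_dir L) \<omega>"
    unfolding word_form_def qform_def by (rule sum.swap)
  finally show ?thesis .
qed

lemma word_mat_band:
  assumes "r < N" "s < N"
  shows "word_mat N (replicate m Band) \<omega> $$ (r, s) = mpow N (\<lambda>r s. periodic_band N (b N) (X N \<omega>) $$ (r, s)) m r s"
  using assms
proof (induction m arbitrary: r)
  case 0
  then show ?case by (simp add: word_mat_Nil)
next
  case (Suc m)
  let ?A = "\<lambda>r s. periodic_band N (b N) (X N \<omega>) $$ (r, s)"
  \<comment> \<open>Words are built from the left and \<open>mpow\<close> from the right; a first
    power, split off by \<open>mpow_add\<close>, mediates.\<close>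
  have one: "mpow N ?A 1 r l = ?A r l" if "l < N" for l
    using Suc.prems by (simp add: if_distrib[of "\<lambda>x. x * _"] sum.delta cong: if_cong)
  have "word_mat N (replicate (Suc m) Band) \<omega> $$ (r, s) =
    (\<Sum>l<N. ?A r l * word_mat N (replicate m Band) \<omega> $$ (l, s))"
    unfolding replicate_Suc word_mat_Cons
    using Suc.prems by (subst index_mult_carrier[where N=N]) (auto simp: periodic_band_def)
  also have "\<dots> = (\<Sum>l<N. mpow N ?A 1 r l * mpow N ?A m l s)"
    using Suc one by (intro sum.cong refl) (auto simp del: mpow.simps)
  also have "\<dots> = mpow N ?A (Suc m) r s" using mpow_add[OF Suc.prems(2), of ?A 1 m r] by simp
  finally show ?case .
qed

lemma model_all_moments:
  assumes "N > 0" "r < N" "s < N"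
  shows "prob_space.all_moments (M N) (\<lambda>\<omega>. model X b N i \<omega> $$ (r, s))"
proof -
  interpret banded_gue "M N" N v "X N" "b N" by (rule banded_gue) fact
  show ?thesis
    using Xi_all_moments[OF assms(2,3)] unfolding Xi_def by (cases i) auto
qed

lemma word_all_moments:
  assumes "N > 0" "r < N" "s < N"
  shows "prob_space.all_moments (M N) (\<lambda>\<omega>. word_mat N xs \<omega> $$ (r, s))"
  using assms(2)
proof (induction xs arbitrary: r)
  case Nil
  interpret prob_space "M N" by (rule prob) fact
  show ?case by (simp add: word_mat_Nil all_moments_const)
next
  case (Cons x xs)
  interpret prob_space "M N" by (rule prob) fact
  have e: "word_mat N (x # xs) \<omega> $$ (r, s) = (\<Sum>l<N. model X b N x \<omega> $$ (r, l) * word_mat N xs \<omega> $$ (l, s))" for \<omega>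
    unfolding word_mat_Cons using Cons.prems assms(3) by (intro index_mult_carrier) simp_all
  show ?case unfolding e
    by (intro all_moments_sum all_moments_mult model_all_moments[OF assms(1)] Cons) (use Cons.prems in auto)
qed

lemma trace_all_moments:
  assumes "N > 0"
  shows "prob_space.all_moments (M N) (\<lambda>\<omega>. mat_trace (word_mat N xs \<omega>))"
proof -
  interpret prob_space "M N" by (rule prob) fact
  have "mat_trace (word_mat N xs \<omega>) = (\<Sum>r<N. word_mat N xs \<omega> $$ (r, r))" for \<omega>
    using carrier_matD(1)[OF word_mat_carrier] by (simp add: mat_trace_def)
  then show ?thesis by (simp, intro all_moments_sum word_all_moments assms) auto
qed

lemma expectation_trace_band:
  assumes "N > 0"
  shows "(\<integral>\<omega>. mat_trace (word_mat N (replicate m Band) \<omega>) \<partial>M N) = of_nat N * of_real (trace_moment v N (b N) m)"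
proof -
  interpret banded_gue "M N" N v "X N" "b N" by (rule banded_gue) fact
  have "mat_trace (word_mat N (replicate m Band) \<omega>) = (\<Sum>r<N. mp m \<omega> r r)" for \<omega>
    using carrier_matD(1)[OF word_mat_carrier] by (simp add: mat_trace_def word_mat_band Xi_def[abs_def])
  then have "(\<integral>\<omega>. mat_trace (word_mat N (replicate m Band) \<omega>) \<partial>M N) = (\<integral>\<omega>. (\<Sum>r<N. mp m \<omega> r r) \<partial>M N)"
    by simp
  also have "\<dots> = (\<Sum>r<N. \<integral>\<omega>. mp m \<omega> r r \<partial>M N)"
    by (intro Bochner_Integration.integral_sum all_moments_integrable mp_all_moments) auto
  also have "\<dots> = of_nat N * of_real (trace_moment v N (b N) m)" by (simp add: expectation_mp)
  finally show ?thesis .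
qed

text \<open>The mean is the trace moment times the inner product of the directions, the variance is
  O(1 / \<xi>), and all moments are bounded uniformly in \<open>N\<close>; so
  \<open>conv_moments_I\<close> applies.\<close>

lemma band_form_conv:
  assumes "a \<noteq> Some 0" "c \<noteq> Some 0"
  shows "conv_moments (\<lambda>N. word_form N a (replicate m Band) c) (of_real (nc_moment v m * (if a = c then 1 else 0)))"
proof (rule conv_moments_I)
  define t where "t = (\<lambda>N. trace_moment v N (b N) m)"
  define i where "i = (\<lambda>N. \<Sum>r<N. dvec N a r * dvec N c r)"
  define y where "y = nc_moment v m * (if a = c then 1 else 0)"
  define C where "C = real (card (pairings {..<2 * m})) * v ^ m"
  have C: "C \<ge> 0" using v_pos by (simp add: C_def)
  have form: "word_form N a (replicate m Band) c = (\<lambda>\<omega>. qform N (dvec N a)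
      (mpow N (banded_gue.Xi N (X N) (b N) \<omega>) m) (dvec N c))" if "N > 0" for N
  proof
    fix \<omega>
    interpret banded_gue "M N" N v "X N" "b N" by (rule banded_gue) fact
    show "word_form N a (replicate m Band) c \<omega> = qform N (dvec N a) (mp m \<omega>) (dvec N c)"
      unfolding word_form_def by (rule qform_cong) (simp add: word_mat_band Xi_def[abs_def])
  qed
  show "prob_space.all_moments (M N) (word_form N a (replicate m Band) c)" if "N > 0" for N
    unfolding form[OF that] by (rule banded_gue.qform_all_moments[OF banded_gue[OF that]])
  show "\<exists>C. \<forall>N>0. (\<integral>\<omega>. norm (word_form N a (replicate m Band) c \<omega>) ^ p \<partial>M N) \<le> C" for p
  proof (intro exI allI impI)
    fix N :: nat assume N: "N > 0"
    interpret banded_gue "M N" N v "X N" "b N" by (rule banded_gue) fact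
    have "(\<integral>\<omega>. norm (word_form N a (replicate m Band) c \<omega>) ^ p \<partial>M N) \<le> 1 + trace_moment v N (b N) (2 ^ Suc p * m)"
      unfolding form[OF N] by (rule expectation_qform_power_le) (rule contraction_dvec)+
    also have "trace_moment v N (b N) (2 ^ Suc p * m) \<le> real (card (pairings {..<2 ^ Suc p * m})) * v ^ (2 ^ Suc p * m div 2)"
      by (rule trace_moment_le[OF v_pos N])
    finally show "(\<integral>\<omega>. norm (word_form N a (replicate m Band) c \<omega>) ^ p \<partial>M N) \<le>
      1 + real (card (pairings {..<2 ^ Suc p * m})) * v ^ (2 ^ Suc p * m div 2)" by simp
  qed
  have ty: "(\<lambda>N. t N * i N) \<longlonglongrightarrow> y"
    unfolding t_def i_def y_def by (intro tendsto_mult trace_moment_limits(2)[OF b_at_top rate] inner_dvec_tendsto assms)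
  show "(\<lambda>N. \<integral>\<omega>. (norm (word_form N a (replicate m Band) c \<omega> - of_real (nc_moment v m * (if a = c then 1 else 0))))\<^sup>2 \<partial>M N) \<longlonglongrightarrow> 0"
    unfolding y_def[symmetric]
  proof (rule Lim_null_comparison)
    have bw: "(\<lambda>N. 1 / real (band_width N (b N))) \<longlonglongrightarrow> 0"
    proof (rule Lim_null_comparison)
      have "(\<lambda>N. inverse (real (b N))) \<longlonglongrightarrow> 0"
        using tendsto_inverse_0_at_top[OF filterlim_compose[OF filterlim_real_sequentially b_at_top]] .
      then show "(\<lambda>N. inverse (real (b N)) + inverse (real N)) \<longlonglongrightarrow> 0"
        using tendsto_add[OF _ lim_inverse_n] by fastforce
      show "\<forall>\<^sub>F N in sequentially. norm (1 / real (band_width N (b N))) \<le> inverse (real (b N)) + inverse (real N)"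
        using eventually_gt_at_top[of 0] b_at_top[unfolded filterlim_at_top, rule_format, of 1]
      proof eventually_elim
        case (elim N)
        have "inverse (real (2 * b N + 1)) \<le> inverse (real (b N))" using elim by (intro le_imp_inverse_le) auto
        moreover have "0 \<le> inverse (real (b N))" "0 \<le> inverse (real N)" by auto
        moreover have "norm (1 / real (band_width N (b N))) = inverse (real (2 * b N + 1)) \<or>
            norm (1 / real (band_width N (b N))) = inverse (real N)"
          by (auto simp: band_width_def min_def inverse_eq_divide)
        ultimately show ?case by linarith
      qed
    qed
    \<comment> \<open>The first summand bounds the variance and the second is the squared bias of
      the mean; splitting the square costs a constant factor.\<close>
    have "(\<lambda>N. 8 * (2 * (C * (1 / real (band_width N (b N)))) + (t N * i N - y)\<^sup>2)) \<longlonglongrightarrow> 8 * (2 * (C * 0) + (y - y)\<^sup>2)"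
      by (intro tendsto_intros bw ty)
    then show "(\<lambda>N. 8 * (2 * (C * (1 / real (band_width N (b N)))) + (t N * i N - y)\<^sup>2)) \<longlonglongrightarrow> 0" by simp
    show "\<forall>\<^sub>F N in sequentially. norm (\<integral>\<omega>. (norm (word_form N a (replicate m Band) c \<omega> - of_real y))\<^sup>2 \<partial>M N)
      \<le> 8 * (2 * (C * (1 / real (band_width N (b N)))) + (t N * i N - y)\<^sup>2)"
      using eventually_gt_at_top[of 0]
    proof eventually_elim
      case (elim N)
      interpret banded_gue "M N" N v "X N" "b N" by (rule banded_gue) fact
      let ?Q = "\<lambda>\<omega>. qform N (dvec N a) (mp m \<omega>) (dvec N c)"
      note am = qform_all_moments[of "dvec N a" m "dvec N c"]
      have i1: "integrable (M N) (\<lambda>\<omega>. (norm (?Q \<omega> - z))\<^sup>2)" for z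
        by (rule all_moments_power[OF all_moments_diff[OF am all_moments_const]])
      have "(\<integral>\<omega>. (norm (?Q \<omega> - of_real y))\<^sup>2 \<partial>M N) \<le>
        (\<integral>\<omega>. 4 * ((norm (?Q \<omega> - of_real (t N * i N)))\<^sup>2 + (t N * i N - y)\<^sup>2) \<partial>M N)"
      proof (rule integral_mono)
        show "integrable (M N) (\<lambda>\<omega>. 4 * ((norm (?Q \<omega> - of_real (t N * i N)))\<^sup>2 + (t N * i N - y)\<^sup>2))" using i1 by simp
        fix \<omega>
        have "norm (complex_of_real (t N * i N) - of_real y) ^ 2 = (t N * i N - y)\<^sup>2"
          unfolding of_real_diff[symmetric] norm_of_real by simp
        then show "(norm (?Q \<omega> - of_real y))\<^sup>2 \<le> 4 * ((norm (?Q \<omega> - of_real (t N * i N)))\<^sup>2 + (t N * i N - y)\<^sup>2)"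
          using norm_add_power_le[of "?Q \<omega> - of_real (t N * i N)" "of_real (t N * i N) - of_real y" 2] by simp
      qed (rule i1)
      also have "\<dots> = 4 * ((\<integral>\<omega>. (norm (?Q \<omega> - of_real (t N * i N)))\<^sup>2 \<partial>M N) + (t N * i N - y)\<^sup>2)"
        using i1 by (simp add: prob_space)
      also have "(\<integral>\<omega>. (norm (?Q \<omega> - of_real (t N * i N)))\<^sup>2 \<partial>M N) \<le> 2 * cov_bound m"
        unfolding t_def i_def by (rule variance_qform) (rule contraction_dvec)+
      also have "cov_bound m = C * (1 / real (band_width N (b N)))" by (simp add: cov_bound_def C_def)
      finally have "(\<integral>\<omega>. (norm (?Q \<omega> - of_real y))\<^sup>2 \<partial>M N) \<le> 4 * (2 * (C * (1 / real (band_width N (b N)))) + (t N * i N - y)\<^sup>2)" by simp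
      moreover have "0 \<le> 2 * (C * (1 / real (band_width N (b N)))) + (t N * i N - y)\<^sup>2" using C by simp
      moreover have "0 \<le> (\<integral>\<omega>. (norm (?Q \<omega> - of_real y))\<^sup>2 \<partial>M N)" by simp
      ultimately show ?case unfolding form[OF elim] real_norm_def by linarith
    qed
  qed
qed

text \<open>Excludes the index \<open>0\<close>, for which the matrix units vanish for every \<open>N\<close>.\<close>

definition valid :: "model_index list \<Rightarrow> bool" where
  "valid xs \<longleftrightarrow> (\<forall>L\<in>set xs. left_dir L \<noteq> Some 0 \<and> right_dir L \<noteq> Some 0)"

lemma replicate_or_split:
  assumes "\<not> set xs \<subseteq> {Band}"
  obtains m L ys where "xs = replicate m Band @ L # ys" "L \<noteq> Band"
  using assms
proof (induction xs arbitrary: thesis)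
  case (Cons x xs)
  show ?case
  proof (cases "x = Band")
    case True
    then have "\<not> set xs \<subseteq> {Band}" using Cons.prems(2) by auto
    from Cons.IH[OF _ this] obtain m L ys where "xs = replicate m Band @ L # ys" "L \<noteq> Band" by blast
    then show ?thesis using Cons.prems(1)[of "Suc m" L ys] True by simp
  next
    case False
    then show ?thesis using Cons.prems(1)[of 0 x xs] by simp
  qed
qed simp

lemma only_band_replicate: "set xs \<subseteq> {Band} \<Longrightarrow> xs = replicate (length xs) Band"
  by (induction xs) auto

text \<open>Cutting at the first rank one letter leaves a power of the band matrix on the left and a
  shorter word on the right.\<close>

lemma word_form_conv:
  assumes "valid xs" "a \<noteq> Some 0" "c \<noteq> Some 0"
  shows "\<exists>y. conv_moments (\<lambda>N. word_form N a xs c) y"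
  using assms
proof (induction "length xs" arbitrary: xs a rule: less_induct)
  case less
  show ?case
  proof (cases "set xs \<subseteq> {Band}")
    case True
    then show ?thesis using band_form_conv[OF less.prems(2,3), of "length xs"] only_band_replicate by metis
  next
    case False
    then obtain m L ys where xs: "xs = replicate m Band @ L # ys" "L \<noteq> Band" by (rule replicate_or_split)
    have L: "left_dir L \<noteq> Some 0" "right_dir L \<noteq> Some 0" "valid ys" using less.prems(1) by (auto simp: valid_def xs)
    obtain y where "conv_moments (\<lambda>N. word_form N (right_dir L) ys c) y"
      using less.hyps[of ys] L less.prems by (auto simp: xs)
    from conv_moments_mult[OF band_form_conv[OF less.prems(2) L(1), of m] this]
    show ?thesis unfolding xs(1) word_form_split[OF xs(2), abs_def] by blast
  qed
qed

section \<open>Limits on words and the three rules for \<nu>\<close>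

definition mean_word :: "model_index list \<Rightarrow> nat \<Rightarrow> complex" where
  "mean_word xs N = 1 / of_nat N * (\<integral>\<omega>. mat_trace (word_mat N xs \<omega>) \<partial>M N)"

definition mu_word :: "model_index list \<Rightarrow> complex" where
  "mu_word xs = (if set xs \<subseteq> {Band} then of_real (nc_moment v (length xs)) else 0)"

definition nu_word :: "model_index list \<Rightarrow> complex" where
  "nu_word xs = lim (\<lambda>N. of_nat N * (mean_word xs N - mu_word xs))"

lemma mean_word_commute: "mean_word (xs @ ys) = mean_word (ys @ xs)"
  by (simp add: mean_word_def fun_eq_iff trace_word_commute[of _ xs])

lemma mu_word_commute: "mu_word (xs @ ys) = mu_word (ys @ xs)"
  by (simp add: mu_word_def add.commute Un_commute conj_commute)

lemma nu_word_commute: "nu_word (xs @ ys) = nu_word (ys @ xs)"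
  unfolding nu_word_def mean_word_commute[of xs] mu_word_commute[of xs] ..

lemma nu_word_unit:
  assumes L: "L \<noteq> Band" and y: "conv_moments (\<lambda>N. word_form N (right_dir L) xs (left_dir L)) y"
  shows "(\<lambda>N. of_nat N * (mean_word (L # xs) N - mu_word (L # xs))) \<longlonglongrightarrow> y" "nu_word (L # xs) = y"
proof -
  have 0: "mu_word (L # xs) = 0" using L by (simp add: mu_word_def)
  show lim: "(\<lambda>N. of_nat N * (mean_word (L # xs) N - mu_word (L # xs))) \<longlonglongrightarrow> y"
  proof (rule Lim_transform_eventually[OF conv_moments_expectation[OF y]])
    show "\<forall>\<^sub>F N in sequentially. (\<integral>\<omega>. word_form N (right_dir L) xs (left_dir L) \<omega> \<partial>M N) =
        of_nat N * (mean_word (L # xs) N - mu_word (L # xs))"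
      using eventually_gt_at_top[of 0] by eventually_elim (simp add: mean_word_def 0 trace_word_form[OF L])
  qed
  then show "nu_word (L # xs) = y" unfolding nu_word_def by (rule limI)
qed

text \<open>Pure band words are the case of \<open>trace_moment_limits\<close>. Any other word is
  rotated until it begins with a rank one letter, and then its trace is a form.\<close>

lemma nu_word_lim:
  assumes "valid xs"
  shows "(\<lambda>N. of_nat N * (mean_word xs N - mu_word xs)) \<longlonglongrightarrow> nu_word xs"
proof -
  have "convergent (\<lambda>N. of_nat N * (mean_word xs N - mu_word xs))"
  proof (cases "set xs \<subseteq> {Band}")
    case True
    define m where "m = length xs"
    have xs: "xs = replicate m Band" unfolding m_def by (rule only_band_replicate[OF True])
    obtain L where L: "(\<lambda>N. real N * (trace_moment v N (b N) m - nc_moment v m)) \<longlonglongrightarrow> L"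
      using trace_moment_limits(1)[OF b_at_top rate] by (auto simp: convergent_def)
    then have "(\<lambda>N. complex_of_real (real N * (trace_moment v N (b N) m - nc_moment v m))) \<longlonglongrightarrow> of_real L"
      by (rule tendsto_of_real)
    then have "(\<lambda>N. of_nat N * (mean_word xs N - mu_word xs)) \<longlonglongrightarrow> of_real L"
    proof (rule Lim_transform_eventually)
      show "\<forall>\<^sub>F N in sequentially. complex_of_real (real N * (trace_moment v N (b N) m - nc_moment v m)) =
          of_nat N * (mean_word xs N - mu_word xs)"
        using eventually_gt_at_top[of 0]
      proof eventually_elim
        case (elim N)
        have "mean_word xs N = of_real (trace_moment v N (b N) m)"
          unfolding mean_word_def xs expectation_trace_band[OF elim] using elim by simp
        moreover have "mu_word xs = of_real (nc_moment v m)" using True by (simp add: mu_word_def m_def)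
        ultimately show ?case by simp
      qed
    qed
    then show ?thesis by (rule convergentI)
  next
    case False
    then obtain m L ys where xs: "xs = replicate m Band @ L # ys" "L \<noteq> Band" by (rule replicate_or_split)
    have "valid (ys @ replicate m Band)" "left_dir L \<noteq> Some 0" "right_dir L \<noteq> Some 0"
      using assms by (auto simp: valid_def xs)
    then obtain y where "conv_moments (\<lambda>N. word_form N (right_dir L) (ys @ replicate m Band) (left_dir L)) y"
      using word_form_conv by blast
    from nu_word_unit(1)[OF xs(2) this] show ?thesis
      unfolding xs(1) mean_word_commute[of "replicate m Band"] mu_word_commute[of "replicate m Band"] convergent_def
      by auto
  qed
  then show ?thesis unfolding nu_word_def by (simp add: convergent_LIMSEQ_iff)
qed

lemma mean_word_lim:
  assumes "valid xs"
  shows "mean_word xs \<longlonglongrightarrow> mu_word xs"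
proof -
  have "(\<lambda>N. of_nat N * (mean_word xs N - mu_word xs) * inverse (of_nat N)) \<longlonglongrightarrow> nu_word xs * 0"
    by (intro tendsto_mult nu_word_lim assms lim_inverse_n)
  then have "(\<lambda>N. of_nat N * (mean_word xs N - mu_word xs) * inverse (of_nat N)) \<longlonglongrightarrow> 0" by simp
  then have "(\<lambda>N. mean_word xs N - mu_word xs) \<longlonglongrightarrow> 0"
  proof (rule Lim_transform_eventually)
    show "\<forall>\<^sub>F N in sequentially. of_nat N * (mean_word xs N - mu_word xs) * inverse (of_nat N) = mean_word xs N - mu_word xs"
      using eventually_gt_at_top[of 0] by eventually_elim simp
  qed
  then show ?thesis by (rule LIM_zero_cancel)
qed

text \<open>After a rotation the band block stands between the last and the first letter of
  \<open>t\<close>, where its form tends to \<open>nc_moment v m\<close> times 0 or 1. An empty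
  block gives the same with \<open>nc_moment v 0 = 1\<close>, and this evaluates
  \<open>nu_word t\<close>.\<close>

lemma nu_word_band:
  assumes t: "valid t" "t \<noteq> []" "hd t \<noteq> Band" "last t \<noteq> Band"
  shows "nu_word (replicate m Band @ t) = of_real (nc_moment v m) * nu_word t"
proof -
  obtain L xs where tL: "t = L # xs" using t(2) by (cases t) auto
  have L: "L \<noteq> Band" "left_dir L \<noteq> Some 0" "right_dir L \<noteq> Some 0" "valid xs" using t by (auto simp: tL valid_def)
  have comm: "nu_word (replicate m Band @ t) = nu_word (L # xs @ replicate m Band)"
    unfolding tL by (subst nu_word_commute) simp
  show ?thesis
  proof (cases xs rule: rev_cases)
    case Nil
    have "nu_word (L # replicate m' Band) = of_real (nc_moment v m' * (if right_dir L = left_dir L then 1 else 0))" for m'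
      by (rule nu_word_unit(2)[OF L(1) band_form_conv]) (use L in auto)
    from this[of m] this[of 0] show ?thesis unfolding comm unfolding tL Nil
      by (simp add: nc_moment_def pairings_empty crossing_def)
  next
    case (snoc ys R)
    have R: "R \<noteq> Band" "left_dir R \<noteq> Some 0" "right_dir R \<noteq> Some 0" "valid ys"
      using t L(4) by (auto simp: tL snoc valid_def)
    obtain y where y: "conv_moments (\<lambda>N. word_form N (right_dir L) ys (left_dir R)) y"
      using word_form_conv R L by blast
    have "nu_word (L # ys @ R # replicate m' Band) =
      y * of_real (nc_moment v m' * (if right_dir R = left_dir L then 1 else 0))" for m'
    proof (rule nu_word_unit(2)[OF L(1)])
      show "conv_moments (\<lambda>N. word_form N (right_dir L) (ys @ R # replicate m' Band) (left_dir L))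
        (y * of_real (nc_moment v m' * (if right_dir R = left_dir L then 1 else 0)))"
        unfolding word_form_split[OF R(1), abs_def]
        by (intro conv_moments_mult y band_form_conv) (use R L in auto)
    qed
    from this[of m] this[of 0] show ?thesis unfolding comm unfolding tL snoc
      by (simp add: nc_moment_def pairings_empty crossing_def)
  qed
qed

text \<open>Between neighbouring rank one letters stands an empty band block, whose form is the
  inner product of two different directions and tends to 0.\<close>

lemma nu_word_orthogonal:
  assumes "valid (u @ L # R # w)" "L \<noteq> Band" "R \<noteq> Band" "right_dir L \<noteq> left_dir R"
  shows "nu_word (u @ L # R # w) = 0"
proof -
  have v: "left_dir L \<noteq> Some 0" "right_dir L \<noteq> Some 0" "left_dir R \<noteq> Some 0" "right_dir R \<noteq> Some 0" "valid (w @ u)"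
    using assms(1) by (auto simp: valid_def)
  obtain y where y: "conv_moments (\<lambda>N. word_form N (right_dir R) (w @ u) (left_dir L)) y"
    using word_form_conv v by blast
  have "nu_word (L # [] @ R # w @ u) = of_real (nc_moment v 0 * (if right_dir L = left_dir R then 1 else 0)) * y"
  proof (rule nu_word_unit(2)[OF assms(2)])
    show "conv_moments (\<lambda>N. word_form N (right_dir L) ([] @ R # w @ u) (left_dir L))
      (of_real (nc_moment v 0 * (if right_dir L = left_dir R then 1 else 0)) * y)"
      unfolding word_form_split[OF assms(3), abs_def]
      using conv_moments_mult[OF band_form_conv[of "right_dir L" "left_dir R" 0] y] v by simp
  qed
  then show ?thesis using assms(4) nu_word_commute[of u "L # R # w"] by simp
qed

end

section \<open>The limiting functionals\<close>

definition nc_linear :: "('i list \<Rightarrow> complex) \<Rightarrow> 'i nc_poly \<Rightarrow> complex" where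
  "nc_linear f P = (\<Sum>w\<in>Poly_Mapping.keys P. Poly_Mapping.lookup P w * f (letters w))"

lemma nc_linear_superset:
  assumes "finite A" "Poly_Mapping.keys P \<subseteq> A"
  shows "nc_linear f P = (\<Sum>w\<in>A. Poly_Mapping.lookup P w * f (letters w))"
  unfolding nc_linear_def using assms by (intro sum.mono_neutral_left) (auto simp: in_keys_iff)

lemma nc_linear_add: "nc_linear f (P + Q) = nc_linear f P + nc_linear f Q"
proof -
  let ?A = "Poly_Mapping.keys P \<union> Poly_Mapping.keys Q"
  have "Poly_Mapping.keys (P + Q) \<subseteq> ?A" by (rule Poly_Mapping.keys_add)
  then show ?thesis
    by (simp add: nc_linear_superset[of ?A] lookup_add distrib_right sum.distrib)
qed

lemma nc_linear_zero [simp]: "nc_linear f 0 = 0"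
  by (simp add: nc_linear_def)

lemma nc_linear_sum: "nc_linear f (\<Sum>x\<in>A. P x) = (\<Sum>x\<in>A. nc_linear f (P x))"
  by (induction A rule: infinite_finite_induct) (simp_all add: nc_linear_add)

lemma nc_linear_single: "nc_linear f (Poly_Mapping.single w c) = c * f (letters w)"
  by (cases "c = 0") (simp_all add: nc_linear_def)

lemma poly_sum_single: "(\<Sum>w\<in>Poly_Mapping.keys P. Poly_Mapping.single w (Poly_Mapping.lookup P w)) = (P :: 'i nc_poly)"
  by (intro poly_mapping_eqI) (auto simp: lookup_sum lookup_single when_def sum.delta in_keys_iff)

lemma nc_linear_mult:
  "nc_linear f (P * Q) = (\<Sum>u\<in>Poly_Mapping.keys P. \<Sum>w\<in>Poly_Mapping.keys Q.
     Poly_Mapping.lookup P u * Poly_Mapping.lookup Q w * f (letters u @ letters w))"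
proof -
  have "P * Q = (\<Sum>u\<in>Poly_Mapping.keys P. \<Sum>w\<in>Poly_Mapping.keys Q.
      Poly_Mapping.single (u + w) (Poly_Mapping.lookup P u * Poly_Mapping.lookup Q w))"
    by (subst (1 2) poly_sum_single[symmetric]) (simp add: sum_product mult_single)
  then show ?thesis by (simp add: nc_linear_sum nc_linear_single plus_nc_monomial_def)
qed

lemma nc_linear_scale: "nc_linear f (nc_scale c P) = c * nc_linear f P"
proof (cases "c = 0")
  case False
  then show ?thesis
    unfolding nc_scale_def nc_linear_mult
    by (simp add: zero_nc_monomial_def sum_distrib_left nc_linear_def mult.assoc)
qed (simp add: nc_scale_def)

lemma nc_linear_one: "nc_linear f 1 = f []"
  unfolding single_one[symmetric] nc_linear_single by (simp add: zero_nc_monomial_def)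

lemma nc_linear_mult_commute:
  assumes "\<And>u w. f (u @ w) = f (w @ u)"
  shows "nc_linear f (P * Q) = nc_linear f (Q * P)"
  unfolding nc_linear_mult
  by (subst sum.swap) (intro sum.cong refl mult.commute assms arg_cong2[of _ _ _ _ "(*)"])

lemma nc_linear_eq_0: "(\<And>w. w \<in> Poly_Mapping.keys P \<Longrightarrow> f (letters w) = 0) \<Longrightarrow> nc_linear f P = 0"
  by (simp add: nc_linear_def)

text \<open>Lets properties of words, such as the kind of the first letter, pass to products of
  polynomials, where functionals given on words are then evaluated.\<close>

definition words_in :: "('i list \<Rightarrow> bool) \<Rightarrow> 'i nc_poly \<Rightarrow> bool" where
  "words_in R P \<longleftrightarrow> (\<forall>w\<in>Poly_Mapping.keys P. R (letters w))"

lemma words_in_mult: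
  assumes "words_in R P" "words_in R' Q" "\<And>u w. R u \<Longrightarrow> R' w \<Longrightarrow> R'' (u @ w)"
  shows "words_in R'' (P * Q)"
  unfolding words_in_def
proof
  fix w assume "w \<in> Poly_Mapping.keys (P * Q)"
  then obtain u u' where "w = u + u'" "u \<in> Poly_Mapping.keys P" "u' \<in> Poly_Mapping.keys Q"
    using keys_mult[of P Q] by blast
  then show "R'' (letters w)" using assms by (auto simp: words_in_def plus_nc_monomial_def)
qed

lemma words_in_1: "R [] \<Longrightarrow> words_in R 1"
  unfolding words_in_def single_one[symmetric] by (simp add: zero_nc_monomial_def)

lemma words_in_polys: "P \<in> nc_polys I \<longleftrightarrow> words_in (\<lambda>w. set w \<subseteq> I) P"
  by (auto simp: nc_polys_def words_in_def)

lemma nc_polys_subalgebra: "nc_poly.unital_subalgebra (nc_polys I)"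
  unfolding nc_poly.unital_subalgebra_def nc_poly.subspace_def
proof (intro conjI ballI allI)
  show "0 \<in> nc_polys I" by (simp add: nc_polys_def)
  show "x + y \<in> nc_polys I" if "x \<in> nc_polys I" "y \<in> nc_polys I" for x y
    using that Poly_Mapping.keys_add[of x y] by (fastforce simp: nc_polys_def)
  have m: "x * y \<in> nc_polys I" if "x \<in> nc_polys I" "y \<in> nc_polys I" for x y
    using that unfolding words_in_polys by (rule words_in_mult) auto
  then show "x * y \<in> nc_polys I" if "x \<in> nc_polys I" "y \<in> nc_polys I" for x y using that by blast
  show "1 \<in> nc_polys I" unfolding words_in_polys by (rule words_in_1) simp
  show "nc_scale c x \<in> nc_polys I" if "x \<in> nc_polys I" for c x
    unfolding nc_scale_def by (rule m[OF _ that]) (auto simp: nc_polys_def zero_nc_monomial_def split: if_splits)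
qed

text \<open>Through this inclusion, identities for all polynomials in the letters of a family apply
  to the subalgebra generated by them.\<close>

lemma hull_nc_var_subset: "nc_poly.unital_subalgebra hull (nc_var ` S) \<subseteq> nc_polys S"
proof (rule hull_minimal)
  show "nc_var ` S \<subseteq> nc_polys S" by (auto simp: nc_var_def nc_polys_def split: if_splits)
qed (rule nc_polys_subalgebra)

lemma hull_subalgebra: "nc_poly.unital_subalgebra (nc_poly.unital_subalgebra hull S)"
proof (rule hull_in)
  fix F :: "'i nc_poly set set" assume "\<forall>f\<in>F. nc_poly.unital_subalgebra f"
  then have f: "0 \<in> f" "1 \<in> f" "\<And>x y. x \<in> f \<Longrightarrow> y \<in> f \<Longrightarrow> x + y \<in> f"
    "\<And>c x. x \<in> f \<Longrightarrow> nc_scale c x \<in> f" "\<And>x y. x \<in> f \<Longrightarrow> y \<in> f \<Longrightarrow> x * y \<in> f" if "f \<in> F" for f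
    using that unfolding nc_poly.unital_subalgebra_def nc_poly.subspace_def by simp_all
  then show "nc_poly.unital_subalgebra (\<Inter> F)"
    unfolding nc_poly.unital_subalgebra_def nc_poly.subspace_def by (simp add: Inter_iff)
qed

lemma words_in_conj: "words_in R P \<Longrightarrow> words_in R' P \<Longrightarrow> words_in (\<lambda>w. R w \<and> R' w) P"
  by (auto simp: words_in_def)

lemma words_in_prod_list:
  assumes "\<And>P. P \<in> set Ps \<Longrightarrow> words_in R P" "R []" "\<And>u w. R u \<Longrightarrow> R w \<Longrightarrow> R (u @ w)"
  shows "words_in R (prod_list Ps)"
  using assms(1)
proof (induction Ps)
  case Nil
  show ?case using words_in_1[of R] assms(2) by simp
next
  case (Cons P Ps)
  have "words_in R (P * prod_list Ps)"
    by (rule words_in_mult[of R _ R]) (use Cons assms(3) in auto)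
  then show ?case by simp
qed

lemma words_in_True: "words_in (\<lambda>_. True) P"
  by (simp add: words_in_def)

section \<open>The freeness identities\<close>

context banded_model
begin

lemma nu_mult_band:
  assumes a: "a \<in> nc_polys {Band}"
    and T: "words_in (\<lambda>t. valid t \<and> t \<noteq> [] \<and> hd t \<noteq> Band \<and> last t \<noteq> Band) T"
  shows "nc_linear nu_word (a * T) = nc_linear mu_word a * nc_linear nu_word T"
proof -
  have "nu_word (letters u @ letters w) = mu_word (letters u) * nu_word (letters w)"
    if "u \<in> Poly_Mapping.keys a" "w \<in> Poly_Mapping.keys T" for u w
  proof -
    have u: "set (letters u) \<subseteq> {Band}" using a that by (auto simp: nc_polys_def)
    then have "mu_word (letters u) = of_real (nc_moment v (length (letters u)))" by (simp add: mu_word_def)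
    moreover have "nu_word (replicate (length (letters u)) Band @ letters w) =
        of_real (nc_moment v (length (letters u))) * nu_word (letters w)"
      using T that(2) by (intro nu_word_band) (auto simp: words_in_def)
    ultimately show ?thesis using only_band_replicate[OF u] by simp
  qed
  then have "nc_linear nu_word (a * T) = (\<Sum>u\<in>Poly_Mapping.keys a. \<Sum>w\<in>Poly_Mapping.keys T.
     (Poly_Mapping.lookup a u * mu_word (letters u)) * (Poly_Mapping.lookup T w * nu_word (letters w)))"
    unfolding nc_linear_mult by (intro sum.cong refl) simp
  then show ?thesis by (simp add: nc_linear_def sum_product)
qed

text \<open>\<open>None\<close> singles out the constant direction, so a matrix unit never shares a
  direction with the all-ones matrix. This is the source of orthogonality between the two rank one
  families.\<close>

lemma family_dirs:
  assumes "L \<in> family_indices N0 l"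
  shows "left_dir L \<noteq> Some 0" "right_dir L \<noteq> Some 0" "L = Band \<longleftrightarrow> l = BandFamily"
    "l \<noteq> BandFamily \<Longrightarrow> (left_dir L = None \<longleftrightarrow> l = OnesFamily)"
    "l \<noteq> BandFamily \<Longrightarrow> (right_dir L = None \<longleftrightarrow> l = OnesFamily)"
  using assms by (cases l; auto)+

text \<open>Outside the band family \<mu> sees only the constant coefficient, so centring removes
  the empty word, and all remaining words begin and end with a rank one letter.\<close>

lemma centred_words_nonempty:
  assumes a: "a \<in> nc_polys (family_indices N0 l)" "nc_linear mu_word a = 0" and l: "l \<noteq> BandFamily"
  shows "words_in (\<lambda>w. w \<noteq> [] \<and> set w \<subseteq> family_indices N0 l) a"
proof -
  have mu: "mu_word (letters w) = (if w = 0 then 1 else 0)" if "w \<in> Poly_Mapping.keys a" for w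
  proof (cases "letters w")
    case Nil
    then have "w = 0" by (cases w) (simp add: zero_nc_monomial_def)
    then show ?thesis by (simp add: mu_word_def zero_nc_monomial_def nc_moment_def pairings_empty crossing_def)
  next
    case (Cons x xs)
    then have "x \<in> family_indices N0 l" using a(1) that by (force simp: nc_polys_def)
    then have "x \<noteq> Band" using family_dirs(3) l by blast
    moreover have "w \<noteq> 0" using Cons by (auto simp: zero_nc_monomial_def)
    ultimately show ?thesis using Cons by (simp add: mu_word_def)
  qed
  have "nc_linear mu_word a = (\<Sum>w\<in>Poly_Mapping.keys a. if w = 0 then Poly_Mapping.lookup a w else 0)"
    unfolding nc_linear_def using mu by (intro sum.cong refl) simp
  also have "\<dots> = Poly_Mapping.lookup a 0" by (simp add: sum.delta in_keys_iff)
  finally have "0 \<notin> Poly_Mapping.keys a" using a(2) by (simp add: in_keys_iff)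
  then show ?thesis using a(1)
    by (auto simp: words_in_def nc_polys_def) (metis nc_monomial.collapse zero_nc_monomial_def)
qed

text \<open>\<mu> vanishes once some factor is not a band factor, and two consecutive factors
  contain such a one. For \<nu>, a band factor that is cyclically between rank one factors comes out
  as \<mu> (a m) = 0, and neighbouring rank one factors are orthogonal. What survives is band, rank
  one, band, because the outer factors merge cyclically into a product that need not be
  centred.\<close>

lemma alternating_products:
  fixes i :: "nat \<Rightarrow> family_label" and a :: "nat \<Rightarrow> model_index nc_poly"
  defines "\<mu> \<equiv> nc_linear mu_word" and "\<nu> \<equiv> nc_linear nu_word"
  assumes k: "k \<ge> 2"
    and a: "\<And>j. j < k \<Longrightarrow> a j \<in> nc_polys (family_indices N0 (i j))" "\<And>j. j < k \<Longrightarrow> \<mu> (a j) = 0"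
    and alt: "\<And>j. Suc j < k \<Longrightarrow> i j \<noteq> i (Suc j)"
  shows "\<mu> (prod_list (map a [0..<k])) = 0"
    and "\<nu> (prod_list (map a [0..<k])) =
      (\<Sum>j<k. \<nu> (a j) * \<mu> (prod_list (map a ([0..<j] @ [Suc j..<k]))))"
proof -
  define pr where "pr = (\<lambda>js. prod_list (map a js))"
  have pr_append: "pr (js @ ks) = pr js * pr ks" for js ks by (simp add: pr_def)
  have pr_single: "pr [j] = a j" for j by (simp add: pr_def)
  have band: "a j \<in> nc_polys {Band}" if "j < k" "i j = BandFamily" for j
    using a(1)[OF that(1)] that by simp
  have nonempty: "words_in (\<lambda>w. w \<noteq> [] \<and> set w \<subseteq> family_indices N0 (i j)) (a j)" if "j < k" "i j \<noteq> BandFamily" for j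
    using centred_words_nonempty[OF a(1)[OF that(1)] a(2)[OF that(1), unfolded \<mu>_def] that(2)] .
  have valid_pr: "words_in valid (pr js)" if "set js \<subseteq> {..<k}" for js
    unfolding pr_def
  proof (rule words_in_prod_list)
    fix P assume "P \<in> set (map a js)"
    then obtain j where "j \<in> set js" "P = a j" by auto
    then have j: "j < k" "P = a j" using that by auto
    then show "words_in valid P"
      using a(1)[OF j(1)] family_dirs(1,2) by (fastforce simp: words_in_def nc_polys_def valid_def)
  qed (auto simp: valid_def)
  have start: "words_in (\<lambda>w. w \<noteq> [] \<and> hd w \<noteq> Band) (pr (j # js))" if "j < k" "i j \<noteq> BandFamily" for j js
  proof -
    have "words_in (\<lambda>w. w \<noteq> [] \<and> hd w \<noteq> Band) (a j * pr js)"
    proof (rule words_in_mult[OF nonempty[OF that] words_in_True])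
      fix u w assume "u \<noteq> [] \<and> set u \<subseteq> family_indices N0 (i j)"
      then have u: "u \<noteq> []" "hd u \<in> family_indices N0 (i j)" using hd_in_set[of u] by auto
      then show "u @ w \<noteq> [] \<and> hd (u @ w) \<noteq> Band" using family_dirs(3)[OF u(2)] that(2) by simp
    qed
    then show ?thesis by (simp add: pr_def)
  qed
  have finish: "words_in (\<lambda>w. w \<noteq> [] \<and> last w \<noteq> Band) (pr (js @ [j]))" if "j < k" "i j \<noteq> BandFamily" for j js
    unfolding pr_append pr_single
  proof (rule words_in_mult[OF words_in_True nonempty[OF that]])
    fix u w assume "w \<noteq> [] \<and> set w \<subseteq> family_indices N0 (i j)"
    then have w: "w \<noteq> []" "last w \<in> family_indices N0 (i j)" using last_in_set[of w] by auto
    then show "u @ w \<noteq> [] \<and> last (u @ w) \<noteq> Band" using family_dirs(3)[OF w(2)] that(2) by simp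
  qed
  have mu0: "\<mu> (pr js) = 0" if "set js \<subseteq> {..<k}" "j \<in> set js" "i j \<noteq> BandFamily" for js j
  proof -
    from that(2) obtain us ws where js: "js = us @ j # ws" by (meson split_list)
    have "j < k" using that by auto
    have "words_in (\<lambda>w. \<not> set w \<subseteq> {Band}) (pr us * pr (j # ws))"
      by (rule words_in_mult[OF words_in_True start[OF \<open>j < k\<close> that(3)]]) (auto dest: hd_in_set)
    then show ?thesis unfolding js pr_append \<mu>_def
      by (intro nc_linear_eq_0) (auto simp: words_in_def mu_word_def)
  qed
  have comm: "\<nu> (P * Q) = \<nu> (Q * P)" "\<mu> (P * Q) = \<mu> (Q * P)" for P Q
    unfolding \<mu>_def \<nu>_def by (intro nc_linear_mult_commute nu_word_commute mu_word_commute)+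
  have pull: "\<nu> (P * pr js) = \<mu> P * \<nu> (pr js)"
    if "P \<in> nc_polys {Band}" "set js \<subseteq> {..<k}" "js \<noteq> []" "i (hd js) \<noteq> BandFamily" "i (last js) \<noteq> BandFamily" for P js
    unfolding \<mu>_def \<nu>_def
  proof (rule nu_mult_band[OF that(1)])
    have "hd js < k" "last js < k" using that(2) hd_in_set[OF that(3)] last_in_set[OF that(3)] by auto
    then have "words_in (\<lambda>w. w \<noteq> [] \<and> hd w \<noteq> Band) (pr js)" "words_in (\<lambda>w. w \<noteq> [] \<and> last w \<noteq> Band) (pr js)"
      using start[of "hd js" "tl js"] finish[of "last js" "butlast js"] that by simp_all
    then show "words_in (\<lambda>t. valid t \<and> t \<noteq> [] \<and> hd t \<noteq> Band \<and> last t \<noteq> Band) (pr js)"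
      using valid_pr[OF that(2)] by (simp add: words_in_def)
  qed
  \<comment> \<open>The words of both factors are nonempty, so a last letter from one family meets a
    first letter from the other; different families have different directions.\<close>
  have orth: "\<nu> (pr (js @ j # Suc j # ks)) = 0"
    if "set (js @ j # Suc j # ks) \<subseteq> {..<k}" "i j \<noteq> BandFamily" "i (Suc j) \<noteq> BandFamily" for js j ks
  proof -
    have jk: "j < k" "Suc j < k" using that by auto
    have ne: "i j \<noteq> i (Suc j)" using alt jk by blast
    define R where "R = (\<lambda>w. \<exists>u L R z. w = u @ L # R # z \<and> L \<noteq> Band \<and> R \<noteq> Band \<and> right_dir L \<noteq> left_dir R)"
    have "words_in R (a j * a (Suc j))"
    proof (rule words_in_mult[OF nonempty[OF jk(1) that(2)] nonempty[OF jk(2) that(3)]])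
      fix u w assume u: "u \<noteq> [] \<and> set u \<subseteq> family_indices N0 (i j)"
        and w: "w \<noteq> [] \<and> set w \<subseteq> family_indices N0 (i (Suc j))"
      have L: "last u \<in> family_indices N0 (i j)" "hd w \<in> family_indices N0 (i (Suc j))"
        using u w last_in_set[of u] hd_in_set[of w] by auto
      have "u @ w = butlast u @ last u # hd w # tl w" using u w by simp
      moreover have "last u \<noteq> Band" "hd w \<noteq> Band"
        using family_dirs(3)[OF L(1)] family_dirs(3)[OF L(2)] that by auto
      moreover have "right_dir (last u) \<noteq> left_dir (hd w)"
      proof
        assume e: "right_dir (last u) = left_dir (hd w)"
        then have "i j = OnesFamily \<longleftrightarrow> i (Suc j) = OnesFamily"
          using family_dirs(5)[OF L(1) that(2)] family_dirs(4)[OF L(2) that(3)] by simp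
        then show False using ne that(2,3) by (cases "i j"; cases "i (Suc j)"; simp)
      qed
      ultimately show "R (u @ w)" unfolding R_def by blast
    qed
    then have "words_in R (pr js * (a j * a (Suc j)))"
    proof (rule words_in_mult[OF words_in_True])
      fix u w assume "R w"
      then show "R (u @ w)" unfolding R_def by (metis append.assoc)
    qed
    then have "words_in R (pr js * (a j * a (Suc j)) * pr ks)"
    proof (rule words_in_mult[OF _ words_in_True])
      fix u w assume "R u"
      then show "R (u @ w)" unfolding R_def by (metis append.assoc append_Cons)
    qed
    then have "words_in R (pr (js @ j # Suc j # ks))" by (simp add: pr_def mult.assoc)
    then have "words_in (\<lambda>w. valid w \<and> R w) (pr (js @ j # Suc j # ks))"
      by (intro words_in_conj valid_pr that(1))
    then show ?thesis unfolding \<nu>_def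
    proof (intro nc_linear_eq_0)
      fix w assume "w \<in> Poly_Mapping.keys (pr (js @ j # Suc j # ks))"
      then have "valid (letters w) \<and> R (letters w)"
        using \<open>words_in (\<lambda>w. valid w \<and> R w) _\<close> by (simp add: words_in_def)
      then show "nu_word (letters w) = 0" unfolding R_def using nu_word_orthogonal by auto
    qed
  qed
  define b where "b = (\<lambda>j. i j = BandFamily)"
  have alt_b: "\<not> (b j \<and> b (Suc j))" if "Suc j < k" for j using alt[OF that] by (auto simp: b_def)
  have split0: "[0..<k] = [0..<j] @ j # [Suc j..<k]" if "j < k" for j
    using that upt_add_eq_append[of 0 j "k - j"] upt_conv_Cons[of j k] by simp
  show "\<mu> (prod_list (map a [0..<k])) = 0"
  proof (cases "b 0")
    case True
    then have "i 1 \<noteq> BandFamily" using alt_b[of 0] k by (simp add: b_def)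
    then show ?thesis using mu0[of "[0..<k]" 1] k unfolding pr_def by (simp add: atLeast0LessThan)
  next
    case False
    then show ?thesis using mu0[of "[0..<k]" 0] k unfolding pr_def b_def by (simp add: atLeast0LessThan)
  qed
  \<comment> \<open>Only band factors may be left after removing \<open>a j\<close>. By alternation,
    either \<open>k = 2\<close> and the one remaining factor is centred, or the pattern is the
    excluded one.\<close>
  have rhs: "(\<Sum>j<k. \<nu> (a j) * \<mu> (pr ([0..<j] @ [Suc j..<k]))) = 0" if "\<not> (k = 3 \<and> b 0 \<and> b 2)"
  proof (intro sum.neutral ballI)
    fix j assume "j \<in> {..<k}"
    then have j: "j < k" by simp
    let ?js = "[0..<j] @ [Suc j..<k]"
    have "\<mu> (pr ?js) = 0"
    proof (cases "\<exists>t<k. t \<noteq> j \<and> \<not> b t")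
      case True
      then obtain t where "t < k" "t \<noteq> j" "\<not> b t" by blast
      then show ?thesis using j by (intro mu0[of ?js t]) (auto simp: b_def)
    next
      case False
      then have all: "b t" if "t < k" "t \<noteq> j" for t using that by blast
      have "k = 2"
      proof (rule ccontr)
        assume "k \<noteq> 2"
        then consider "k = 3" "j = 0" | "k = 3" "j = 1" | "k = 3" "j = 2" | "k > 3" "j \<le> 1" | "k > 3" "j \<ge> 2"
          using k j by linarith
        then show False
        proof cases
          case 1 then show ?thesis using all[of 1] all[of 2] alt_b[of 1] by (simp add: numeral_2_eq_2)
        next
          case 2 then show ?thesis using all[of 0] all[of 2] that by simp
        next
          case 3 then show ?thesis using all[of 0] all[of 1] alt_b[of 0] by simp
        next
          case 4 then show ?thesis using all[of 2] all[of 3] alt_b[of 2] by (simp add: numeral_3_eq_3 numeral_2_eq_2)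
        next
          case 5 then show ?thesis using all[of 0] all[of 1] alt_b[of 0] by simp
        qed
      qed
      then have "?js = [1 - j]" using j by (cases "j = 0") (auto simp: numeral_2_eq_2 less_Suc_eq)
      then show ?thesis using a(2)[of "1 - j"] \<open>k = 2\<close> by (simp add: pr_single)
    qed
    then show "\<nu> (a j) * \<mu> (pr ?js) = 0" by simp
  qed
  have "\<nu> (pr [0..<k]) = (\<Sum>j<k. \<nu> (a j) * \<mu> (pr ([0..<j] @ [Suc j..<k])))"
  proof (cases "\<exists>m. 0 < m \<and> Suc m < k \<and> b m")
    case True
    then obtain m where m: "0 < m" "Suc m < k" "b m" by blast
    have nb: "\<not> b (m - 1)" "\<not> b (Suc m)" using alt_b[of "m - 1"] alt_b[of m] m by auto
    have l0: "last [0..<m] = m - 1" "hd [Suc m..<k] = Suc m" "[0..<m] \<noteq> []" "[Suc m..<k] \<noteq> []"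
      using m by (auto simp: last_conv_nth)
    \<comment> \<open>Rotation brings the band factor to the front; the rest then begins at
      \<open>Suc m\<close> and ends at \<open>m - 1\<close>, both of rank one type.\<close>
    have "\<nu> (pr [0..<k]) = \<nu> (pr [0..<m] * (a m * pr [Suc m..<k]))"
      using split0[of m] m by (simp add: pr_def)
    also have "\<dots> = \<nu> (a m * pr ([Suc m..<k] @ [0..<m]))"
      unfolding comm(1)[of "pr [0..<m]"] pr_append by (simp add: mult.assoc)
    also have "\<dots> = \<mu> (a m) * \<nu> (pr ([Suc m..<k] @ [0..<m]))"
      using m nb l0 by (intro pull band) (auto simp: b_def)
    also have "\<dots> = 0" using a(2)[of m] m by simp
    finally have "\<nu> (pr [0..<k]) = 0" .
    moreover have "\<not> (k = 3 \<and> b 0 \<and> b 2)"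
      using m nb by (auto simp: numeral_3_eq_3 numeral_2_eq_2 less_Suc_eq)
    ultimately show ?thesis using rhs by simp
  next
    case False
    then have inner: "\<not> b m" if "0 < m" "Suc m < k" for m using that by blast
    obtain l where l: "k = Suc l" "l \<ge> 1" using k by (cases k) auto
    have last: "[0..<k] = [0..<l] @ [l]" using l by simp
    have first: "[0..<k] = 0 # [1..<k]" using l by (simp add: upt_conv_Cons)
    consider "b 0" "\<not> b l" | "\<not> b 0" "b l" | "\<not> b 0" "\<not> b l" | "b 0" "b l" by blast
    then show ?thesis
    proof cases
      case 1
      have "\<not> b 1" using alt_b[of 0] 1 l by simp
      moreover have "hd [1..<k] = 1" "last [1..<k] = l" "[1..<k] \<noteq> []" "set [1..<k] \<subseteq> {..<k}" "0 < k"
        using l by (simp_all only: hd_upt last_upt) auto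
      ultimately have "\<nu> (a 0 * pr [1..<k]) = \<mu> (a 0) * \<nu> (pr [1..<k])"
        using 1 by (intro pull band) (simp_all only: b_def not_False_eq_True)
      then have "\<nu> (pr [0..<k]) = 0" using a(2)[of 0] l unfolding first by (simp add: pr_def)
      moreover have "\<not> (k = 3 \<and> b 0 \<and> b 2)" using 1 l by auto
      ultimately show ?thesis using rhs by simp
    next
      case 2
      have "\<not> b (l - 1)" using alt_b[of "l - 1"] 2 l by auto
      then have "\<nu> (a l * pr [0..<l]) = \<mu> (a l) * \<nu> (pr [0..<l])"
        using 2 l by (intro pull band) (auto simp: b_def last_conv_nth)
      then have "\<nu> (pr [0..<k]) = 0" using a(2)[of l] l comm(1)[of "pr [0..<l]" "a l"] unfolding last pr_append pr_single by simp
      moreover have "\<not> (k = 3 \<and> b 0 \<and> b 2)" using 2 by auto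
      ultimately show ?thesis using rhs by simp
    next
      \<comment> \<open>There is no band factor at all, so already the first two factors are
        orthogonal.\<close>
      case 3
      have "\<not> b 1" using inner[of 1] 3 l by (cases "l = 1") auto
      then have "\<nu> (pr ([] @ 0 # Suc 0 # [2..<k])) = 0" using 3 l by (intro orth) (auto simp: b_def)
      moreover have "[0..<k] = [] @ 0 # Suc 0 # [2..<k]" using l by (simp add: upt_conv_Cons numeral_2_eq_2)
      ultimately have "\<nu> (pr [0..<k]) = 0" by simp
      moreover have "\<not> (k = 3 \<and> b 0 \<and> b 2)" using 3 by auto
      ultimately show ?thesis using rhs by simp
    next
      \<comment> \<open>The two outer band factors are cyclic neighbours and are pulled out
        together.\<close>
      case 4
      have l2: "l \<ge> 2" using alt_b[of 0] 4 l by (cases "l = 1") auto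
      have nb: "\<not> b 1" "\<not> b (l - 1)" using inner[of 1] inner[of "l - 1"] l l2 by auto
      have mid: "[0..<k] = 0 # [1..<l] @ [l]" using l by (simp add: upt_conv_Cons)
      have "\<nu> (pr [0..<k]) = \<nu> (a 0 * (pr [1..<l] * a l))" unfolding mid by (simp add: pr_def)
      also have "\<dots> = \<nu> (pr [1..<l] * (a l * a 0))" by (subst comm(1)) (simp add: mult.assoc)
      also have "\<dots> = \<nu> ((a l * a 0) * pr [1..<l])" by (rule comm(1))
      also have "\<dots> = \<mu> (a l * a 0) * \<nu> (pr [1..<l])"
      proof (rule pull)
        have "a l \<in> nc_polys {Band}" "a 0 \<in> nc_polys {Band}" using 4 l by (auto simp: b_def intro!: band)
        then show "a l * a 0 \<in> nc_polys {Band}"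
          using nc_polys_subalgebra[of "{Band}"] unfolding nc_poly.unital_subalgebra_def by blast
        have "hd [1..<l] = 1" "last [1..<l] = l - 1" using l2 by (simp_all only: hd_upt last_upt)
        then show "i (hd [1..<l]) \<noteq> BandFamily" "i (last [1..<l]) \<noteq> BandFamily"
          using nb by (simp_all only: b_def not_False_eq_True)
      qed (use l l2 in auto)
      finally have E: "\<nu> (pr [0..<k]) = \<mu> (a l * a 0) * \<nu> (pr [1..<l])" .
      show ?thesis
      proof (cases "l = 2")
        case True
        have k3: "k = 3" using l True by simp
        \<comment> \<open>Of the three terms on the right only the one that removes the middle
          factor survives, and by traciality of \<mu> it is the value on the left.\<close>
        have "{..<k} = {0, 1, 2}" using k3 by auto
        then have "(\<Sum>j<k. \<nu> (a j) * \<mu> (pr ([0..<j] @ [Suc j..<k]))) =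
          \<nu> (a 0) * \<mu> (pr [1, 2]) + \<nu> (a 1) * \<mu> (pr [0, 2]) + \<nu> (a 2) * \<mu> (pr [0, 1])"
        proof -
          have js: "[0..<0] @ [Suc 0..<3] = [1, 2]" "[0..<1] @ [Suc 1..<3] = [0, 2]" "[0..<2] @ [Suc 2..<3] = [0, 1]"
            by (simp_all add: numeral_3_eq_3 numeral_2_eq_2)
          have "(\<Sum>j<k. f j) = f 0 + f 1 + f 2" for f :: "nat \<Rightarrow> complex"
            unfolding \<open>{..<k} = {0, 1, 2}\<close> by (simp add: add.assoc)
          then show ?thesis unfolding k3 by (simp only: js)
        qed
        also have "\<mu> (pr [1, 2]) = 0" using mu0[of "[1, 2]" 1] nb k3 by (auto simp: b_def)
        also have "\<mu> (pr [0, 1]) = 0" using mu0[of "[0, 1]" 1] nb k3 by (auto simp: b_def)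
        also have "\<mu> (pr [0, 2]) = \<mu> (a 2 * a 0)" using comm(2)[of "a 0" "a 2"] by (simp add: pr_def)
        finally have S: "(\<Sum>j<k. \<nu> (a j) * \<mu> (pr ([0..<j] @ [Suc j..<k]))) = \<nu> (a 1) * \<mu> (a 2 * a 0)"
          by (simp only: mult_zero_right add_0_left add_0_right)
        have "pr [1..<l] = a 1" unfolding True by (simp add: pr_def numeral_2_eq_2)
        then show ?thesis unfolding E S True by (simp only: mult.commute)
      next
        case False
        then have l3: "l \<ge> 3" using l2 by simp
        \<comment> \<open>The middle part now contains at least two factors, and its first two are
          neighbours of rank one type.\<close>
        then have "\<not> b 2" using inner[of 2] l by simp
        then have "\<nu> (pr ([] @ 1 # Suc 1 # [3..<l])) = 0" using nb l l3 by (intro orth) (auto simp: b_def numeral_2_eq_2)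
        moreover have "[1..<l] = [] @ 1 # Suc 1 # [3..<l]" using l3 by (simp add: upt_conv_Cons numeral_3_eq_3)
        ultimately have "\<nu> (pr [0..<k]) = 0" unfolding E by simp
        moreover have "\<not> (k = 3 \<and> b 0 \<and> b 2)" using l l3 by auto
        ultimately show ?thesis using rhs by simp
      qed
    qed
  qed
  then show "\<nu> (prod_list (map a [0..<k])) =
      (\<Sum>j<k. \<nu> (a j) * \<mu> (prod_list (map a ([0..<j] @ [Suc j..<k]))))"
    unfolding pr_def .
qed

lemma mean_distr_eq:
  assumes "N > 0"
  shows "prob_space.mean_distr (M N) N (model X b N) P =
    (\<Sum>w\<in>Poly_Mapping.keys P. Poly_Mapping.lookup P w * mean_word (letters w) N)"
proof -
  interpret prob_space "M N" by (rule prob) fact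
  have em: "eval_monomial N (\<lambda>i. model X b N i \<omega>) w = word_mat N (letters w) \<omega>" for w \<omega>
    by (simp add: word_mat_def)
  have tr: "mat_trace (eval_poly N (\<lambda>i. model X b N i \<omega>) P) =
    (\<Sum>w\<in>Poly_Mapping.keys P. Poly_Mapping.lookup P w * mat_trace (word_mat N (letters w) \<omega>))" for \<omega>
  proof -
    have "mat_trace (eval_poly N (\<lambda>i. model X b N i \<omega>) P) =
      (\<Sum>r<N. \<Sum>w\<in>Poly_Mapping.keys P. Poly_Mapping.lookup P w * word_mat N (letters w) \<omega> $$ (r, r))"
      by (simp add: mat_trace_def eval_poly_def em)
    also have "\<dots> = (\<Sum>w\<in>Poly_Mapping.keys P. \<Sum>r<N. Poly_Mapping.lookup P w * word_mat N (letters w) \<omega> $$ (r, r))"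
      by (rule sum.swap)
    also have "\<dots> = (\<Sum>w\<in>Poly_Mapping.keys P. Poly_Mapping.lookup P w * mat_trace (word_mat N (letters w) \<omega>))"
      using carrier_matD(1)[OF word_mat_carrier] by (simp add: mat_trace_def sum_distrib_left)
    finally show ?thesis .
  qed
  have "mean_distr N (model X b N) P = 1 / of_nat N *
    (\<Sum>w\<in>Poly_Mapping.keys P. \<integral>\<omega>. Poly_Mapping.lookup P w * mat_trace (word_mat N (letters w) \<omega>) \<partial>M N)"
    unfolding mean_distr_def tr
    by (subst Bochner_Integration.integral_sum)
       (auto intro!: all_moments_integrable all_moments_mult all_moments_const trace_all_moments assms)
  then show ?thesis by (simp add: mean_word_def sum_distrib_left mult_ac)
qed

lemma nu_word_Nil: "nu_word [] = 0"
proof -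
  have "(\<lambda>N. of_nat N * (mean_word [] N - mu_word [])) \<longlonglongrightarrow> 0"
  proof (rule tendsto_eventually)
    show "\<forall>\<^sub>F N in sequentially. of_nat N * (mean_word [] N - mu_word []) = 0"
      using eventually_gt_at_top[of 0]
    proof eventually_elim
      case (elim N)
      have "mean_word [] N = 1"
        using elim prob_space.prob_space[OF prob[OF elim]] by (simp add: mean_word_def word_mat_Nil mat_trace_def)
      moreover have "mu_word [] = 1" by (simp add: mu_word_def nc_moment_def pairings_empty crossing_def)
      ultimately show ?case by simp
    qed
  qed
  moreover have "valid []" by (simp add: valid_def)
  ultimately show ?thesis using nu_word_lim LIMSEQ_unique by blast
qed

lemma asymptotically_free:
  "asymptotically_infinitesimally_free M (model X b)
     {BandFamily, UnitFamily, OnesFamily} (family_indices N0)"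
proof -
  define L where "L = {BandFamily, UnitFamily, OnesFamily}"
  define I where "I = (\<Union>l\<in>L. family_indices N0 l)"
  let ?\<mu> = "nc_linear mu_word" and ?\<nu> = "nc_linear nu_word"
  have sub: "family_indices N0 l \<subseteq> I" for l by (cases l) (auto simp: I_def L_def)
  have disj: "disjoint_family_on (family_indices N0) L"
    by (auto simp: disjoint_family_on_def L_def)
  have moments: "prob_space.random_matrix (M N) N (model X b N j) \<and> prob_space.has_all_moments (M N) N (model X b N j)"
    if "N > 0" for N j
  proof -
    interpret prob_space "M N" by (rule prob) fact
    show ?thesis
      using model_all_moments[OF that, of _ _ j] all_moments_measurable all_moments_power
      by (auto simp: random_matrix_def has_all_moments_def)
  qed
  have limits: "(\<lambda>N. prob_space.mean_distr (M N) N (model X b N) P) \<longlonglongrightarrow> ?\<mu> P \<and>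
      (\<lambda>N. of_nat N * (prob_space.mean_distr (M N) N (model X b N) P - ?\<mu> P)) \<longlonglongrightarrow> ?\<nu> P"
    if P: "P \<in> nc_polys I" for P
  proof
    let ?K = "Poly_Mapping.keys P" and ?c = "Poly_Mapping.lookup P"
    \<comment> \<open>The families number the coordinates from 1, so the direction
      \<open>Some 0\<close> does not occur.\<close>
    have valid: "valid (letters w)" if "w \<in> ?K" for w
    proof -
      have "set (letters w) \<subseteq> I" using P that by (auto simp: nc_polys_def)
      then show ?thesis unfolding valid_def I_def using family_dirs(1,2) by blast
    qed
    have "(\<lambda>N. \<Sum>w\<in>?K. ?c w * mean_word (letters w) N) \<longlonglongrightarrow> (\<Sum>w\<in>?K. ?c w * mu_word (letters w))"
      by (intro tendsto_sum tendsto_mult tendsto_const mean_word_lim valid)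
    then show "(\<lambda>N. prob_space.mean_distr (M N) N (model X b N) P) \<longlonglongrightarrow> ?\<mu> P"
      unfolding nc_linear_def
    proof (rule Lim_transform_eventually)
      show "\<forall>\<^sub>F N in sequentially. (\<Sum>w\<in>?K. ?c w * mean_word (letters w) N) = prob_space.mean_distr (M N) N (model X b N) P"
        using eventually_gt_at_top[of 0] by eventually_elim (simp add: mean_distr_eq)
    qed
    have "(\<lambda>N. \<Sum>w\<in>?K. ?c w * (of_nat N * (mean_word (letters w) N - mu_word (letters w)))) \<longlonglongrightarrow>
        (\<Sum>w\<in>?K. ?c w * nu_word (letters w))"
      by (intro tendsto_sum tendsto_mult tendsto_const nu_word_lim valid)
    then show "(\<lambda>N. of_nat N * (prob_space.mean_distr (M N) N (model X b N) P - ?\<mu> P)) \<longlonglongrightarrow> ?\<nu> P"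
      unfolding nc_linear_def
    proof (rule Lim_transform_eventually)
      show "\<forall>\<^sub>F N in sequentially. (\<Sum>w\<in>?K. ?c w * (of_nat N * (mean_word (letters w) N - mu_word (letters w)))) =
          of_nat N * (prob_space.mean_distr (M N) N (model X b N) P - (\<Sum>w\<in>?K. ?c w * mu_word (letters w)))"
        using eventually_gt_at_top[of 0]
        by eventually_elim (simp add: mean_distr_eq sum_subtractf[symmetric] sum_distrib_left algebra_simps)
    qed
  qed
  have space: "inf_nc_prob_space nc_scale (nc_polys I) ?\<mu> ?\<nu>"
  proof (intro inf_nc_prob_space.intro inf_nc_prob_space_axioms.intro)
    show "complex_algebra (nc_scale :: complex \<Rightarrow> model_index nc_poly \<Rightarrow> _)" by (rule nc_poly.complex_algebra_axioms)
    show "nc_poly.unital_subalgebra (nc_polys I)" by (rule nc_polys_subalgebra)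
    show "?\<mu> 1 = 1" by (simp add: nc_linear_one mu_word_def nc_moment_def pairings_empty crossing_def)
    show "?\<nu> 1 = 0" by (simp add: nc_linear_one nu_word_Nil)
  qed (simp_all add: nc_linear_add nc_linear_scale)
  then interpret inf_nc_prob_space nc_scale "nc_polys I" ?\<mu> ?\<nu> .
  have "collections_infinitesimally_free L (\<lambda>l. nc_var ` family_indices N0 l)"
    unfolding collections_infinitesimally_free_def infinitesimally_free_def
  proof (intro conjI ballI allI impI, goal_cases)
    case (1 l)
    show ?case by (rule hull_subalgebra)
  next
    case (2 l)
    have "nc_polys (family_indices N0 l) \<subseteq> nc_polys I" using sub by (fastforce simp: nc_polys_def)
    then show ?case using hull_nc_var_subset by blast
  next
    case (3 k i a)
    then show ?case using hull_nc_var_subset by (intro alternating_products(1)[of k a N0 i]) blast+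
  next
    case (4 k i a)
    then show ?case using hull_nc_var_subset by (intro alternating_products(2)[of k a N0 i]) blast+
  qed
  then show ?thesis
    unfolding asymptotically_infinitesimally_free_def Let_def L_def[symmetric] I_def[symmetric]
    using disj moments limits space by blast
qed

end

theorem theorem1p18:
  fixes M :: "nat \<Rightarrow> 'w measure"
    and X :: "nat \<Rightarrow> 'w \<Rightarrow> complex mat"
    and b :: "nat \<Rightarrow> nat"
    and v :: real
    and N0 :: nat
  assumes "v > 0"
    and "\<And>N. N > 0 \<Longrightarrow> prob_space (M N)"
    and "\<And>N. N > 0 \<Longrightarrow> prob_space.gue (M N) N v (X N)"
    and "filterlim b at_top sequentially"
    and "filterlim (\<lambda>N. real (b N) / sqrt (real N)) at_top sequentially \<or>
         (\<exists>c>0. (\<lambda>N. real (b N) / sqrt (real N)) \<longlonglongrightarrow> c)"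
  shows "asymptotically_infinitesimally_free M (model X b)
           {BandFamily, UnitFamily, OnesFamily} (family_indices N0)"
proof -
  interpret banded_model M X b v
    by (intro banded_model.intro prob_sequence.intro banded_model_axioms.intro) (fact assms)+
  show ?thesis by (rule asymptotically_free)
qed

end
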